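(* Let $N\ge1$, $k\ge1$ be integers, $1<p<\infty$, $q=p/(p-1)$, $\kappa_0>0$ and $\theta_0\in(0,1]$. There is a constant $C=C(N,k,q,\theta_0,\kappa_0)$, independent of $\theta_0$ when $k=1$, such that the following holds. Let $\Omega_h$ be a conforming simplicial mesh of $\Omega\subset\mathbb{R}^N$ that is shape regular, i.e. $|M_K|\,|M_K^{-1}|\le\kappa_0$ for all $K\in\Omega_h$. Let $\beta$ be an advection field that is constant on each element, $\beta|_K\equiv\beta_K\in\mathbb{R}^N\setminus\{0\}$, with continuous normal component across element interfaces. Suppose that either $k=1$, or $|\beta_K\cdot n_i|\ge\theta_0|\beta_K|$ for every $K\in\Omega_h$ and every facet $F_i$ of $K$. Then for all $K\in\Omega_h$ and all $v\in W_q(\partial_\beta,K)$, $$|\!|\!|\varPi_K v|\!|\!|_{q,K}\le C\,|\!|\!|v|\!|\!|_{q,K}.$$ Consequently $|\!|\!|\varPi_h v|\!|\!|_{q,\Omega_h}\le C\,|\!|\!|v|\!|\!|_{q,\Omega_h}$ for all $v\in W_q(\partial_\beta,\Omega_h)$. Moreover, if $v\in W_q(\partial_\beta,K)$ is such that $$(z,v)_K=0\ \text{ for all } z\in P_{k-2}(K),\qquad (\beta\cdot\nabla w,v)_K=0\ \text{ for all } w\in P_k^\perp(K),$$ then, with $a_K:=h_K/|\beta_K|$, $$\|\varPi_K v\|_{L_q(K)}\le C\,a_K\,\|\beta\cdot\nabla v\|_{L_q(K)},\qquad \|\beta\cdot\nabla\varPi_K v\|_{L_q(K)}\le C\,\|\beta\cdot\nabla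 v\|_{L_q(K)}.$$
   Context: $\Omega\subset\mathbb{R}^N$ is a Lipschitz polyhedral domain. $\hat K$ is the unit reference $N$-simplex with vertices $\hat a_0,\dots,\hat a_N$. Each element $K\in\Omega_h$, with vertices $a_0,\dots,a_N$, is the image of $\hat K$ under an affine homeomorphism $\Phi_K(\hat x)=M_K\hat x+g_K$ mapping $\hat a_i$ to $a_i$; $h_K=\operatorname{diam}K$. $|\cdot|$ is the Euclidean norm of vectors and the associated matrix norm. $\lambda_0,\dots,\lambda_N$ are the barycentric coordinates of $K$, $F_i$ is the facet of $K$ opposite $a_i$, and $n_i$ is the outward unit normal on $F_i$. $(\cdot,\cdot)_K$ is the $L_2(K)$ pairing $(f,g)_K=\int_K fg\,dx$. $W_r(\partial_\beta,K)=\{v\in L_r(K):\beta\cdot\nabla v\in L_r(K)\}$ and $W_r(\partial_\beta,\Omega_h)=\prod_{K\in\Omega_h}W_r(\partial_\beta,K)$. For $w\in W_p(\partial_\beta,K)$, $v\in W_q(\partial_\beta,K)$ let $\langle D_Kw,v\rangle=(\beta\cdot\nabla w,v)_K+(w,\beta\cdot\nabla v)_K$ (for smooth $w,v$ this equals $\int_{\partial K}(\beta\cdot n)wv\,ds$). $P_j(K)$ is the space of polynomials of degree at most $j$ on $K$ ($P_j(K)=\{0\}$ if $j<0$). $\mathring P_j(K)=\{z\in P_j(K):z|_{\partial K}=0\}$, which is $\{0\}$ for $0\le j\le N$; $P_j^\perp(K)$ is the $L_2(K)$-orthogonal complement of $\mathring P_j(K)$ in $P_j(K)$ (so $P_j^\perp(K)=P_j(K)$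 for $0\le j\le N$). Bubbles: $b=\prod_{j=0}^N\lambda_j$, $b_i=\prod_{j\ne i}\lambda_j$. Signs: $s_i=\operatorname{sgn}(\beta_K\cdot n_i)\in\{-1,0,1\}$, $b_s=\sum_{i=0}^N s_ib_i$. Local test space: $V(K)=b_sP_k^\perp(K)+b\,P_{k-2}(K)\subseteq P_{k+N}(K)$. Under the stated hypotheses, for every $v\in W_q(\partial_\beta,K)$ there is a unique $\varPi_Kv\in V(K)$ with $\langle D_Kw,\varPi_Kv-v\rangle=0$ for all $w\in P_k^\perp(K)$ and $(z,\varPi_Kv-v)_K=0$ for all $z\in P_{k-2}(K)$; this defines $\varPi_K$. Also $(\varPi_hv)|_K:=\varPi_K(v|_K)$. Norms: $|\!|\!|v|\!|\!|_{q,K}=\|v\|_{L_q(K)}+\frac{h_K}{|\beta_K|}\|\beta\cdot\nabla v\|_{L_q(K)}$ and $|\!|\!|v|\!|\!|_{q,\Omega_h}^q=\sum_{K\in\Omega_h}|\!|\!|v|\!|\!|_{q,K}^q$. *)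

theory Defs
  imports "HOL-Analysis.Analysis"
begin

text \<open>
  The space dimension is \<open>N = CARD('n)\<close> and the ambient space is \<open>real ^ 'n\<close>. The \<open>N + 1\<close> vertices
  of a simplex (hence its facets, barycentric coordinates, normals) are indexed by \<open>'n option\<close>,
  with \<open>None\<close> in the role of the index \<open>0\<close>.
\<close>

section \<open>Domains, meshes and advection fields\<close>

text \<open>Near each boundary point the domain is, in suitable orthogonal coordinates with last axis \<open>e\<close>,
  the strict epigraph of a Lipschitz function on the hyperplane orthogonal to \<open>e\<close>.\<close>

definition lipschitz_boundary :: "(real ^ 'n) set \<Rightarrow> bool" where
  "lipschitz_boundary \<Omega> \<longleftrightarrow>
     (\<forall>x\<in>frontier \<Omega>. \<exists>e r L \<phi>. norm e = 1 \<and> 0 < r \<and> L-lipschitz_on {y. y \<bullet> e = 0} \<phi> \<and>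
        (\<forall>y\<in>ball x r. y \<in> \<Omega> \<longleftrightarrow> \<phi> (y - (y \<bullet> e) *\<^sub>R e) < y \<bullet> e))"

definition lipschitz_polyhedral_domain :: "(real ^ 'n) set \<Rightarrow> bool" where
  "lipschitz_polyhedral_domain \<Omega> \<longleftrightarrow>
     open \<Omega> \<and> connected \<Omega> \<and> bounded \<Omega> \<and> \<Omega> \<noteq> {} \<and> lipschitz_boundary \<Omega> \<and>
     (\<exists>\<P>. finite \<P> \<and> (\<forall>P\<in>\<P>. polytope P) \<and> closure \<Omega> = \<Union>\<P>)"

fun ref_vertex :: "'n option \<Rightarrow> real ^ 'n" where
  "ref_vertex None = 0"
| "ref_vertex (Some i) = axis i 1"

definition ref_simplex :: "(real ^ 'n) set" where
  "ref_simplex = convex hull (range ref_vertex)"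

definition affine_map :: "real ^ 'n ^ 'n \<Rightarrow> real ^ 'n \<Rightarrow> real ^ 'n \<Rightarrow> real ^ 'n" where
  "affine_map M g x = M *v x + g"

definition vertices :: "real ^ 'n ^ 'n \<Rightarrow> real ^ 'n \<Rightarrow> 'n option \<Rightarrow> real ^ 'n" where
  "vertices M g i = affine_map M g (ref_vertex i)"

text \<open>The library notion \<^const>\<open>triangulation\<close> says that there are finitely many simplices and that
  any two of them meet in a common (possibly empty) face, i.e. the mesh is conforming. The map
  attached to the element \<open>K\<close> is \<^term>\<open>affine_map (M K) (g K)\<close>.\<close>

definition conforming_simplicial_mesh ::
  "(real ^ 'n) set \<Rightarrow> (real ^ 'n) set set \<Rightarrow> ((real ^ 'n) set \<Rightarrow> real ^ 'n ^ 'n) \<Rightarrow>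
   ((real ^ 'n) set \<Rightarrow> real ^ 'n) \<Rightarrow> bool" where
  "conforming_simplicial_mesh \<Omega> \<T> M g \<longleftrightarrow>
     triangulation \<T> \<and> \<Union>\<T> = closure \<Omega> \<and>
     (\<forall>K\<in>\<T>. invertible (M K) \<and> K = affine_map (M K) (g K) ` ref_simplex)"

definition mat_norm :: "real ^ 'n ^ 'n \<Rightarrow> real" where
  "mat_norm A = onorm (\<lambda>x. A *v x)"

definition shape_regular ::
  "real \<Rightarrow> (real ^ 'n) set set \<Rightarrow> ((real ^ 'n) set \<Rightarrow> real ^ 'n ^ 'n) \<Rightarrow> bool" where
  "shape_regular \<kappa> \<T> M \<longleftrightarrow> (\<forall>K\<in>\<T>. mat_norm (M K) * mat_norm (matrix_inv (M K)) \<le> \<kappa>)"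

definition facet :: "('n option \<Rightarrow> real ^ 'n) \<Rightarrow> 'n option \<Rightarrow> (real ^ 'n) set" where
  "facet a i = convex hull (a ` (UNIV - {i}))"

definition outward_normal :: "(real ^ 'n) set \<Rightarrow> (real ^ 'n) set \<Rightarrow> real ^ 'n" where
  "outward_normal K F =
     (THE n. norm n = 1 \<and> (\<forall>x\<in>F. \<forall>y\<in>F. n \<bullet> (y - x) = 0) \<and> (\<forall>x\<in>F. \<forall>y\<in>K. n \<bullet> (y - x) \<le> 0))"

text \<open>\<open>\<beta>\<close> is the field, \<open>\<beta>\<^sub>K\<close> the family of its values on the elements. On an interior facet the outward
  normals of the two neighbours differ by the sign, so either one may be used.\<close>

definition advection_field ::
  "(real ^ 'n) set set \<Rightarrow> (real ^ 'n \<Rightarrow> real ^ 'n) \<Rightarrow> ((real ^ 'n) set \<Rightarrow> real ^ 'n) \<Rightarrow> bool" where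
  "advection_field \<T> \<beta> \<beta>\<^sub>K \<longleftrightarrow>
     (\<forall>K\<in>\<T>. \<beta>\<^sub>K K \<noteq> 0 \<and> (\<forall>x\<in>interior K. \<beta> x = \<beta>\<^sub>K K)) \<and>
     (\<forall>K\<in>\<T>. \<forall>K'\<in>\<T>. \<forall>F. K \<noteq> K' \<and> F facet_of K \<and> F facet_of K' \<longrightarrow>
        \<beta>\<^sub>K K \<bullet> outward_normal K F = \<beta>\<^sub>K K' \<bullet> outward_normal K F)"


section \<open>Function spaces\<close>

definition Lr :: "real \<Rightarrow> (real ^ 'n) set \<Rightarrow> (real ^ 'n \<Rightarrow> real) set" where
  "Lr r K = {f. f \<in> borel_measurable (lebesgue_on K) \<and> integrable (lebesgue_on K) (\<lambda>x. \<bar>f x\<bar> powr r)}"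

definition Lr_norm :: "real \<Rightarrow> (real ^ 'n) set \<Rightarrow> (real ^ 'n \<Rightarrow> real) \<Rightarrow> real" where
  "Lr_norm r K f = (integral\<^sup>L (lebesgue_on K) (\<lambda>x. \<bar>f x\<bar> powr r)) powr (1 / r)"

definition pairing :: "(real ^ 'n) set \<Rightarrow> (real ^ 'n \<Rightarrow> real) \<Rightarrow> (real ^ 'n \<Rightarrow> real) \<Rightarrow> real" where
  "pairing K f g = integral\<^sup>L (lebesgue_on K) (\<lambda>x. f x * g x)"

primrec Ck :: "nat \<Rightarrow> (real ^ 'n \<Rightarrow> real) \<Rightarrow> bool" where
  "Ck 0 f \<longleftrightarrow> continuous_on UNIV f"
| "Ck (Suc m) f \<longleftrightarrow> (\<forall>x. f differentiable (at x)) \<and>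
     (\<forall>i. Ck m (\<lambda>x. frechet_derivative f (at x) (axis i 1)))"

definition test_functions :: "(real ^ 'n) set \<Rightarrow> (real ^ 'n \<Rightarrow> real) set" where
  "test_functions U = {\<phi>. (\<forall>m. Ck m \<phi>) \<and> compact (closure {x. \<phi> x \<noteq> 0}) \<and> closure {x. \<phi> x \<noteq> 0} \<subseteq> U}"

definition loc_integrable :: "(real ^ 'n) set \<Rightarrow> (real ^ 'n \<Rightarrow> real) \<Rightarrow> bool" where
  "loc_integrable U f \<longleftrightarrow> (\<forall>S. compact S \<and> S \<subseteq> U \<longrightarrow> integrable (lebesgue_on S) f)"

text \<open>\<open>g\<close> is a representative of the distributional derivative \<open>\<beta> \<cdot> \<nabla>v\<close> on the open set \<open>U\<close>,
  for a constant vector \<open>\<beta>\<close>.\<close>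

definition is_weak_deriv ::
  "real ^ 'n \<Rightarrow> (real ^ 'n) set \<Rightarrow> (real ^ 'n \<Rightarrow> real) \<Rightarrow> (real ^ 'n \<Rightarrow> real) \<Rightarrow> bool" where
  "is_weak_deriv \<beta> U v g \<longleftrightarrow> loc_integrable U v \<and> loc_integrable U g \<and>
     (\<forall>\<phi>\<in>test_functions U. integral\<^sup>L (lebesgue_on U) (\<lambda>x. v x * frechet_derivative \<phi> (at x) \<beta>) =
        - integral\<^sup>L (lebesgue_on U) (\<lambda>x. g x * \<phi> x))"

text \<open>The weak derivative is unique up to null sets; all uses below are insensitive to the choice.\<close>

definition weak_deriv :: "real ^ 'n \<Rightarrow> (real ^ 'n) set \<Rightarrow> (real ^ 'n \<Rightarrow> real) \<Rightarrow> real ^ 'n \<Rightarrow> real" where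
  "weak_deriv \<beta> K v = (SOME g. is_weak_deriv \<beta> (interior K) v g)"

definition W :: "real \<Rightarrow> real ^ 'n \<Rightarrow> (real ^ 'n) set \<Rightarrow> (real ^ 'n \<Rightarrow> real) set" where
  "W r \<beta> K = {v \<in> Lr r K. \<exists>g\<in>Lr r K. is_weak_deriv \<beta> (interior K) v g}"

definition W_mesh ::
  "real \<Rightarrow> ((real ^ 'n) set \<Rightarrow> real ^ 'n) \<Rightarrow> (real ^ 'n) set set \<Rightarrow>
   ((real ^ 'n) set \<Rightarrow> real ^ 'n \<Rightarrow> real) set" where
  "W_mesh r \<beta>\<^sub>K \<T> = Pi \<T> (\<lambda>K. W r (\<beta>\<^sub>K K) K)"

definition D ::
  "real ^ 'n \<Rightarrow> (real ^ 'n) set \<Rightarrow> (real ^ 'n \<Rightarrow> real) \<Rightarrow> (real ^ 'n \<Rightarrow> real) \<Rightarrow> real" where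
  "D \<beta> K w v = pairing K (weak_deriv \<beta> K w) v + pairing K w (weak_deriv \<beta> K v)"

definition tnorm :: "real \<Rightarrow> real ^ 'n \<Rightarrow> (real ^ 'n) set \<Rightarrow> (real ^ 'n \<Rightarrow> real) \<Rightarrow> real" where
  "tnorm q \<beta> K v = Lr_norm q K v + diameter K / norm \<beta> * Lr_norm q K (weak_deriv \<beta> K v)"

definition tnorm_mesh ::
  "real \<Rightarrow> ((real ^ 'n) set \<Rightarrow> real ^ 'n) \<Rightarrow> (real ^ 'n) set set \<Rightarrow>
   ((real ^ 'n) set \<Rightarrow> real ^ 'n \<Rightarrow> real) \<Rightarrow> real" where
  "tnorm_mesh q \<beta>\<^sub>K \<T> v = (\<Sum>K\<in>\<T>. tnorm q (\<beta>\<^sub>K K) K (v K) powr q) powr (1 / q)"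


section \<open>Polynomial spaces, bubbles and the local projector\<close>

text \<open>Polynomials of total degree at most \<open>j\<close>, as functions on the whole space (a polynomial is
  determined by its restriction to an element). For \<open>j < 0\<close> the sum is empty and the space is \<open>{0}\<close>.\<close>

definition Pol :: "int \<Rightarrow> (real ^ 'n \<Rightarrow> real) set" where
  "Pol j = {f. \<exists>c. f = (\<lambda>x. \<Sum>\<alpha> | int (\<Sum>i\<in>UNIV. \<alpha> i) \<le> j. c \<alpha> * (\<Prod>i\<in>UNIV. (x $ i) ^ \<alpha> i))}"

definition Pol0 :: "int \<Rightarrow> (real ^ 'n) set \<Rightarrow> (real ^ 'n \<Rightarrow> real) set" where
  "Pol0 j K = {z \<in> Pol j. \<forall>x\<in>frontier K. z x = 0}"

definition Pol_perp :: "int \<Rightarrow> (real ^ 'n) set \<Rightarrow> (real ^ 'n \<Rightarrow> real) set" where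
  "Pol_perp j K = {w \<in> Pol j. \<forall>z\<in>Pol0 j K. pairing K w z = 0}"

definition bary :: "('n option \<Rightarrow> real ^ 'n) \<Rightarrow> 'n option \<Rightarrow> real ^ 'n \<Rightarrow> real" where
  "bary a i x = (THE c. (\<Sum>j\<in>UNIV. c j) = 1 \<and> (\<Sum>j\<in>UNIV. c j *\<^sub>R a j) = x) i"

definition bubble :: "('n option \<Rightarrow> real ^ 'n) \<Rightarrow> real ^ 'n \<Rightarrow> real" where
  "bubble a x = (\<Prod>j\<in>UNIV. bary a j x)"

definition facet_bubble :: "('n option \<Rightarrow> real ^ 'n) \<Rightarrow> 'n option \<Rightarrow> real ^ 'n \<Rightarrow> real" where
  "facet_bubble a i x = (\<Prod>j\<in>UNIV - {i}. bary a j x)"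

definition facet_sign ::
  "real ^ 'n \<Rightarrow> (real ^ 'n) set \<Rightarrow> ('n option \<Rightarrow> real ^ 'n) \<Rightarrow> 'n option \<Rightarrow> real" where
  "facet_sign \<beta> K a i = sgn (\<beta> \<bullet> outward_normal K (facet a i))"

definition signed_bubble ::
  "real ^ 'n \<Rightarrow> (real ^ 'n) set \<Rightarrow> ('n option \<Rightarrow> real ^ 'n) \<Rightarrow> real ^ 'n \<Rightarrow> real" where
  "signed_bubble \<beta> K a x = (\<Sum>i\<in>UNIV. facet_sign \<beta> K a i * facet_bubble a i x)"

definition V ::
  "nat \<Rightarrow> real ^ 'n \<Rightarrow> (real ^ 'n) set \<Rightarrow> ('n option \<Rightarrow> real ^ 'n) \<Rightarrow> (real ^ 'n \<Rightarrow> real) set" where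
  "V k \<beta> K a = {(\<lambda>x. signed_bubble \<beta> K a x * r x + bubble a x * z x) | r z.
     r \<in> Pol_perp (int k) K \<and> z \<in> Pol (int k - 2)}"

definition Proj ::
  "nat \<Rightarrow> real ^ 'n \<Rightarrow> (real ^ 'n) set \<Rightarrow> ('n option \<Rightarrow> real ^ 'n) \<Rightarrow>
   (real ^ 'n \<Rightarrow> real) \<Rightarrow> real ^ 'n \<Rightarrow> real" where
  "Proj k \<beta> K a v = (THE u. u \<in> V k \<beta> K a \<and>
     (\<forall>w\<in>Pol_perp (int k) K. D \<beta> K w (\<lambda>x. u x - v x) = 0) \<and>
     (\<forall>z\<in>Pol (int k - 2). pairing K z (\<lambda>x. u x - v x) = 0))"

definition Proj_mesh ::
  "nat \<Rightarrow> ((real ^ 'n) set \<Rightarrow> real ^ 'n) \<Rightarrow> ((real ^ 'n) set \<Rightarrow> 'n option \<Rightarrow> real ^ 'n) \<Rightarrow>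
   ((real ^ 'n) set \<Rightarrow> real ^ 'n \<Rightarrow> real) \<Rightarrow> (real ^ 'n) set \<Rightarrow> real ^ 'n \<Rightarrow> real" where
  "Proj_mesh k \<beta>\<^sub>K a v K = Proj k (\<beta>\<^sub>K K) K (a K) (v K)"

end

theory Submission
  imports Defs "HOL-Computational_Algebra.Polynomial" "HOL-Library.Function_Algebras"
begin

text \<open>
  Integrating by parts against \<open>r \<in> P\<^sub>k\<^sup>\<bottom>\<close> and using that the bubbles vanish on all but one facet, the equations
  for \<open>b\<^sub>s r + b z\<close> decouple: \<open>r\<close> is the Riesz representative of \<open>w \<mapsto> \<langle>D w, v\<rangle>\<close> for the form
  \<open>\<Sum>\<^sub>i \<integral> \<bar>\<beta> \<bullet> n\<^sub>i\<bar> b\<^sub>i w r\<close> over the facets, and then \<open>z\<close> is determined by the weighted form \<open>\<integral> b \<zeta> z\<close>. Both forms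
  are positive definite, with constants that can be taken on the reference simplex because all norms on a
  finite-dimensional space of polynomials are comparable; for \<open>k = 1\<close> two facets with
  \<open>\<bar>\<beta> \<bullet> n\<^sub>i\<bar>\<close> comparable to \<open>\<bar>\<beta>\<bar>\<close> suffice, so that no lower bound on the other fluxes is needed. Shape
  regularity enters only through the inverse inequality for \<open>\<beta> \<bullet> \<nabla>\<close>.

  Surface integrals are avoided: the integral over the facet opposite to \<open>a\<^sub>i\<close> is expressed, up to a factor, as
  the volume integral of \<open>N f + (x - a\<^sub>i) \<bullet> \<nabla>f\<close>, and its positivity follows by replacing a polynomial by one
  that is homogeneous about \<open>a\<^sub>i\<close> and has the same values on the facet.
\<close>

section \<open>Test functions\<close>

text \<open>The decoupling rests on two facts: a multiple of \<open>bub\<close> vanishes on every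
  facet, so it contributes nothing to \<open>D \<beta> El w\<close>, and the signs in
  \<open>signed_bubble\<close> turn each flux into its modulus. Restricting \<open>r\<close> to the
  orthogonal complement makes the facet form definite, because an element with zero boundary values
  is orthogonal to itself. The estimates are made in the maximum norm: each equation is tested with
  its own solution, coercivity is evaluated at a point where that solution is largest in modulus,
  and one factor cancels. The powers of the volume from Hoelder's inequality and from the return to
  L_q cancel as well, so that only reference constants, \<kappa> and \<theta> survive. Since
  \<open>weak_deriv\<close> is an arbitrary choice among representatives, nothing can be computed
  with it before uniqueness up to null sets is known; this is what the bump functions are for. In
  place of a change of variables, integrals of monomials in barycentric coordinates on different
  simplices are compared through a recursion, itself obtained by integrating by parts along
  edges.\<close>

abbreviation rpoly :: "('a::euclidean_space \<Rightarrow> real) \<Rightarrow> bool" where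
  "rpoly \<equiv> real_polynomial_function"

lemmas rpoly_intros = real_polynomial_function.intros
  and rpoly_differentiable = differentiable_at_real_polynomial_function

section \<open>Smoothness of sums, products and polynomials\<close>

lemma Ck_SucD: "Ck (Suc m) f \<Longrightarrow> Ck m f"
proof (induction m arbitrary: f)
  case 0
  then show ?case
    by (simp add: continuous_at_imp_continuous_on differentiable_imp_continuous_within)
qed auto

lemma Ck_const: "Ck m (\<lambda>x. c)"
  by (induction m arbitrary: c) auto

lemma Ck_add: "Ck m f \<Longrightarrow> Ck m g \<Longrightarrow> Ck m (\<lambda>x. f x + g x)"
proof (induction m arbitrary: f g)
  case 0
  then show ?case by (simp add: continuous_on_add)
next
  case (Suc m)
  have "frechet_derivative (\<lambda>x. f x + g x) (at x) = (\<lambda>d. frechet_derivative f (at x) d + frechet_derivative g (at x) d)" for x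
    using Suc.prems by (intro frechet_derivative_at[symmetric] has_derivative_add) (auto simp: frechet_derivative_works)
  then show ?case using Suc by (auto intro!: differentiable_add)
qed

lemma Ck_mult: "Ck m f \<Longrightarrow> Ck m g \<Longrightarrow> Ck m (\<lambda>x. f x * g x)"
proof (induction m arbitrary: f g)
  case 0
  then show ?case by (simp add: continuous_on_mult)
next
  case (Suc m)
  have "frechet_derivative (\<lambda>x. f x * g x) (at x)
      = (\<lambda>d. f x * frechet_derivative g (at x) d + frechet_derivative f (at x) d * g x)" for x
    using Suc.prems by (intro frechet_derivative_at[symmetric] has_derivative_mult) (auto simp: frechet_derivative_works)
  then show ?case using Suc Ck_SucD[OF Suc.prems(1)] Ck_SucD[OF Suc.prems(2)]
    by (auto intro!: differentiable_mult Ck_add)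
qed

lemma Ck_prod: "finite I \<Longrightarrow> (\<And>i. i \<in> I \<Longrightarrow> Ck m (f i)) \<Longrightarrow> Ck m (\<lambda>x. \<Prod>i\<in>I. f i x)"
  by (induction rule: finite_induct) (auto intro: Ck_const Ck_mult)

lemma Ck_bounded_linear:
  assumes "bounded_linear f" shows "Ck m f"
proof (cases m)
  case 0
  then show ?thesis using assms by (simp add: linear_continuous_on)
next
  case (Suc n)
  have "frechet_derivative f (at x) = f" for x
    using assms by (intro frechet_derivative_at[symmetric] bounded_linear_imp_has_derivative)
  then show ?thesis using Suc assms by (auto intro: Ck_const bounded_linear_imp_differentiable)
qed

lemma Ck_rpoly: "rpoly f \<Longrightarrow> Ck m f"
  by (induction rule: real_polynomial_function.induct)
    (auto intro: Ck_const Ck_add Ck_mult Ck_bounded_linear)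

text \<open>The classical function exp(-1/t), extended by zero to t \<le> 0, with a polynomial
  factor in 1/t. The factor makes the family closed under differentiation, so that smoothness
  becomes one induction for all \<open>P\<close> at once.\<close>

definition flat :: "real poly \<Rightarrow> real \<Rightarrow> real" where
  "flat P t = (if 0 < t then poly P (1 / t) * exp (- (1 / t)) else 0)"

lemma poly_mult_exp_tendsto_0: "((\<lambda>s. poly P s * exp (- s)) \<longlongrightarrow> 0) at_top" for P :: "real poly"
proof -
  have "((\<lambda>s. \<Sum>i\<le>degree P. coeff P i * (s ^ i / exp s)) \<longlongrightarrow> (\<Sum>i\<le>degree P. coeff P i * 0)) at_top"
    by (intro tendsto_intros tendsto_power_div_exp_0)
  then show ?thesis
    by (simp add: poly_altdef sum_distrib_right exp_minus divide_inverse mult.assoc)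
qed

text \<open>For t > 0 the chain rule turns P into X^2 (P - P'), with \<open>monom 1 2\<close> in the
  role of X^2. The point 0 is the only delicate one; there all difference quotients tend to zero
  because the exponential beats every power of 1/t.\<close>

lemma flat_has_derivative:
  "(flat P has_real_derivative flat (monom 1 2 * (P - pderiv P)) t) (at t)"
proof -
  consider "t > 0" | "t < 0" | "t = 0" by linarith
  then show ?thesis
  proof cases
    case 1
    have i: "((\<lambda>t. 1 / t) has_real_derivative (- (1 / t\<^sup>2))) (at t)"
      using 1 by (auto intro!: derivative_eq_intros simp: power2_eq_square)
    have "((\<lambda>t. poly P (1 / t) * exp (- (1 / t))) has_real_derivative
        poly (pderiv P) (1 / t) * (- (1 / t\<^sup>2)) * exp (- (1 / t))
        + exp (- (1 / t)) * (- (- (1 / t\<^sup>2))) * poly P (1 / t)) (at t)"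
      by (intro DERIV_mult DERIV_chain2[OF poly_DERIV i] DERIV_chain2[OF DERIV_exp DERIV_minus[OF i]])
    also have "poly (pderiv P) (1 / t) * (- (1 / t\<^sup>2)) * exp (- (1 / t))
        + exp (- (1 / t)) * (- (- (1 / t\<^sup>2))) * poly P (1 / t) = flat (monom 1 2 * (P - pderiv P)) t"
      using 1 by (simp add: flat_def poly_monom power_divide algebra_simps)
    finally show ?thesis
      by (rule has_field_derivative_transform_within_open[of _ _ _ "{0<..}"])
        (use 1 in \<open>auto simp: flat_def\<close>)
  next
    case 2
    have "((\<lambda>t. 0) has_real_derivative flat (monom 1 2 * (P - pderiv P)) t) (at t)"
      using 2 by (auto simp: flat_def)
    then show ?thesis
      by (rule has_field_derivative_transform_within_open[of _ _ _ "{..<0}"])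
        (use 2 in \<open>auto simp: flat_def\<close>)
  next
    case 3
    \<comment> \<open>Dividing by t multiplies the polynomial factor by X, so the right difference
      quotient at 0 is again of the form handled by \<open>poly_mult_exp_tendsto_0\<close>.\<close>
    have "((\<lambda>t. poly (pCons 0 P) (inverse t) * exp (- (inverse t))) \<longlongrightarrow> 0) (at_right 0)"
      by (rule filterlim_compose[OF poly_mult_exp_tendsto_0 filterlim_inverse_at_top_right])
    then have "((\<lambda>t. flat P t / t) \<longlongrightarrow> 0) (at_right 0)"
      by (rule Lim_transform_eventually)
        (auto simp: eventually_at_right_field flat_def field_simps intro!: exI[of _ 1])
    moreover have "((\<lambda>t. flat P t / t) \<longlongrightarrow> 0) (at_left 0)"
      by (rule Lim_transform_eventually[OF tendsto_const])
        (auto simp: eventually_at_left_field flat_def intro!: exI[of _ "-1"])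
    ultimately have "((\<lambda>t. flat P t / t) \<longlongrightarrow> 0) (at 0)"
      by (simp add: filterlim_split_at)
    then show ?thesis using 3 by (simp add: DERIV_def flat_def)
  qed
qed

text \<open>The induction must be generalised over \<open>P\<close>, since each derivative changes
  the polynomial. The affine argument with slope \<open>s\<close> covers both ends of an
  interval.\<close>

lemma Ck_flat: "Ck m (\<lambda>x. flat P (c + s * x $ i))"
proof (induction m arbitrary: P)
  case 0
  have "continuous_on UNIV (flat P)"
    using DERIV_isCont[OF flat_has_derivative] by (simp add: continuous_at_imp_continuous_on)
  then show ?case
    by (simp, intro continuous_on_compose2[of UNIV "flat P" _ "\<lambda>x. c + s * x $ i"] continuous_intros) auto
next
  case (Suc m)
  let ?Q = "monom 1 2 * (P - pderiv P)"
  have *: "((\<lambda>x. flat P (c + s * x $ i)) has_derivative (\<lambda>d. flat ?Q (c + s * x $ i) * (s * d $ i))) (at x)"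
    for x :: "real ^ 'a"
  proof -
    have "((\<lambda>x. c + s * x $ i) has_derivative (\<lambda>d. 0 + s * d $ i)) (at x)"
      by (intro has_derivative_add has_derivative_const has_derivative_mult_right bounded_linear_imp_has_derivative bounded_linear_vec_nth)
    from DERIV_compose_FDERIV[OF flat_has_derivative this] show ?thesis
      by (simp add: mult.commute)
  qed
  have "frechet_derivative (\<lambda>x. flat P (c + s * x $ i)) (at x) = (\<lambda>d. flat ?Q (c + s * x $ i) * (s * d $ i))"
    for x :: "real ^ 'a"
    using * by (rule frechet_derivative_at[symmetric])
  moreover have "(\<lambda>x::real^'a. flat P (c + s * x $ i)) differentiable (at x)" for x
    using * by (auto simp: differentiable_def)
  ultimately show ?case using Suc by (auto intro!: Ck_mult Ck_const)
qed

text \<open>A smooth function that is positive exactly on the open box. The factors are written as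
  \<open>c + s * x $ i\<close> with slopes 1 and -1 so that \<open>Ck_flat\<close> applies
  literally.\<close>

definition bump :: "real ^ 'n \<Rightarrow> real ^ 'n \<Rightarrow> real ^ 'n \<Rightarrow> real" where
  "bump a b x = (\<Prod>i\<in>UNIV. flat 1 (- a $ i + 1 * x $ i) * flat 1 (b $ i + (-1) * x $ i))"

lemma Ck_bump: "Ck m (bump a b)"
  unfolding bump_def by (intro Ck_prod Ck_mult Ck_flat) auto

lemma bump_pos: "x \<in> box a b \<Longrightarrow> 0 < bump a b x"
  unfolding bump_def by (intro prod_pos) (auto simp: flat_def mem_box_cart)

lemma bump_outside: "x \<notin> box a b \<Longrightarrow> bump a b x = 0"
  unfolding bump_def by (auto simp: flat_def mem_box_cart)

text \<open>These are the only test functions needed to identify a weak derivative; polynomial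
  factors suffice because polynomials are dense in the continuous functions on a box.\<close>

lemma test_function_bump_poly:
  assumes "cbox a b \<subseteq> U" "rpoly f"
  shows "(\<lambda>x. bump a b x * f x) \<in> test_functions U"
proof -
  have "closure {x. bump a b x * f x \<noteq> 0} \<subseteq> cbox a b"
    using bump_outside[of _ a b] box_subset_cbox[of a b] by (intro closure_minimal) auto
  moreover have "compact (closure {x. bump a b x * f x \<noteq> 0})"
    using bounded_subset[OF bounded_cbox calculation] by (simp add: compact_eq_bounded_closed)
  ultimately show ?thesis
    using assms by (auto simp: test_functions_def intro: Ck_mult Ck_bump Ck_rpoly)
qed

section \<open>Weak derivatives\<close>

lemmas has_derivative_frechet = frechet_derivative_works[THEN iffD1]

lemma rpoly_has_derivative:
  "rpoly f \<Longrightarrow> (f has_derivative frechet_derivative f (at x)) (at x)"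
  by (intro has_derivative_frechet rpoly_differentiable) auto

lemma frechet_derivative_mult:
  fixes f g :: "'a::real_normed_vector \<Rightarrow> real"
  assumes "f differentiable at x" "g differentiable at x"
  shows "frechet_derivative (\<lambda>x. f x * g x) (at x) d
    = f x * frechet_derivative g (at x) d + frechet_derivative f (at x) d * g x"
  using has_derivative_mult[OF assms[THEN has_derivative_frechet], THEN frechet_derivative_at] by metis

lemma frechet_derivative_add:
  assumes "f differentiable at x" "g differentiable at x"
  shows "frechet_derivative (\<lambda>x. f x + g x) (at x) d
    = frechet_derivative f (at x) d + frechet_derivative g (at x) d"
  using has_derivative_add[OF assms[THEN has_derivative_frechet], THEN frechet_derivative_at] by metis

lemma frechet_derivative_bounded_linear:
  "bounded_linear f \<Longrightarrow> frechet_derivative f (at x) = f"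
  by (metis bounded_linear_imp_has_derivative frechet_derivative_at)

lemma rpoly_frechet_derivative:
  "rpoly f \<Longrightarrow> rpoly (\<lambda>x. frechet_derivative f (at x) d)"
proof (induction rule: real_polynomial_function.induct)
  case (linear f)
  then show ?case by (simp add: frechet_derivative_bounded_linear rpoly_intros(2))
next
  case (mult f g)
  then show ?case
    by (auto simp: frechet_derivative_mult rpoly_differentiable)
next
  case (add f g)
  then show ?case
    by (auto simp: frechet_derivative_add rpoly_differentiable)
qed auto

lemma continuous_on_rpoly:
  "rpoly f \<Longrightarrow> continuous_on S f"
  by (simp add: continuous_on_polymonial_function real_polynomial_function_eq)

section \<open>Integrals of directional derivatives over the whole space\<close>

lemma compact_sets_lebesgue: "compact K \<Longrightarrow> K \<in> sets lebesgue"
  by (simp add: compact_imp_closed)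

lemma integrable_lebesgue_on_compact:
  fixes f :: "'a::euclidean_space \<Rightarrow> real"
  assumes "compact K" "continuous_on K f"
  shows "integrable (lebesgue_on K) f"
  using borel_integrable_compact[OF assms] assms
  by (simp add: integrable_restrict_space integrable_completion compact_sets_lebesgue)

lemma integral_lebesgue_on_eq_lborel:
  fixes f :: "'a::euclidean_space \<Rightarrow> real"
  assumes "f \<in> borel_measurable borel" "U \<in> sets borel"
  shows "integral\<^sup>L (lebesgue_on U) f = integral\<^sup>L lborel (\<lambda>x. indicator U x * f x)"
  using assms by (simp add: integral_restrict_space integral_completion)

lemma integral_lborel_translation:
  fixes F :: "'a::euclidean_space \<Rightarrow> real"
  assumes [measurable]: "F \<in> borel_measurable borel"
  shows "integral\<^sup>L lborel (\<lambda>x. F (x + c)) = integral\<^sup>L lborel F"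
proof -
  have "integral\<^sup>L lborel F = integral\<^sup>L (distr lborel borel ((+) c)) F"
    by (simp add: lborel_distr_plus)
  also have "\<dots> = integral\<^sup>L lborel (\<lambda>x. F (c + x))"
    by (rule integral_distr) auto
  finally show ?thesis by (simp add: add.commute)
qed

text \<open>The difference quotients have integral zero by translation invariance.\<close>

lemma integral_directional_derivative_eq_0:
  fixes F F' :: "'a::euclidean_space \<Rightarrow> real"
  assumes meas [measurable]: "F \<in> borel_measurable borel" "F' \<in> borel_measurable borel"
    and int: "integrable lborel F"
    and supp: "\<And>x. F x \<noteq> 0 \<Longrightarrow> norm x \<le> R"
    and lip: "\<And>x t. 0 < t \<Longrightarrow> t \<le> 1 \<Longrightarrow> \<bar>F (x + t *\<^sub>R d) - F x\<bar> \<le> C * t"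
    and lim: "AE x in lborel. (\<lambda>n. real (Suc n) * (F (x + (1 / real (Suc n)) *\<^sub>R d) - F x)) \<longlonglongrightarrow> F' x"
  shows "integral\<^sup>L lborel F' = 0"
proof -
  define g where "g n x = real (Suc n) * (F (x + (1 / real (Suc n)) *\<^sub>R d) - F x)" for n x
  have trans: "integrable lborel (\<lambda>x. F (x + c))" for c
    using integrable_distr[of "(+) c" lborel borel F] int
    by (simp add: lborel_distr_plus add.commute)
  have zero: "integral\<^sup>L lborel (g n) = 0" for n
    unfolding g_def using trans int integral_lborel_translation[OF meas(1)] by simp
  have C: "0 \<le> C" using lip[of 1 0] by simp
  have "(\<lambda>n. integral\<^sup>L lborel (g n)) \<longlonglongrightarrow> integral\<^sup>L lborel F'"
  \<comment> \<open>The steps have length at most \<open>norm d\<close>, so every quotient vanishes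
    outside the ball of radius \<open>R + norm d\<close>; inside it, the Lipschitz bound along
    \<open>d\<close> is the integrable majorant.\<close>
  proof (rule integral_dominated_convergence[where w = "\<lambda>x. C * indicator (cball 0 (R + norm d)) x"])
    show "F' \<in> borel_measurable lborel" by simp
    show "g n \<in> borel_measurable lborel" for n unfolding g_def by measurable
    show "integrable lborel (\<lambda>x::'a. C * indicator (cball 0 (R + norm d)) x :: real)"
      using emeasure_bounded_finite[OF bounded_cball, of "0::'a" "R + norm d"]
      by (intro integrable_mult_right integrable_real_indicator) auto
    show "AE x in lborel. (\<lambda>n. g n x) \<longlonglongrightarrow> F' x" using lim by (simp add: g_def)
    show "AE x in lborel. norm (g n x) \<le> C * indicator (cball 0 (R + norm d)) x" for n
    proof (intro AE_I2)
      fix x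
      let ?t = "1 / real (Suc n)"
      have t: "0 < ?t" "?t \<le> 1" by auto
      show "norm (g n x) \<le> C * indicator (cball 0 (R + norm d)) x"
      proof (cases "x \<in> cball 0 (R + norm d)")
        case True
        have "norm (g n x) = real (Suc n) * \<bar>F (x + ?t *\<^sub>R d) - F x\<bar>"
          by (simp add: g_def abs_mult)
        also have "\<dots> \<le> real (Suc n) * (C * ?t)"
          by (intro mult_left_mono lip t) auto
        finally show ?thesis using True by simp
      next
        case False
        then have 1: "R + norm d < norm x" by simp
        have "F x = 0" using supp[of x] 1 norm_ge_zero[of d] by (metis add_increasing2 linorder_not_less)
        moreover have "norm (?t *\<^sub>R d) \<le> norm d"
          using t mult_right_mono[OF t(2) norm_ge_zero[of d]] by simp
        then have "R < norm (x + ?t *\<^sub>R d)"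
          using 1 norm_triangle_ineq2[of x "- (?t *\<^sub>R d)"] by (simp del: norm_scaleR)
        then have "F (x + ?t *\<^sub>R d) = 0" using supp by fastforce
        ultimately show ?thesis using False by (simp add: g_def)
      qed
    qed
  qed
  then show ?thesis using zero by (simp add: LIMSEQ_const_iff)
qed

lemma difference_quotient_tendsto:
  fixes F :: "'a::real_normed_vector \<Rightarrow> real"
  assumes "(F has_derivative F') (at x)"
  shows "(\<lambda>n. real (Suc n) * (F (x + (1 / real (Suc n)) *\<^sub>R d) - F x)) \<longlonglongrightarrow> F' d"
proof -
  have "((\<lambda>t. F (x + t *\<^sub>R d)) has_derivative (\<lambda>t. F' (t *\<^sub>R d))) (at 0)"
    by (rule has_derivative_compose[of "\<lambda>t. x + t *\<^sub>R d" "\<lambda>t. t *\<^sub>R d"])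
      (use assms in \<open>auto intro!: derivative_eq_intros\<close>)
  then have "((\<lambda>t. F (x + t *\<^sub>R d)) has_real_derivative F' d) (at 0)"
    by (simp add: has_field_derivative_def linear_scale[OF has_derivative_linear[OF assms]] mult.commute[of _ "F' d"])
  then have "((\<lambda>h. (F (x + h *\<^sub>R d) - F x) / h) \<longlongrightarrow> F' d) (at 0)"
    by (simp add: DERIV_def)
  moreover have "filterlim (\<lambda>n. 1 / real (Suc n)) (at 0) sequentially"
    using filterlim_atI LIMSEQ_Suc[OF lim_1_over_n] by (auto simp: filterlim_at)
  ultimately have "(\<lambda>n. (F (x + (1 / real (Suc n)) *\<^sub>R d) - F x) / (1 / real (Suc n))) \<longlonglongrightarrow> F' d"
    by (rule filterlim_compose)
  then show ?thesis by (simp add: mult.commute)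
qed

lemma frechet_derivative_eq_sum:
  fixes f :: "real ^ 'n \<Rightarrow> real"
  assumes "f differentiable (at x)"
  shows "frechet_derivative f (at x) d = (\<Sum>i\<in>UNIV. d $ i * frechet_derivative f (at x) (axis i 1))"
proof -
  interpret linear "frechet_derivative f (at x)"
    using assms by (rule linear_frechet_derivative)
  have "frechet_derivative f (at x) d = frechet_derivative f (at x) (\<Sum>i\<in>UNIV. d $ i *\<^sub>R axis i 1)"
    using basis_expansion[of d] by (simp add: scalar_mult_eq_scaleR)
  then show ?thesis by (simp add: sum scale)
qed

lemma Ck_frechet_derivative:
  assumes "Ck (Suc m) f"
  shows "Ck m (\<lambda>x. frechet_derivative f (at x) d)"
proof -
  have sum: "finite I \<Longrightarrow> (\<And>i. i \<in> I \<Longrightarrow> Ck m (g i)) \<Longrightarrow> Ck m (\<lambda>x. \<Sum>i\<in>I. g i x)"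
    for I :: "'b set" and g :: "'b \<Rightarrow> real ^ 'a \<Rightarrow> real"
    by (induction rule: finite_induct) (auto intro: Ck_const Ck_add)
  have "(\<lambda>x. frechet_derivative f (at x) d) = (\<lambda>x. \<Sum>i\<in>UNIV. d $ i * frechet_derivative f (at x) (axis i 1))"
    using assms by (auto simp: frechet_derivative_eq_sum)
  then show ?thesis using assms by (auto intro!: sum Ck_mult Ck_const)
qed

lemma test_function_continuous:
  assumes "\<phi> \<in> test_functions U"
  shows "\<phi> differentiable (at x)" "continuous_on UNIV \<phi>"
    "continuous_on UNIV (\<lambda>x. frechet_derivative \<phi> (at x) d)"
proof -
  have "Ck (Suc 0) \<phi>" using assms by (simp add: test_functions_def)
  then show "\<phi> differentiable (at x)" "continuous_on UNIV \<phi>"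
    "continuous_on UNIV (\<lambda>x. frechet_derivative \<phi> (at x) d)"
    using Ck_SucD[of 0 \<phi>] Ck_frechet_derivative[of 0 \<phi> d] by simp_all
qed

lemma indicator_mult_eq:
  fixes h :: "'a \<Rightarrow> real"
  assumes "\<And>x. x \<notin> S \<Longrightarrow> h x = 0" "S \<subseteq> U"
  shows "(\<lambda>x. indicator U x * h x) = h"
proof
  fix x
  show "indicator U x * h x = h x"
    using assms by (cases "x \<in> U"; cases "x \<in> S") auto
qed

lemma test_function_outside:
  assumes "x \<notin> closure {x. \<phi> x \<noteq> 0}"
  shows "\<phi> x = (0::real)" "frechet_derivative \<phi> (at x) d = 0"
proof -
  show "\<phi> x = 0" using assms closure_subset[of "{x. \<phi> x \<noteq> 0}"] by auto
  have "(\<phi> has_derivative (\<lambda>d. 0)) (at x)"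
  proof (rule has_derivative_transform_within_open[OF has_derivative_const])
    show "open (- closure {x. \<phi> x \<noteq> 0})" by (simp add: open_Compl)
    show "x \<in> - closure {x. \<phi> x \<noteq> 0}" using assms by simp
    show "0 = \<phi> y" if "y \<in> - closure {x. \<phi> x \<noteq> 0}" for y
      using that closure_subset[of "{x. \<phi> x \<noteq> 0}"] by auto
  qed
  then show "frechet_derivative \<phi> (at x) d = 0" by (metis frechet_derivative_at)
qed

lemma directional_mvt:
  fixes f :: "'a::real_normed_vector \<Rightarrow> real"
  assumes diff: "\<And>x. f differentiable (at x)" and t: "0 < t"
  shows "\<exists>z. 0 < z \<and> z < t \<and> f (x + t *\<^sub>R d) - f x = t * frechet_derivative f (at (x + z *\<^sub>R d)) d"
proof -
  have der: "((\<lambda>s. f (x + s *\<^sub>R d)) has_real_derivative frechet_derivative f (at (x + s *\<^sub>R d)) d) (at s)" for s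
  proof -
    have "((\<lambda>s. f (x + s *\<^sub>R d)) has_derivative (\<lambda>s'. frechet_derivative f (at (x + s *\<^sub>R d)) (s' *\<^sub>R d))) (at s)"
      by (rule has_derivative_compose[of "\<lambda>s. x + s *\<^sub>R d" "\<lambda>s. s *\<^sub>R d", OF _ has_derivative_frechet[OF diff]])
        (auto intro!: derivative_eq_intros)
    then show ?thesis
      by (simp add: has_field_derivative_def linear_scale[OF linear_frechet_derivative[OF diff]]
          mult.commute[of _ "frechet_derivative f (at (x + s *\<^sub>R d)) d"])
  qed
  show ?thesis using MVT2[OF t der] by simp
qed

lemma test_function_derivative_integral:
  fixes \<phi> :: "real ^ 'n \<Rightarrow> real"
  assumes "\<phi> \<in> test_functions U"
  shows "integral\<^sup>L lborel (\<lambda>x. frechet_derivative \<phi> (at x) d) = 0"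
proof -
  let ?S = "closure {x. \<phi> x \<noteq> 0}" and ?D = "\<lambda>x. frechet_derivative \<phi> (at x) d"
  have comp: "compact ?S" using assms by (simp add: test_functions_def)
  note diff = test_function_continuous(1)[OF assms]
    and cont = test_function_continuous(2)[OF assms] test_function_continuous(3)[OF assms, of d]
    and out = test_function_outside(1)[of _ \<phi>] and D0 = test_function_outside(2)[of _ \<phi> d]
  obtain R where R: "\<And>x. x \<in> ?S \<Longrightarrow> norm x \<le> R"
    using comp compact_imp_bounded bounded_iff by metis
  have "bounded (?D ` ?S)"
    using comp cont by (intro compact_imp_bounded compact_continuous_image) (auto intro: continuous_on_subset)
  then obtain C0 where C0: "\<And>x. x \<in> ?S \<Longrightarrow> \<bar>?D x\<bar> \<le> C0" by (auto simp: bounded_iff)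
  \<comment> \<open>The support may be empty, and then \<open>C0\<close> is arbitrary; the maximum
    is nonnegative and also bounds the zero values outside the support.\<close>
  define C where "C = max C0 0"
  have C: "\<bar>?D x\<bar> \<le> C" for x using C0[of x] D0[of x] by (cases "x \<in> ?S") (auto simp: C_def)
  show ?thesis
  proof (rule integral_directional_derivative_eq_0[of \<phi>])
    show "\<phi> \<in> borel_measurable borel" "?D \<in> borel_measurable borel"
      using cont by (auto intro: borel_measurable_continuous_onI)
    show "norm x \<le> R" if "\<phi> x \<noteq> 0" for x using that out R by blast
    have "integrable lborel (\<lambda>x. indicator ?S x *\<^sub>R \<phi> x)"
      using comp cont by (intro borel_integrable_compact) (auto intro: continuous_on_subset)
    moreover have "(\<lambda>x. indicator ?S x *\<^sub>R \<phi> x) = \<phi>"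
      using indicator_mult_eq[OF out order_refl] by simp
    ultimately show "integrable lborel \<phi>" by simp
    show "AE x in lborel. (\<lambda>n. real (Suc n) * (\<phi> (x + (1 / real (Suc n)) *\<^sub>R d) - \<phi> x)) \<longlonglongrightarrow> ?D x"
      by (rule AE_I2, rule difference_quotient_tendsto[OF has_derivative_frechet[OF diff]])
    show "\<bar>\<phi> (x + t *\<^sub>R d) - \<phi> x\<bar> \<le> C * t" if t: "0 < t" "t \<le> 1" for x t
    proof -
      obtain z where "\<phi> (x + t *\<^sub>R d) - \<phi> x = t * ?D (x + z *\<^sub>R d)"
        using directional_mvt[OF diff t(1)] by blast
      then have "\<bar>\<phi> (x + t *\<^sub>R d) - \<phi> x\<bar> = t * \<bar>?D (x + z *\<^sub>R d)\<bar>"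
        using t by (simp add: abs_mult)
      also have "\<dots> \<le> t * C" using C t by (intro mult_left_mono) auto
      finally show ?thesis by (simp add: mult.commute)
    qed
  qed
qed

lemma test_function_mult_poly:
  assumes "\<phi> \<in> test_functions U" "rpoly f"
  shows "(\<lambda>x. f x * \<phi> x) \<in> test_functions U"
proof -
  have sub: "closure {x. f x * \<phi> x \<noteq> 0} \<subseteq> closure {x. \<phi> x \<noteq> 0}"
    by (intro closure_mono) auto
  moreover have "compact (closure {x. f x * \<phi> x \<noteq> 0})"
    using assms(1) compact_Int_closed[of "closure {x. \<phi> x \<noteq> 0}", OF _ closed_closure, of "{x. f x * \<phi> x \<noteq> 0}"]
    unfolding Int_absorb1[OF sub] by (simp add: test_functions_def)
  ultimately show ?thesis
    using assms by (auto simp: test_functions_def intro: Ck_mult Ck_rpoly)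
qed

text \<open>The product of \<open>f\<close> with a test function is again a test function, so the
  integral of its derivative vanishes; the product rule splits this integral into the two sides of
  the weak identity.\<close>

lemma is_weak_deriv_polynomial:
  fixes f :: "real ^ 'n \<Rightarrow> real"
  assumes f: "rpoly f" and U: "open U"
  shows "is_weak_deriv \<beta> U f (\<lambda>x. frechet_derivative f (at x) \<beta>)"
  unfolding is_weak_deriv_def
proof (intro conjI ballI)
  show "loc_integrable U f" "loc_integrable U (\<lambda>x. frechet_derivative f (at x) \<beta>)"
    using f by (auto simp: loc_integrable_def intro!: integrable_lebesgue_on_compact
      continuous_on_rpoly rpoly_frechet_derivative)
  fix \<phi> assume phi: "\<phi> \<in> test_functions U"
  let ?S = "closure {x. \<phi> x \<noteq> 0}"
  let ?D = "\<lambda>x. frechet_derivative \<phi> (at x) \<beta>" and ?E = "\<lambda>x. frechet_derivative f (at x) \<beta>"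
  have comp: "compact ?S" and sub: "?S \<subseteq> U" using phi by (auto simp: test_functions_def)
  note diff = test_function_continuous(1)[OF phi]
    and cont = test_function_continuous(2)[OF phi] test_function_continuous(3)[OF phi, of \<beta>]
    and out = test_function_outside(1)[of _ \<phi>] and D0 = test_function_outside(2)[of _ \<phi> \<beta>]
  have contf: "continuous_on UNIV f" "continuous_on UNIV ?E"
    using f by (auto intro!: continuous_on_rpoly rpoly_frechet_derivative)
  have int: "integrable lborel h" if "continuous_on UNIV h" "\<And>x. x \<notin> ?S \<Longrightarrow> h x = 0" for h :: "real ^ 'n \<Rightarrow> real"
  proof -
    have "integrable lborel (\<lambda>x. indicator ?S x *\<^sub>R h x)"
      using comp that by (intro borel_integrable_compact) (auto intro: continuous_on_subset)
    moreover have "(\<lambda>x. indicator ?S x *\<^sub>R h x) = h"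
      using indicator_mult_eq[OF that(2) order_refl] by simp
    ultimately show ?thesis by simp
  qed
  have eqU: "integral\<^sup>L (lebesgue_on U) h = integral\<^sup>L lborel h"
    if "continuous_on UNIV h" "\<And>x. x \<notin> ?S \<Longrightarrow> h x = 0" for h :: "real ^ 'n \<Rightarrow> real"
  proof -
    have "(\<lambda>x. indicator U x * h x) = h"
      using indicator_mult_eq[OF that(2) sub] by simp
    then show ?thesis
      using integral_lebesgue_on_eq_lborel[OF borel_measurable_continuous_onI[OF that(1)] borel_open[OF U]] by simp
  qed
  have z1: "f x * ?D x = 0" and z2: "?E x * \<phi> x = 0" if "x \<notin> ?S" for x
    using D0[OF that] out[OF that] by simp_all
  have c1: "continuous_on UNIV (\<lambda>x. f x * ?D x)" and c2: "continuous_on UNIV (\<lambda>x. ?E x * \<phi> x)"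
    by (intro continuous_on_mult cont contf)+
  note i1 = int[of "\<lambda>x. f x * ?D x", OF c1 z1] and i2 = int[of "\<lambda>x. ?E x * \<phi> x", OF c2 z2]
  have "integral\<^sup>L lborel (\<lambda>x. f x * ?D x + ?E x * \<phi> x) = 0"
    using test_function_derivative_integral[OF test_function_mult_poly[OF phi f], of \<beta>]
    by (simp add: frechet_derivative_mult diff rpoly_differentiable f)
  then have "integral\<^sup>L lborel (\<lambda>x. f x * ?D x) = - integral\<^sup>L lborel (\<lambda>x. ?E x * \<phi> x)"
    using i1 i2 by simp
  then show "integral\<^sup>L (lebesgue_on U) (\<lambda>x. f x * ?D x) = - integral\<^sup>L (lebesgue_on U) (\<lambda>x. ?E x * \<phi> x)"
    using eqU[of "\<lambda>x. f x * ?D x", OF c1 z1] eqU[of "\<lambda>x. ?E x * \<phi> x", OF c2 z2] by simp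
qed

section \<open>Uniqueness of weak derivatives\<close>

lemma negligible_iff_AE_lebesgue_on:
  assumes "S \<in> sets lebesgue"
  shows "(AE x in lebesgue_on S. P x) \<longleftrightarrow> negligible {x \<in> S. \<not> P x}"
proof -
  have "(AE x in lebesgue_on S. P x) \<longleftrightarrow> (AE x in lebesgue. x \<in> S \<longrightarrow> P x)"
    using assms by (simp add: AE_restrict_space_iff)
  also have "\<dots> \<longleftrightarrow> negligible {x \<in> S. \<not> P x}"
    unfolding eventually_ae_filter_negligible by (auto intro: negligible_subset)
  finally show ?thesis .
qed

lemma integrable_mult_bounded:
  fixes h c :: "'a \<Rightarrow> real"
  assumes "integrable M h" "c \<in> borel_measurable M" "\<And>x. x \<in> space M \<Longrightarrow> \<bar>c x\<bar> \<le> B"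
  shows "integrable M (\<lambda>x. h x * c x)"
proof (rule Bochner_Integration.integrable_bound[of M "\<lambda>x. B * \<bar>h x\<bar>"])
  show "AE x in M. norm (h x * c x) \<le> norm (B * \<bar>h x\<bar>)"
  proof (rule AE_I2)
    fix x assume "x \<in> space M"
    then have "\<bar>c x\<bar> \<le> \<bar>B\<bar>" using assms(3) by fastforce
    then show "norm (h x * c x) \<le> norm (B * \<bar>h x\<bar>)"
      by (simp add: abs_mult mult.commute mult_right_mono)
  qed
qed (use assms in auto)

text \<open>By Stone--Weierstrass, \<open>H\<close> is orthogonal to all continuous functions; these converge
  boundedly almost everywhere to the sign of \<open>H\<close>.\<close>

lemma negligible_if_orthogonal_to_polynomials:
  fixes H :: "'a::euclidean_space \<Rightarrow> real"
  assumes B: "compact B" and H: "integrable (lebesgue_on B) H"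
    and orth: "\<And>f. rpoly f \<Longrightarrow> integral\<^sup>L (lebesgue_on B) (\<lambda>x. H x * f x) = 0"
  shows "negligible {x \<in> B. H x \<noteq> 0}"
proof -
  have Bs: "B \<in> sets lebesgue" using B by (rule compact_sets_lebesgue)
  have mcont: "c \<in> borel_measurable (lebesgue_on B)" if "continuous_on UNIV c" for c :: "'a \<Rightarrow> real"
    by (rule continuous_imp_measurable_on_sets_lebesgue[OF continuous_on_subset[OF that] Bs]) simp
  have intc: "integrable (lebesgue_on B) (\<lambda>x. H x * c x)" if c: "continuous_on UNIV c" for c :: "'a \<Rightarrow> real"
  proof -
    have "bounded (c ` B)"
      using B c by (intro compact_imp_bounded compact_continuous_image) (auto intro: continuous_on_subset)
    then obtain C where "\<And>x. x \<in> B \<Longrightarrow> \<bar>c x\<bar> \<le> C" by (auto simp: bounded_iff)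
    then show ?thesis using H mcont[OF c] by (intro integrable_mult_bounded) auto
  qed
  have orthc: "integral\<^sup>L (lebesgue_on B) (\<lambda>x. H x * c x) = 0" if c: "continuous_on UNIV c" for c :: "'a \<Rightarrow> real"
  proof -
    let ?I = "integral\<^sup>L (lebesgue_on B) (\<lambda>x. H x * c x)" and ?N = "integral\<^sup>L (lebesgue_on B) (\<lambda>x. \<bar>H x\<bar>)"
    have N0: "0 \<le> ?N" by simp
    have "\<bar>?I\<bar> \<le> e" if e: "0 < e" for e
    proof -
      \<comment> \<open>The summand 1 keeps the denominator positive when \<open>H\<close> has
        integral norm zero.\<close>
      define e' where "e' = e / (?N + 1)"
      have "?N / (?N + 1) \<le> 1" using N0 by (subst divide_le_eq_1_pos; linarith)
      then have "e * (?N / (?N + 1)) \<le> e" using e by (intro mult_left_le) auto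
      then have e': "e' * ?N \<le> e" "0 < e'"
        unfolding e'_def by (simp, intro divide_pos_pos e, use N0 in linarith)
      obtain f where f: "rpoly f" "\<And>x. x \<in> B \<Longrightarrow> \<bar>c x - f x\<bar> < e'"
        using Stone_Weierstrass_real_polynomial_function[OF B continuous_on_subset[OF c subset_UNIV] e'(2)] by metis
      have cf: "continuous_on UNIV (\<lambda>x. c x - f x)" "continuous_on UNIV f"
        using continuous_on_diff[OF c continuous_on_rpoly[OF f(1)]]
          continuous_on_rpoly[OF f(1)] by blast+
      have "?I = integral\<^sup>L (lebesgue_on B) (\<lambda>x. H x * (c x - f x)) + integral\<^sup>L (lebesgue_on B) (\<lambda>x. H x * f x)"
        using intc[OF cf(1)] intc[OF cf(2)]
        by (subst Bochner_Integration.integral_add[symmetric]) (auto simp: algebra_simps)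
      also have "\<dots> = integral\<^sup>L (lebesgue_on B) (\<lambda>x. H x * (c x - f x))" using orth[OF f(1)] by simp
      finally have "\<bar>?I\<bar> \<le> integral\<^sup>L (lebesgue_on B) (\<lambda>x. \<bar>H x * (c x - f x)\<bar>)"
        using integral_abs_bound[of "lebesgue_on B" "\<lambda>x. H x * (c x - f x)"] by simp
      also have "\<dots> \<le> integral\<^sup>L (lebesgue_on B) (\<lambda>x. e' * \<bar>H x\<bar>)"
      proof (rule integral_mono)
        show "integrable (lebesgue_on B) (\<lambda>x. \<bar>H x * (c x - f x)\<bar>)" using intc[OF cf(1)] by simp
        show "integrable (lebesgue_on B) (\<lambda>x. e' * \<bar>H x\<bar>)" using H by simp
        fix x assume "x \<in> space (lebesgue_on B)"
        then have "\<bar>c x - f x\<bar> \<le> e'" using f(2)[of x] by simp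
        then show "\<bar>H x * (c x - f x)\<bar> \<le> e' * \<bar>H x\<bar>"
          by (simp add: abs_mult mult.commute[of e'] mult_left_mono)
      qed
      also have "\<dots> \<le> e" using e'(1) by simp
      finally show ?thesis .
    qed
    then show ?thesis by (metis abs_le_zero_iff dense_ge)
  qed
  have "(\<lambda>x. sgn (H x)) \<in> borel_measurable (lebesgue_on B)"
    using H borel_measurable_integrable by measurable
  then have "(\<lambda>x. sgn (H x)) measurable_on B"
    using measurable_on_iff_borel_measurable[OF Bs] by blast
  then obtain N g where N: "negligible N" and g: "\<And>n. continuous_on UNIV (g n)"
    and lim: "\<And>x. x \<notin> N \<Longrightarrow> (\<lambda>n. g n x) \<longlonglongrightarrow> (if x \<in> B then sgn (H x) else 0)"
    unfolding measurable_on_def by blast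
  \<comment> \<open>Clipping to [-1, 1] gives a bound uniform in \<open>n\<close> and does not
    change the limit, which is a sign.\<close>
  define c where "c n x = max (-1) (min 1 (g n x))" for n x
  have c: "continuous_on UNIV (c n)" for n
    unfolding c_def by (intro continuous_on_max continuous_on_min continuous_on_const g)
  have "(\<lambda>n. integral\<^sup>L (lebesgue_on B) (\<lambda>x. H x * c n x)) \<longlonglongrightarrow> integral\<^sup>L (lebesgue_on B) (\<lambda>x. \<bar>H x\<bar>)"
  proof (rule integral_dominated_convergence[where w = "\<lambda>x. \<bar>H x\<bar>"])
    show "integrable (lebesgue_on B) (\<lambda>x. \<bar>H x\<bar>)" "(\<lambda>x. \<bar>H x\<bar>) \<in> borel_measurable (lebesgue_on B)"
      using H by auto
    show "(\<lambda>x. H x * c n x) \<in> borel_measurable (lebesgue_on B)" for n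
      using intc[OF c] by blast
    show "AE x in lebesgue_on B. norm (H x * c n x) \<le> \<bar>H x\<bar>" for n
    proof (rule AE_I2)
      fix x
      have "\<bar>c n x\<bar> \<le> 1" by (auto simp: c_def)
      then show "norm (H x * c n x) \<le> \<bar>H x\<bar>" by (simp add: abs_mult mult_left_le)
    qed
    show "AE x in lebesgue_on B. (\<lambda>n. H x * c n x) \<longlonglongrightarrow> \<bar>H x\<bar>"
      unfolding negligible_iff_AE_lebesgue_on[OF Bs]
    proof (rule negligible_subset[OF N], clarify, rule ccontr)
      fix x assume x: "x \<in> B" "x \<notin> N" "\<not> (\<lambda>n. H x * c n x) \<longlonglongrightarrow> \<bar>H x\<bar>"
      have "(\<lambda>n. H x * c n x) \<longlonglongrightarrow> H x * max (-1) (min 1 (sgn (H x)))"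
        unfolding c_def using lim[OF x(2)] x(1) by (intro tendsto_intros) auto
      moreover have "H x * max (-1) (min 1 (sgn (H x))) = \<bar>H x\<bar>"
        by (simp add: sgn_if)
      ultimately show False using x by simp
    qed
  qed
  then have "integral\<^sup>L (lebesgue_on B) (\<lambda>x. \<bar>H x\<bar>) = 0"
    by (simp add: orthc[OF c] LIMSEQ_const_iff)
  then have "AE x in lebesgue_on B. \<bar>H x\<bar> = 0"
    using H by (subst (asm) integral_nonneg_eq_0_iff_AE) auto
  then show ?thesis using negligible_iff_AE_lebesgue_on[OF Bs] by simp
qed

lemma integrable_mult_test_function:
  assumes U: "open U" and g: "loc_integrable U g" and phi: "\<phi> \<in> test_functions U"
  shows "integrable (lebesgue_on U) (\<lambda>x. g x * \<phi> x)"
proof -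
  let ?S = "closure {x. \<phi> x \<noteq> 0}"
  have comp: "compact ?S" and sub: "?S \<subseteq> U" using phi by (auto simp: test_functions_def)
  have Ss: "?S \<in> sets lebesgue" by (rule compact_sets_lebesgue[OF comp])
  note cont = continuous_on_subset[OF test_function_continuous(2)[OF phi] subset_UNIV]
  have "bounded (\<phi> ` ?S)"
    by (intro compact_imp_bounded compact_continuous_image cont comp)
  then obtain C where C: "\<And>x. x \<in> ?S \<Longrightarrow> \<bar>\<phi> x\<bar> \<le> C" by (auto simp: bounded_iff)
  have "integrable (lebesgue_on ?S) (\<lambda>x. g x * \<phi> x)"
    using g comp sub C continuous_imp_measurable_on_sets_lebesgue[OF cont Ss]
    by (intro integrable_mult_bounded[of _ _ _ C]) (auto simp: loc_integrable_def)
  then have "integrable lebesgue (\<lambda>x. indicator ?S x *\<^sub>R (g x * \<phi> x))"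
    using Ss by (simp add: integrable_restrict_space)
  moreover have "(\<lambda>x. indicator ?S x * (g x * \<phi> x)) = (\<lambda>x. indicator U x * (g x * \<phi> x))"
  proof -
    have "g x * \<phi> x = 0" if "x \<notin> ?S" for x using test_function_outside(1)[OF that] by simp
    note indicator_mult_eq[of ?S "\<lambda>x. g x * \<phi> x", OF this]
    from this[OF _ order_refl] this[OF _ sub] show ?thesis by simp
  qed
  ultimately show ?thesis using U by (simp add: integrable_restrict_space)
qed

text \<open>On a closed box inside \<open>U\<close>, the difference times the bump of the box is
  integrable and orthogonal to every polynomial, because bump times polynomial is a test function.
  Hence it vanishes almost everywhere on the box, and countably many boxes exhaust
  \<open>U\<close>.\<close>

lemma is_weak_deriv_unique:
  fixes v :: "real ^ 'n \<Rightarrow> real"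
  assumes U: "open U" and g: "is_weak_deriv \<beta> U v g" and g': "is_weak_deriv \<beta> U v g'"
  shows "negligible {x \<in> U. g x \<noteq> g' x}"
proof -
  define h where "h x = g x - g' x" for x
  have gl: "loc_integrable U g" "loc_integrable U g'" using g g' by (auto simp: is_weak_deriv_def)
  then have h: "loc_integrable U h"
    unfolding loc_integrable_def h_def by (auto intro!: Bochner_Integration.integrable_diff)
  have orth: "integral\<^sup>L (lebesgue_on U) (\<lambda>x. h x * \<phi> x) = 0" if phi: "\<phi> \<in> test_functions U" for \<phi>
  proof -
    have "integral\<^sup>L (lebesgue_on U) (\<lambda>x. g x * \<phi> x) = integral\<^sup>L (lebesgue_on U) (\<lambda>x. g' x * \<phi> x)"
      using g g' phi by (simp add: is_weak_deriv_def)
    then show ?thesis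
      using integrable_mult_test_function[OF U gl(1) phi] integrable_mult_test_function[OF U gl(2) phi]
      by (simp add: h_def left_diff_distrib)
  qed
  have box: "negligible {x \<in> cbox a b. h x \<noteq> 0}" if ab: "cbox a b \<subseteq> U" for a b
  proof -
    have bcont: "continuous_on UNIV (bump a b)" using Ck_bump[of 0 a b] by simp
    have bs: "cbox a b \<in> sets lebesgue" by simp
    have "bounded (bump a b ` cbox a b)"
      using bcont by (intro compact_imp_bounded compact_continuous_image) (auto intro: continuous_on_subset)
    then obtain C where "\<And>x. x \<in> cbox a b \<Longrightarrow> \<bar>bump a b x\<bar> \<le> C" by (auto simp: bounded_iff)
    moreover have "bump a b \<in> borel_measurable (lebesgue_on (cbox a b))"
      by (rule continuous_imp_measurable_on_sets_lebesgue[OF continuous_on_subset[OF bcont] bs]) simp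
    ultimately have int: "integrable (lebesgue_on (cbox a b)) (\<lambda>x. h x * bump a b x)"
      using h ab by (intro integrable_mult_bounded[of _ _ _ C]) (auto simp: loc_integrable_def)
    have "negligible {x \<in> cbox a b. h x * bump a b x \<noteq> 0}"
    proof (rule negligible_if_orthogonal_to_polynomials[OF compact_cbox int])
      fix f :: "real ^ 'n \<Rightarrow> real" assume f: "rpoly f"
      have "(\<lambda>x. indicator (cbox a b) x * (h x * bump a b x * f x)) = (\<lambda>x. indicator U x * (h x * (bump a b x * f x)))"
        using ab bump_outside[of _ a b] box_subset_cbox[of a b] by (intro ext) (auto split: split_indicator)
      then have "integral\<^sup>L (lebesgue_on (cbox a b)) (\<lambda>x. h x * bump a b x * f x)
          = integral\<^sup>L (lebesgue_on U) (\<lambda>x. h x * (bump a b x * f x))"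
        using U by (simp add: integral_restrict_space)
      also have "\<dots> = 0" by (rule orth[OF test_function_bump_poly[OF ab f]])
      finally show "integral\<^sup>L (lebesgue_on (cbox a b)) (\<lambda>x. h x * bump a b x * f x) = 0" .
    qed
    \<comment> \<open>The bump can be divided out in the open box only; the faces of the box, where
      it vanishes, form a null set.\<close>
    moreover have "{x \<in> cbox a b. h x \<noteq> 0} \<subseteq> {x \<in> cbox a b. h x * bump a b x \<noteq> 0} \<union> (cbox a b - box a b)"
      using bump_pos[of _ a b] by force
    ultimately show ?thesis
      by (meson negligible_Un negligible_frontier_interval negligible_subset)
  qed
  obtain \<D> where D: "countable \<D>" "\<D> \<subseteq> Pow U" "\<And>X. X \<in> \<D> \<Longrightarrow> \<exists>a b. X = cbox a b" "\<Union>\<D> = U"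
    using open_countable_Union_open_cbox[OF U] by metis
  have "{x \<in> U. g x \<noteq> g' x} \<subseteq> \<Union>((\<lambda>X. {x \<in> X. h x \<noteq> 0}) ` \<D>)"
    using D(4) by (auto simp: h_def)
  moreover have "negligible (\<Union>((\<lambda>X. {x \<in> X. h x \<noteq> 0}) ` \<D>))"
    using D box by (intro negligible_countable_Union) (auto, metis PowD subsetD)
  ultimately show ?thesis using negligible_subset by blast
qed

section \<open>Positive definite forms on finite-dimensional spaces of functions\<close>

text \<open>Polynomial spaces are sets of functions rather than types. Making all real functions a
  vector space gives access to spans and to the bound on the size of independent sets.\<close>

global_interpretation fun_vs: vector_space "\<lambda>(c::real) (f::'a \<Rightarrow> real) x. c * f x"
  by unfold_locales (simp_all add: fun_eq_iff distrib_left distrib_right)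

text \<open>Linearity is required in the second argument only, and everything only on
  \<open>S\<close>; symmetry supplies the rest. Finite dimension is phrased by a finite set spanning
  a larger space, so that subspaces of polynomial spaces inherit it at once.\<close>

locale pos_def_form =
  fixes S :: "('a \<Rightarrow> real) set" and a :: "('a \<Rightarrow> real) \<Rightarrow> ('a \<Rightarrow> real) \<Rightarrow> real"
  assumes zero_mem: "(\<lambda>x. 0) \<in> S"
    and add_mem: "f \<in> S \<Longrightarrow> g \<in> S \<Longrightarrow> (\<lambda>x. f x + g x) \<in> S"
    and scale_mem: "f \<in> S \<Longrightarrow> (\<lambda>x. c * f x) \<in> S"
    and finite_dim: "\<exists>B. finite B \<and> S \<subseteq> fun_vs.span B"
    and form_sym: "f \<in> S \<Longrightarrow> g \<in> S \<Longrightarrow> a f g = a g f"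
    and form_add: "f \<in> S \<Longrightarrow> g \<in> S \<Longrightarrow> h \<in> S \<Longrightarrow> a h (\<lambda>x. f x + g x) = a h f + a h g"
    and form_scale: "f \<in> S \<Longrightarrow> h \<in> S \<Longrightarrow> a h (\<lambda>x. c * f x) = c * a h f"
    and pos: "f \<in> S \<Longrightarrow> f \<noteq> (\<lambda>x. 0) \<Longrightarrow> 0 < a f f"
begin

lemma sum_mem:
  "finite E \<Longrightarrow> E \<subseteq> S \<Longrightarrow> (\<lambda>x. \<Sum>e\<in>E. c e * e x) \<in> S"
  by (induction rule: finite_induct) (auto intro: zero_mem add_mem scale_mem)

lemma form_zero: "h \<in> S \<Longrightarrow> a h (\<lambda>x. 0) = 0"
  using form_scale[of "\<lambda>x. 0" h 0] zero_mem by simp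

lemma form_sum:
  "finite E \<Longrightarrow> E \<subseteq> S \<Longrightarrow> h \<in> S \<Longrightarrow> a h (\<lambda>x. \<Sum>e\<in>E. c e * e x) = (\<Sum>e\<in>E. c e * a h e)"
  by (induction rule: finite_induct) (auto simp: form_zero form_add form_scale sum_mem scale_mem)

definition orthonormal :: "('a \<Rightarrow> real) set \<Rightarrow> bool" where
  "orthonormal E \<longleftrightarrow> finite E \<and> E \<subseteq> S \<and> (\<forall>e\<in>E. \<forall>e'\<in>E. a e e' = (if e = e' then 1 else 0))"

lemma orthonormal_coeff:
  assumes "orthonormal E" "e \<in> E"
  shows "a e (\<lambda>x. \<Sum>e\<in>E. c e * e x) = c e"
proof -
  have "a e (\<lambda>x. \<Sum>e\<in>E. c e * e x) = (\<Sum>e'\<in>E. c e' * a e e')"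
    using assms by (intro form_sum) (auto simp: orthonormal_def)
  also have "\<dots> = (\<Sum>e'\<in>E. if e' = e then c e' else 0)"
    using assms by (intro sum.cong) (auto simp: orthonormal_def)
  also have "\<dots> = c e" using assms by (auto simp: orthonormal_def)
  finally show ?thesis .
qed

text \<open>\<open>B\<close> may be dependent: if the remainder of \<open>b\<close> after projection
  is zero, \<open>E\<close> is kept; otherwise the normalised remainder is added to it.\<close>

lemma gram_schmidt:
  assumes "finite B" "B \<subseteq> S"
  shows "\<exists>E. orthonormal E \<and> (\<forall>b\<in>B. \<exists>c. b = (\<lambda>x. \<Sum>e\<in>E. c e * e x))"
  using assms
proof (induction rule: finite_induct)
  case empty
  then show ?case by (auto intro!: exI[of _ "{}"] simp: orthonormal_def)
next
  case (insert b B)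
  then obtain E where E: "orthonormal E" "\<And>b. b \<in> B \<Longrightarrow> \<exists>c. b = (\<lambda>x. \<Sum>e\<in>E. c e * e x)" by auto
  have fE: "finite E" "E \<subseteq> S" using E by (auto simp: orthonormal_def)
  have bS: "b \<in> S" using insert by simp
  define p where "p x = (\<Sum>e\<in>E. a e b * e x)" for x
  have pS: "p \<in> S" using sum_mem[OF fE] by (simp add: p_def[abs_def])
  define b' where "b' x = b x + (-1) * p x" for x
  have b'S: "b' \<in> S" unfolding b'_def by (intro add_mem scale_mem bS pS)
  show ?case
  proof (cases "b' = (\<lambda>x. 0)")
    case True
    then have "b = (\<lambda>x. \<Sum>e\<in>E. a e b * e x)" by (auto simp: b'_def p_def fun_eq_iff)
    then have "\<exists>c. b = (\<lambda>x. \<Sum>e\<in>E. c e * e x)" by (rule exI[of _ "\<lambda>e. a e b"])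
    then show ?thesis using E by (intro exI[of _ E]) auto
  next
    case False
    define s where "s = sqrt (a b' b')"
    have s: "s > 0" "s * s = a b' b'" using pos[OF b'S False] by (auto simp: s_def)
    define n where "n x = (1 / s) * b' x" for x
    have n_eq: "n = (\<lambda>x. (1 / s) * b' x)" by (rule ext) (simp only: n_def)
    have nS: "n \<in> S" unfolding n_def by (intro scale_mem b'S)
    have orth: "a e b' = 0" if "e \<in> E" for e
    proof -
      have eS: "e \<in> S" using that fE by auto
      have "a e b' = a e b + (-1) * a e p"
        unfolding b'_def by (simp only: form_add[OF bS scale_mem[OF pS] eS] form_scale[OF pS eS])
      then show ?thesis using orthonormal_coeff[OF E(1) that, of "\<lambda>e. a e b"] by (simp add: p_def[abs_def])
    qed
    have orthn: "a e n = 0" "a n e = 0" if "e \<in> E" for e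
    proof -
      have eS: "e \<in> S" using that fE by auto
      show "a e n = 0"
        using form_scale[OF b'S eS, of "1 / s"] orth[OF that] unfolding n_eq[symmetric] by simp
      then show "a n e = 0" using form_sym[OF nS eS] by simp
    qed
    have "a n n = (1 / s) * a n b'" using form_scale[OF b'S nS, of "1 / s"] unfolding n_eq[symmetric] .
    also have "a n b' = (1 / s) * a b' b'" 
      using form_sym[OF nS b'S] form_scale[OF b'S b'S, of "1 / s"] unfolding n_eq[symmetric] by simp
    finally have nn: "a n n = 1" using s(1) by (simp add: s(2)[symmetric])
    have nE: "n \<notin> E" using orthn nn by auto
    have "orthonormal (insert n E)"
      using E(1) nS nn orthn nE by (auto simp: orthonormal_def)
    moreover have "\<exists>c. b'' = (\<lambda>x. \<Sum>e\<in>insert n E. c e * e x)" if b'': "b'' \<in> insert b B" for b''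
    proof (cases "b'' = b")
      case True
      have "b = (\<lambda>x. \<Sum>e\<in>insert n E. (if e = n then s else a e b) * e x)"
      proof
        fix x
        have "(\<Sum>e\<in>insert n E. (if e = n then s else a e b) * e x) = s * n x + (\<Sum>e\<in>E. (if e = n then s else a e b) * e x)"
          using nE fE by simp
        also have "(\<Sum>e\<in>E. (if e = n then s else a e b) * e x) = p x"
          unfolding p_def using nE by (intro sum.cong) auto
        also have "s * n x + p x = b x" using s(1) by (simp add: n_def b'_def)
        finally show "b x = (\<Sum>e\<in>insert n E. (if e = n then s else a e b) * e x)" by (rule sym)
      qed
      then show ?thesis unfolding True by (rule exI[of _ "\<lambda>e. if e = n then s else a e b"])
    next
      case False
      then obtain c where c: "b'' = (\<lambda>x. \<Sum>e\<in>E. c e * e x)" using b'' E(2) by auto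
      have "b'' = (\<lambda>x. \<Sum>e\<in>insert n E. (if e = n then 0 else c e) * e x)"
      proof
        fix x
        have "(\<Sum>e\<in>E. (if e = n then 0 else c e) * e x) = (\<Sum>e\<in>E. c e * e x)"
          using nE by (intro sum.cong) auto
        then show "b'' x = (\<Sum>e\<in>insert n E. (if e = n then 0 else c e) * e x)"
          using nE fE c by simp
      qed
      then show ?thesis by (rule exI[of _ "\<lambda>e. if e = n then 0 else c e"])
    qed
    ultimately show ?thesis by blast
  qed
qed

lemma orthonormal_basis:
  obtains E where "orthonormal E" "\<And>f. f \<in> S \<Longrightarrow> f = (\<lambda>x. \<Sum>e\<in>E. a e f * e x)"
proof -
  obtain B0 where B0: "finite B0" "S \<subseteq> fun_vs.span B0" using finite_dim by auto
  obtain B where B: "B \<subseteq> S" "fun_vs.independent B" "S \<subseteq> fun_vs.span B"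
    using fun_vs.maximal_independent_subset[of S] by blast
  \<comment> \<open>An independent set inside the span of a finite set has at most as many elements
    as that finite set.\<close>
  have fB: "finite B" using fun_vs.independent_span_bound[OF B0(1) B(2)] B(1) B0(2) by auto
  obtain E where E: "orthonormal E" "\<And>b. b \<in> B \<Longrightarrow> \<exists>c. b = (\<lambda>x. \<Sum>e\<in>E. c e * e x)"
    using gram_schmidt[OF fB B(1)] by auto
  have span: "\<exists>c. f = (\<lambda>x. \<Sum>e\<in>E. c e * e x)" if "f \<in> fun_vs.span B" for f
    using that
  proof (induction rule: fun_vs.span_induct_alt)
    case base
    show ?case by (auto simp: zero_fun_def intro!: exI[of _ "\<lambda>_. 0"])
  next
    case (step k b f)
    obtain c where c: "b = (\<lambda>x. \<Sum>e\<in>E. c e * e x)" using E(2)[OF step(1)] by (rule exE)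
    obtain d where d: "f = (\<lambda>x. \<Sum>e\<in>E. d e * e x)" using step.IH by (rule exE)
    show ?case unfolding c d
      by (intro exI[of _ "\<lambda>e. k * c e + d e"])
        (simp add: plus_fun_def fun_eq_iff sum.distrib sum_distrib_left algebra_simps)
  qed
  have "f = (\<lambda>x. \<Sum>e\<in>E. a e f * e x)" if f: "f \<in> S" for f
  proof -
    obtain c where c: "f = (\<lambda>x. \<Sum>e\<in>E. c e * e x)" using span f B(3) by blast
    then have "a e f = c e" if "e \<in> E" for e using orthonormal_coeff[OF E(1) that, of c] by simp
    then have "(\<lambda>x. \<Sum>e\<in>E. a e f * e x) = (\<lambda>x. \<Sum>e\<in>E. c e * e x)" by (intro ext sum.cong) auto
    then show ?thesis using c by simp
  qed
  then show thesis by (rule that[OF E(1)])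
qed

lemma functional_sum:
  assumes "\<And>f g. f \<in> S \<Longrightarrow> g \<in> S \<Longrightarrow> l (\<lambda>x. f x + g x) = l f + l g"
    and scale: "\<And>c f. f \<in> S \<Longrightarrow> l (\<lambda>x. c * f x) = c * l f"
  shows "finite F \<Longrightarrow> F \<subseteq> S \<Longrightarrow> l (\<lambda>x. \<Sum>e\<in>F. c e * e x) = (\<Sum>e\<in>F. c e * (l e :: real))"
proof (induction rule: finite_induct)
  case empty
  then show ?case using scale[OF zero_mem, of 0] by simp
next
  case (insert x F)
  then show ?case by (simp add: assms scale_mem sum_mem)
qed

text \<open>In an orthonormal basis the representative has the values of \<open>l\<close> on the
  basis vectors as its coefficients. This produces both components of the projected
  function.\<close>

lemma riesz:
  assumes add: "\<And>f g. f \<in> S \<Longrightarrow> g \<in> S \<Longrightarrow> l (\<lambda>x. f x + g x) = l f + l g"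
    and scale: "\<And>c f. f \<in> S \<Longrightarrow> l (\<lambda>x. c * f x) = c * l f"
  shows "\<exists>r\<in>S. \<forall>f\<in>S. a f r = l f"
proof -
  obtain E where E: "orthonormal E" "\<And>f. f \<in> S \<Longrightarrow> f = (\<lambda>x. \<Sum>e\<in>E. a e f * e x)"
    using orthonormal_basis by blast
  have fE: "finite E" "E \<subseteq> S" using E(1) by (auto simp: orthonormal_def)
  have lsum: "l (\<lambda>x. \<Sum>e\<in>E. c e * e x) = (\<Sum>e\<in>E. c e * l e)" for c
    by (rule functional_sum[OF _ _ fE]) (simp_all add: add scale)
  define r where "r x = (\<Sum>e\<in>E. l e * e x)" for x
  have rS: "r \<in> S" using sum_mem[OF fE] by (simp add: r_def[abs_def])
  have "a f r = l f" if f: "f \<in> S" for f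
  proof -
    have "a f r = (\<Sum>e\<in>E. l e * a f e)"
      using form_sum[OF fE f, of l] by (simp add: r_def[abs_def])
    also have "\<dots> = (\<Sum>e\<in>E. a e f * l e)"
      using fE form_sym[OF f] by (intro sum.cong) (auto simp: mult.commute)
    also have "\<dots> = l f" using lsum[of "\<lambda>e. a e f"] E(2)[OF f] by simp
    finally show ?thesis .
  qed
  then show ?thesis using rS by blast
qed

lemma form_eqD:
  assumes "r \<in> S" "r' \<in> S" "\<And>f. f \<in> S \<Longrightarrow> a f r = a f r'"
  shows "r = r'"
proof -
  define d where "d x = r x + (-1) * r' x" for x
  have dS: "d \<in> S" unfolding d_def by (intro add_mem scale_mem assms)
  have "a d d = a d r + (-1) * a d r'"
    using form_add[OF assms(1) scale_mem[OF assms(2), of "-1"] dS] form_scale[OF assms(2) dS, of "-1"]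
    by (simp only: d_def[symmetric, abs_def])
  then have "a d d = 0" using assms(3)[OF dS] by simp
  then have "d = (\<lambda>x. 0)" using pos[OF dS] by force
  then show ?thesis by (auto simp: d_def fun_eq_iff)
qed

text \<open>This is the norm equivalence in the form used below: \<open>T\<close> is a family of
  linear functionals indexed by points, such as evaluation or a partial derivative at a point.
  Expansion in an orthonormal basis and Cauchy-Schwarz reduce uniformity in the point to finitely
  many basis vectors.\<close>

lemma operator_bound:
  assumes add: "\<And>f g x. f \<in> S \<Longrightarrow> g \<in> S \<Longrightarrow> x \<in> X \<Longrightarrow> T (\<lambda>x. f x + g x) x = T f x + T g x"
    and scale: "\<And>c f x. f \<in> S \<Longrightarrow> x \<in> X \<Longrightarrow> T (\<lambda>x. c * f x) x = c * T f x"
    and bounded: "\<And>f. f \<in> S \<Longrightarrow> \<exists>B. \<forall>x\<in>X. \<bar>T f x :: real\<bar> \<le> B"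
  shows "\<exists>C>0. \<forall>f\<in>S. \<forall>x\<in>X. (T f x)\<^sup>2 \<le> C * a f f"
proof -
  obtain E where E: "orthonormal E" "\<And>f. f \<in> S \<Longrightarrow> f = (\<lambda>x. \<Sum>e\<in>E. a e f * e x)"
    using orthonormal_basis by blast
  have fE: "finite E" "E \<subseteq> S" using E(1) by (auto simp: orthonormal_def)
  have "\<exists>B. \<forall>x\<in>X. \<bar>T e x\<bar> \<le> B" if "e \<in> E" for e using bounded fE that by blast
  then obtain B where B: "\<And>e x. e \<in> E \<Longrightarrow> x \<in> X \<Longrightarrow> \<bar>T e x\<bar> \<le> B e" by metis
  \<comment> \<open>The summand 1 keeps the constant positive when the basis is empty, which happens
    for polynomial spaces of negative degree.\<close>
  define C where "C = (\<Sum>e\<in>E. (B e)\<^sup>2) + 1"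
  have "0 < C" unfolding C_def by (intro add_nonneg_pos sum_nonneg) auto
  moreover have "(T f x)\<^sup>2 \<le> C * a f f" if f: "f \<in> S" and x: "x \<in> X" for f x
  proof -
    have nn: "a f f = (\<Sum>e\<in>E. (a e f)\<^sup>2)"
    proof -
      have "a f f = a f (\<lambda>x. \<Sum>e\<in>E. a e f * e x)" using E(2)[OF f] by metis
      also have "\<dots> = (\<Sum>e\<in>E. a e f * a f e)" by (rule form_sum[OF fE f])
      also have "\<dots> = (\<Sum>e\<in>E. (a e f)\<^sup>2)"
        using fE form_sym[OF f] by (intro sum.cong) (auto simp: power2_eq_square)
      finally show ?thesis .
    qed
    have "T f x = T (\<lambda>x. \<Sum>e\<in>E. a e f * e x) x" using E(2)[OF f] by metis
    also have "\<dots> = (\<Sum>e\<in>E. a e f * T e x)"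
      by (rule functional_sum[of "\<lambda>f. T f x", OF _ _ fE]) (simp_all add: add scale x)
    finally have "(T f x)\<^sup>2 = (\<Sum>e\<in>E. a e f * T e x)\<^sup>2" by simp
    also have "\<dots> \<le> (\<Sum>e\<in>E. (a e f)\<^sup>2) * (\<Sum>e\<in>E. (T e x)\<^sup>2)"
      by (rule Cauchy_Schwarz_ineq_sum)
    also have "\<dots> \<le> (\<Sum>e\<in>E. (a e f)\<^sup>2) * C"
    proof (rule mult_left_mono)
      have "(\<Sum>e\<in>E. (T e x)\<^sup>2) \<le> (\<Sum>e\<in>E. (B e)\<^sup>2)"
        using B[OF _ x] by (intro sum_mono abs_le_square_iff[THEN iffD1]) force
      then show "(\<Sum>e\<in>E. (T e x)\<^sup>2) \<le> C" by (simp add: C_def)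
    qed (auto intro: sum_nonneg)
    finally show ?thesis using nn by (simp add: mult.commute)
  qed
  ultimately show ?thesis by blast
qed

end

section \<open>Polynomials of bounded degree\<close>

definition monomial :: "('n \<Rightarrow> nat) \<Rightarrow> real ^ 'n \<Rightarrow> real" where
  "monomial \<alpha> x = (\<Prod>i\<in>UNIV. (x $ i) ^ \<alpha> i)"

lemma finite_multi_indices: "finite {\<alpha> :: 'n::finite \<Rightarrow> nat. int (\<Sum>i\<in>UNIV. \<alpha> i) \<le> j}"
proof (rule finite_subset)
  have "\<alpha> i \<le> nat j" if "int (\<Sum>i\<in>UNIV. \<alpha> i) \<le> j" for \<alpha> :: "'n \<Rightarrow> nat" and i
    using that member_le_sum[of i UNIV \<alpha>] by (simp del: of_nat_sum)
  then show "{\<alpha> :: 'n \<Rightarrow> nat. int (\<Sum>i\<in>UNIV. \<alpha> i) \<le> j} \<subseteq> Pi\<^sub>E UNIV (\<lambda>_. {..nat j})"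
    by (simp add: subset_iff PiE_UNIV_domain Pi_iff del: of_nat_sum)
  show "finite (Pi\<^sub>E (UNIV :: 'n set) (\<lambda>_. {..nat j}))"
    by (rule finite_PiE) simp_all
qed

lemma Pol_alt: "Pol j = {f. \<exists>c. f = (\<lambda>x. \<Sum>\<alpha> | int (\<Sum>i\<in>UNIV. \<alpha> i) \<le> j. c \<alpha> * monomial \<alpha> x)}"
  unfolding Pol_def monomial_def by (rule refl)

lemma PolI: "f = (\<lambda>x. \<Sum>\<alpha> | int (\<Sum>i\<in>UNIV. \<alpha> i) \<le> j. c \<alpha> * monomial \<alpha> x) \<Longrightarrow> f \<in> Pol j"
  unfolding Pol_alt by (intro CollectI exI[of _ c])

lemma PolE:
  assumes "f \<in> Pol j"
  obtains c where "f = (\<lambda>x. \<Sum>\<alpha> | int (\<Sum>i\<in>UNIV. \<alpha> i) \<le> j. c \<alpha> * monomial \<alpha> x)"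
  using assms unfolding Pol_alt by blast

lemma Pol_zero: "(\<lambda>x. 0) \<in> Pol j"
  by (rule PolI[where c = "\<lambda>_. 0"]) simp

lemma Pol_add:
  assumes "f \<in> Pol j" "g \<in> Pol j" shows "(\<lambda>x. f x + g x) \<in> Pol j"
proof -
  obtain c where c: "f = (\<lambda>x. \<Sum>\<alpha> | int (\<Sum>i\<in>UNIV. \<alpha> i) \<le> j. c \<alpha> * monomial \<alpha> x)"
    using assms(1) by (rule PolE)
  obtain d where d: "g = (\<lambda>x. \<Sum>\<alpha> | int (\<Sum>i\<in>UNIV. \<alpha> i) \<le> j. d \<alpha> * monomial \<alpha> x)"
    using assms(2) by (rule PolE)
  show ?thesis unfolding c d
    by (rule PolI[where c = "\<lambda>\<alpha>. c \<alpha> + d \<alpha>"]) (simp only: distrib_right sum.distrib)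
qed

lemma Pol_scale:
  assumes "f \<in> Pol j" shows "(\<lambda>x. s * f x) \<in> Pol j"
proof -
  obtain c where c: "f = (\<lambda>x. \<Sum>\<alpha> | int (\<Sum>i\<in>UNIV. \<alpha> i) \<le> j. c \<alpha> * monomial \<alpha> x)"
    using assms by (rule PolE)
  show ?thesis unfolding c
    by (rule PolI[where c = "\<lambda>\<alpha>. s * c \<alpha>"]) (simp only: sum_distrib_left mult.assoc)
qed

lemma monomial_Pol:
  assumes "int (\<Sum>i\<in>UNIV. \<alpha> i) \<le> j" shows "monomial \<alpha> \<in> Pol j"
proof (rule PolI[where c = "\<lambda>\<alpha>'. if \<alpha>' = \<alpha> then 1 else 0"], rule ext)
  fix x
  have "(\<Sum>\<alpha>' | int (\<Sum>i\<in>UNIV. \<alpha>' i) \<le> j. (if \<alpha>' = \<alpha> then 1 else 0) * monomial \<alpha>' x)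
    = (\<Sum>\<alpha>' | int (\<Sum>i\<in>UNIV. \<alpha>' i) \<le> j. if \<alpha>' = \<alpha> then monomial \<alpha>' x else 0)"
    by (intro sum.cong) auto
  also have "\<dots> = monomial \<alpha> x"
    using assms by (subst sum.delta[OF finite_multi_indices]) (simp del: of_nat_sum)
  finally show "monomial \<alpha> x = (\<Sum>\<alpha>' | int (\<Sum>i\<in>UNIV. \<alpha>' i) \<le> j. (if \<alpha>' = \<alpha> then 1 else 0) * monomial \<alpha>' x)"
    by (rule sym)
qed

text \<open>Reduces properties stable under linear combinations to single monomials. It also covers
  negative \<open>j\<close>, where no monomial qualifies and the space is trivial.\<close>

lemma Pol_induct [consumes 1, case_names zero add scale monomial]:
  assumes f: "f \<in> Pol j" and zero: "P (\<lambda>x. 0)"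
    and add: "\<And>f g. f \<in> Pol j \<Longrightarrow> g \<in> Pol j \<Longrightarrow> P f \<Longrightarrow> P g \<Longrightarrow> P (\<lambda>x. f x + g x)"
    and scale: "\<And>c f. f \<in> Pol j \<Longrightarrow> P f \<Longrightarrow> P (\<lambda>x. c * f x)"
    and mono: "\<And>\<alpha>. int (\<Sum>i\<in>UNIV. \<alpha> i) \<le> j \<Longrightarrow> P (monomial \<alpha>)"
  shows "P f"
proof -
  obtain c where c: "f = (\<lambda>x. \<Sum>\<alpha> | int (\<Sum>i\<in>UNIV. \<alpha> i) \<le> j. c \<alpha> * monomial \<alpha> x)"
    using f by (rule PolE)
  have "(\<lambda>x. \<Sum>\<alpha>\<in>A. c \<alpha> * monomial \<alpha> x) \<in> Pol j \<and> P (\<lambda>x. \<Sum>\<alpha>\<in>A. c \<alpha> * monomial \<alpha> x)"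
    if "finite A" "A \<subseteq> {\<alpha>. int (\<Sum>i\<in>UNIV. \<alpha> i) \<le> j}" for A
    using that
  proof (induction rule: finite_induct)
    case empty
    then show ?case using zero Pol_zero by simp
  next
    case (insert \<alpha> A)
    then show ?case by (simp add: Pol_add Pol_scale monomial_Pol add scale mono del: of_nat_sum)
  qed
  from this[OF finite_multi_indices order_refl] show ?thesis unfolding c by (rule conjunct2)
qed

lemma Pol_mono: "f \<in> Pol i \<Longrightarrow> i \<le> j \<Longrightarrow> f \<in> Pol j"
  by (induction rule: Pol_induct) (simp_all add: Pol_zero Pol_add Pol_scale monomial_Pol del: of_nat_sum)

lemma Pol_sum: "finite I \<Longrightarrow> (\<And>i. i \<in> I \<Longrightarrow> f i \<in> Pol j) \<Longrightarrow> (\<lambda>x. \<Sum>i\<in>I. f i x) \<in> Pol j"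
  by (induction rule: finite_induct) (simp_all add: Pol_zero Pol_add)

lemma monomial_mult: "monomial \<alpha> x * monomial \<beta> x = monomial (\<lambda>i. \<alpha> i + \<beta> i) x"
  by (simp add: monomial_def power_add prod.distrib)

lemma Pol_mult:
  assumes "f \<in> Pol i" "g \<in> Pol j" shows "(\<lambda>x. f x * g x) \<in> Pol (i + j)"
  using assms(1)
proof (induction rule: Pol_induct)
  case zero
  show ?case by (simp add: Pol_zero)
next
  case (add f f')
  show ?case using Pol_add[OF add(3,4)] by (simp only: distrib_right)
next
  case (scale c f)
  show ?case using Pol_scale[OF scale(2), of c] by (simp only: mult.assoc)
next
  case (monomial \<alpha>)
  from assms(2) show ?case
  proof (induction rule: Pol_induct)
    case zero
    show ?case by (simp add: Pol_zero)
  next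
    case (add f f')
    show ?case using Pol_add[OF add(3,4)] by (simp only: distrib_left)
  next
    case (scale c f)
    show ?case using Pol_scale[OF scale(2), of c] by (simp only: mult.left_commute)
  next
    case (monomial \<beta>)
    then show ?case unfolding monomial_mult
      using \<open>int (sum \<alpha> UNIV) \<le> i\<close> by (intro monomial_Pol) (simp add: sum.distrib)
  qed
qed

lemma Pol_const: "0 \<le> j \<Longrightarrow> (\<lambda>x. c) \<in> Pol j"
proof -
  assume "0 \<le> j"
  then have "monomial (\<lambda>_. 0) \<in> Pol j" by (intro monomial_Pol) simp
  from Pol_scale[OF this, of c] show ?thesis by (simp add: monomial_def)
qed

lemma Pol_component: "(\<lambda>x. x $ i) \<in> Pol 1"
proof -
  have "(\<Prod>l\<in>UNIV. (x $ l) ^ (if l = i then 1 else 0)) = x $ i" for x :: "real ^ 'a"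
    by (simp add: if_distrib[of "\<lambda>e. _ ^ e"] prod.delta cong: if_cong)
  then have "(\<lambda>x. x $ i) = monomial (\<lambda>l. if l = i then 1 else 0)"
    by (simp add: monomial_def fun_eq_iff)
  then show ?thesis by (simp add: monomial_Pol)
qed

lemma Pol_power: "f \<in> Pol j \<Longrightarrow> (\<lambda>x. f x ^ n) \<in> Pol (int n * j)"
proof (induction n)
  case (Suc n)
  then show ?case using Pol_mult[of f j "\<lambda>x. f x ^ n" "int n * j"] by (simp add: algebra_simps)
qed (simp add: Pol_const)

lemma Pol_prod:
  "finite I \<Longrightarrow> (\<And>i. i \<in> I \<Longrightarrow> f i \<in> Pol (j i)) \<Longrightarrow> (\<lambda>x. \<Prod>i\<in>I. f i x) \<in> Pol (\<Sum>i\<in>I. j i)"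
  by (induction rule: finite_induct) (simp_all add: Pol_const Pol_mult)

lemma linear_eq_sum_axis:
  fixes f :: "real ^ 'n \<Rightarrow> real"
  assumes "linear f" shows "f x = (\<Sum>i\<in>UNIV. f (axis i 1) * x $ i)"
proof -
  have "f x = f (\<Sum>i\<in>UNIV. x $ i *\<^sub>R axis i 1)"
    using basis_expansion[of x] by (simp add: scalar_mult_eq_scaleR)
  then show ?thesis by (simp add: linear_sum[OF assms] linear_scale[OF assms] mult.commute)
qed

lemma Pol_linear:
  fixes f :: "real ^ 'n \<Rightarrow> real"
  assumes "linear f" shows "f \<in> Pol 1"
proof -
  have "(\<lambda>x. \<Sum>i\<in>UNIV. f (axis i 1) * x $ i) \<in> Pol 1"
    by (intro Pol_sum Pol_scale Pol_component) simp
  moreover have "f = (\<lambda>x. \<Sum>i\<in>UNIV. f (axis i 1) * x $ i)"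
    by (rule ext) (rule linear_eq_sum_axis[OF assms])
  ultimately show ?thesis by simp
qed

lemma Pol_compose:
  assumes "f \<in> Pol j" "\<And>i. (\<lambda>x. \<Phi> x $ i) \<in> Pol 1"
  shows "(\<lambda>x. f (\<Phi> x)) \<in> Pol j"
  using assms(1)
proof (induction rule: Pol_induct)
  case (monomial \<alpha>)
  have "(\<lambda>x. \<Prod>i\<in>UNIV. (\<Phi> x $ i) ^ \<alpha> i) \<in> Pol (\<Sum>i\<in>UNIV. int (\<alpha> i) * 1)"
    by (intro Pol_prod Pol_power assms) simp
  then show ?case unfolding monomial_def by (rule Pol_mono) (use monomial in simp)
qed (simp_all add: Pol_zero Pol_add Pol_scale)

lemma Pol_rpoly: "f \<in> Pol j \<Longrightarrow> rpoly f"
proof (induction rule: Pol_induct)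
  case (monomial \<alpha>)
  have "rpoly (\<lambda>x::real^'a. x $ i)" for i
    by (intro rpoly_intros bounded_linear_vec_nth)
  then show ?case unfolding monomial_def[abs_def]
    by (intro real_polynomial_function_prod real_polynomial_function_power) simp_all
qed (simp_all add: rpoly_intros)

text \<open>Recovers a degree bound from the degree-free notion, so that induction over monomials is
  available for arbitrary polynomial functions.\<close>

lemma rpoly_Pol:
  fixes f :: "real ^ 'n \<Rightarrow> real"
  shows "rpoly f \<Longrightarrow> \<exists>j\<ge>0. f \<in> Pol j"
proof (induction rule: real_polynomial_function.induct)
  case (linear f)
  then show ?case by (intro exI[of _ 1]) (simp add: Pol_linear bounded_linear.linear)
next
  case (const c)
  show ?case by (intro exI[of _ 0]) (simp add: Pol_const)
next
  case (add f g)
  then obtain i j where ij: "i \<ge> 0" "j \<ge> 0" "f \<in> Pol i" "g \<in> Pol j" by blast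
  have "f \<in> Pol (max i j)" "g \<in> Pol (max i j)" using ij(3,4) by (auto elim: Pol_mono)
  then show ?case using ij by (intro exI[of _ "max i j"]) (simp add: Pol_add)
next
  case (mult f g)
  then obtain i j where ij: "i \<ge> 0" "j \<ge> 0" "f \<in> Pol i" "g \<in> Pol j" by blast
  then show ?case by (intro exI[of _ "i + j"]) (simp add: Pol_mult)
qed

lemma Pol_finite_dim: "\<exists>B. finite B \<and> Pol j \<subseteq> fun_vs.span B"
proof (intro exI conjI subsetI)
  let ?B = "monomial ` {\<alpha>. int (\<Sum>i\<in>UNIV. \<alpha> i) \<le> j}"
  show "finite ?B" by (intro finite_imageI finite_multi_indices)
  fix f assume "f \<in> Pol j"
  then show "f \<in> fun_vs.span ?B"
  proof (induction rule: Pol_induct)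
    case zero
    show ?case using fun_vs.span_zero unfolding zero_fun_def .
  next
    case (add f g)
    show ?case using fun_vs.span_add[OF add(3,4)] unfolding plus_fun_def .
  next
    case (scale c f)
    then show ?case by (intro fun_vs.span_scale)
  next
    case (monomial \<alpha>)
    then show ?case by (intro fun_vs.span_base imageI CollectI)
  qed
qed

text \<open>On the line through \<open>x0\<close> and \<open>x\<close> the function is a polynomial
  in one variable that vanishes on an interval, hence has infinitely many roots.\<close>

lemma polynomial_zero_if_zero_on_open:
  fixes f :: "'a::euclidean_space \<Rightarrow> real"
  assumes f: "rpoly f" and U: "open U" "x0 \<in> U" and z: "\<And>x. x \<in> U \<Longrightarrow> f x = 0"
  shows "f x = 0"
proof -
  let ?h = "\<lambda>t. f (x0 + t *\<^sub>R (x - x0))"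
  have "polynomial_function (\<lambda>t::real. x0 + t *\<^sub>R (x - x0))"
    by (intro polynomial_function_add polynomial_function_const polynomial_function_bounded_linear bounded_linear_scaleR_left)
  then have "rpoly ?h"
    using real_polynomial_function_compose[OF _ f] by (simp add: o_def)
  then obtain c n where h: "?h = (\<lambda>t. \<Sum>i\<le>n. c i * t ^ i)"
    using real_polynomial_function_imp_sum by blast
  have c: "?h t = (\<Sum>i\<le>n. c i * t ^ i)" for t using fun_cong[OF h] .
  obtain e where e: "e > 0" "ball x0 e \<subseteq> U" by (rule openE[OF U])
  \<comment> \<open>The summand 1 avoids a division by zero when \<open>x = x0\<close>.\<close>
  define m where "m = norm (x - x0) + 1"
  have m: "m > 0" "norm (x - x0) \<le> m" unfolding m_def using norm_ge_zero[of "x - x0"] by linarith+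
  define \<delta> where "\<delta> = e / m"
  have \<delta>: "\<delta> > 0" unfolding \<delta>_def using e(1) m(1) by simp
  have "?h t = 0" if t: "t \<in> {0<..<\<delta>}" for t
  proof -
    have t: "0 < t" "t < \<delta>" using t by simp_all
    have "t * norm (x - x0) \<le> t * m" using mult_left_mono[OF m(2)] t(1) by simp
    also have "\<dots> < \<delta> * m" using mult_strict_right_mono[OF t(2) m(1)] .
    also have "\<dots> = e" unfolding \<delta>_def using m(1) by simp
    finally have "dist x0 (x0 + t *\<^sub>R (x - x0)) < e" using t(1) by (simp add: dist_norm)
    then have "x0 + t *\<^sub>R (x - x0) \<in> U" using e(2) by (meson mem_ball subsetD)
    then show ?thesis by (rule z)
  qed
  then have sub: "{0<..<\<delta>} \<subseteq> {t. (\<Sum>i\<le>n. c i * t ^ i) = 0}" using c by auto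
  have "\<not> finite {t. (\<Sum>i\<le>n. c i * t ^ i) = 0}"
    using finite_subset[OF sub] infinite_Ioo[OF \<delta>] by blast
  then have "\<forall>i\<le>n. c i = 0" using polyfun_finite_roots[of c n] by blast
  then show ?thesis using c[of 1] by simp
qed

section \<open>Barycentric coordinates\<close>

lemma sum_option: "(\<Sum>i\<in>UNIV. f i) = f None + (\<Sum>i\<in>UNIV. f (Some i))" for f :: "'n::finite option \<Rightarrow> 'a::comm_monoid_add"
  by (simp add: UNIV_option_conv sum.reindex)

text \<open>The coordinates and their constant differentials \<open>dl\<close> are parameters rather
  than derived from the vertices: the reference simplex can then use explicit formulas and an
  element their pullbacks, without inverting an affine system.\<close>

locale barycentric =
  fixes a :: "'n option \<Rightarrow> real ^ 'n" and lam dl :: "'n option \<Rightarrow> real ^ 'n \<Rightarrow> real"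
  assumes dl_linear: "linear (dl i)"
    and lam_add: "lam i (x + d) = lam i x + dl i d"
    and lam_sum: "(\<Sum>i\<in>UNIV. lam i x) = 1"
    and lam_comb: "(\<Sum>i\<in>UNIV. lam i x *\<^sub>R a i) = x"
    and lam_vertex: "lam i (a j) = (if i = j then 1 else 0)"
begin

definition K where "K = {x. \<forall>i. 0 \<le> lam i x}"

definition I :: "(real ^ 'n \<Rightarrow> real) \<Rightarrow> real" where "I f = integral\<^sup>L (lebesgue_on K) f"

lemma lam_eq: "lam i x = lam i 0 + dl i x"
  using lam_add[of i 0 x] by simp

lemma lam_scaleR_add: "lam i (x + t *\<^sub>R d) = lam i x + t * dl i d"
  by (simp add: lam_add linear_scale[OF dl_linear])

text \<open>Along an edge only the coordinates of its two end points change. All integration by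
  parts below is done along edges for this reason.\<close>

lemma dl_diff: "dl k (a i - a j) = (if k = i then 1 else 0) - (if k = j then 1 else 0)"
  using lam_add[of k "a j" "a i - a j"] by (simp add: lam_vertex)

lemma dl_sum: "(\<Sum>i\<in>UNIV. dl i d) = 0"
  using lam_sum[of "0 + d"] lam_sum[of 0] unfolding lam_add by (simp add: sum.distrib)

lemma dl_comb: "(\<Sum>i\<in>UNIV. dl i d *\<^sub>R a i) = d"
  using lam_comb[of "0 + d"] lam_comb[of 0] unfolding lam_add by (simp add: sum.distrib scaleR_left_distrib)

lemma lam_polynomial: "rpoly (lam i)"
proof -
  have "rpoly (\<lambda>x. lam i 0 + dl i x)"
    by (intro rpoly_intros) (simp add: dl_linear linear_linear)
  then show ?thesis by (simp add: lam_eq[symmetric])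
qed

lemma lam_Pol: "lam i \<in> Pol 1"
proof -
  have "(\<lambda>x. lam i 0 + dl i x) \<in> Pol 1"
    by (intro Pol_add Pol_const Pol_linear dl_linear) simp
  then show ?thesis by (simp add: lam_eq[symmetric])
qed

lemma lam_differentiable: "lam i differentiable (at x)"
  by (rule rpoly_differentiable[OF lam_polynomial])

lemma lam_derivative: "frechet_derivative (lam i) (at x) = dl i"
proof -
  have "((\<lambda>x. lam i 0 + dl i x) has_derivative (\<lambda>d. 0 + dl i d)) (at x)"
    by (intro has_derivative_add has_derivative_const linear_imp_has_derivative dl_linear)
  then show ?thesis unfolding lam_eq[symmetric] by (simp add: frechet_derivative_at[symmetric])
qed

lemma continuous_on_lam: "continuous_on S (lam i)"
  by (rule continuous_on_rpoly[OF lam_polynomial])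

lemma K_closed: "closed K"
proof -
  have "K = (\<Inter>i. {x. 0 \<le> lam i x})" by (auto simp: K_def)
  then show ?thesis by (auto intro!: closed_INT closed_Collect_le continuous_on_lam continuous_on_const)
qed

lemma K_compact: "compact K"
proof -
  have "norm x \<le> (\<Sum>i\<in>UNIV. norm (a i))" if "x \<in> K" for x
  proof -
    have "norm x = norm (\<Sum>i\<in>UNIV. lam i x *\<^sub>R a i)" by (simp add: lam_comb)
    also have "\<dots> \<le> (\<Sum>i\<in>UNIV. norm (lam i x *\<^sub>R a i))" by (rule norm_sum)
    also have "\<dots> \<le> (\<Sum>i\<in>UNIV. norm (a i))"
    proof (rule sum_mono)
      fix i
      have "lam i x \<le> (\<Sum>i\<in>UNIV. lam i x)" using that by (intro member_le_sum) (auto simp: K_def)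
      then have "lam i x \<le> 1" by (simp add: lam_sum)
      then show "norm (lam i x *\<^sub>R a i) \<le> norm (a i)"
        using that by (simp add: K_def mult_left_le_one_le)
    qed
    finally show ?thesis .
  qed
  then have "bounded K" by (auto simp: bounded_iff)
  then show ?thesis using K_closed by (simp add: compact_eq_bounded_closed)
qed

lemma lam_segment:
  "lam i ((1 - t) *\<^sub>R x + t *\<^sub>R y) = (1 - t) * lam i x + t * lam i y"
proof -
  have eq: "(1 - t) *\<^sub>R x + t *\<^sub>R y = x + t *\<^sub>R (y - x)" by (simp add: algebra_simps)
  have dl: "dl i (y - x) = lam i y - lam i x" using lam_add[of i x "y - x"] by simp
  show ?thesis unfolding eq lam_scaleR_add dl by (simp add: algebra_simps)
qed

lemma K_convex: "convex K"
proof (rule convexI)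
  fix x y and u v :: real
  assume xy: "x \<in> K" "y \<in> K" and uv: "0 \<le> u" "0 \<le> v" "u + v = 1"
  have u: "u = 1 - v" using uv by simp
  show "u *\<^sub>R x + v *\<^sub>R y \<in> K"
    unfolding u K_def mem_Collect_eq lam_segment using xy uv(2) uv(1)[unfolded u] by (simp add: K_def)
qed

lemma vertex_in_K: "a i \<in> K"
  by (simp add: K_def lam_vertex)

lemma K_eq_hull: "K = convex hull (range a)"
proof
  show "convex hull (range a) \<subseteq> K"
    by (intro hull_minimal) (auto simp: vertex_in_K K_convex)
  show "K \<subseteq> convex hull (range a)"
  proof
    fix x assume "x \<in> K"
    then have "(\<Sum>i\<in>UNIV. lam i x *\<^sub>R a i) \<in> convex hull (range a)"
      by (intro convex_sum) (auto simp: lam_sum K_def hull_inc)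
    then show "x \<in> convex hull (range a)" by (simp add: lam_comb)
  qed
qed

section \<open>Interior and frontier of a simplex\<close>

definition K_int where "K_int = {x. \<forall>i. 0 < lam i x}"

lemma K_int_open: "open K_int"
proof -
  have "K_int = (\<Inter>i. {x. 0 < lam i x})" by (auto simp: K_int_def)
  then show ?thesis by (auto intro!: open_INT open_Collect_less continuous_on_lam continuous_on_const)
qed

lemma exists_other: "\<exists>j::'n option. j \<noteq> i"
  by (cases i) auto

lemma K_int_nonempty: "\<exists>x. x \<in> K_int"
proof -
  define N where "N = real (card (UNIV :: 'n option set))"
  have N: "N > 0" by (simp add: N_def card_gt_0_iff)
  \<comment> \<open>The witness \<open>a None + d\<close> is the barycentre; \<open>N\<close> counts
    the vertices here, so it is the dimension plus one.\<close>
  define d where "d = (\<Sum>j\<in>UNIV. (1 / N) *\<^sub>R (a j - a None))"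
  have "lam i (a None + d) = 1 / N" for i
  proof -
    have "(\<Sum>j\<in>UNIV. dl i (a j - a None)) = (\<Sum>j\<in>UNIV. if i = j then 1 else 0) - (\<Sum>j\<in>(UNIV::'n option set). if i = None then 1 else 0)"
      by (simp only: dl_diff sum_subtractf)
    also have "(\<Sum>j\<in>(UNIV::'n option set). if i = None then 1 else 0) = (if i = None then N else 0)"
      by (simp add: N_def)
    also have "(\<Sum>j\<in>UNIV. if i = j then 1 else 0) = (1::real)" by simp
    finally have "(\<Sum>j\<in>UNIV. dl i (a j - a None)) = 1 - (if i = None then N else 0)" .
    moreover have "lam i (a None + d) = (if i = None then 1 else 0) + (1 / N) * (\<Sum>j\<in>UNIV. dl i (a j - a None))"
      by (simp only: lam_add lam_vertex d_def linear_sum[OF dl_linear] linear_scale[OF dl_linear] sum_distrib_left real_scaleR_def)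
    ultimately show ?thesis using N by (cases "i = None") (simp_all add: field_simps)
  qed
  then show ?thesis using N unfolding K_int_def by (intro exI[of _ "a None + d"]) simp
qed

lemma K_int_subset: "K_int \<subseteq> K"
  by (auto simp: K_int_def K_def less_imp_le)

text \<open>From any point, a small step in direction \<open>a j - a i\<close> lowers coordinate
  \<open>i\<close> at unit rate. At an interior point this step stays in \<open>K\<close>, so
  coordinate \<open>i\<close> cannot have been zero.\<close>

lemma interior_K: "interior K = K_int"
proof
  show "K_int \<subseteq> interior K" using K_int_open K_int_subset by (rule interior_maximal[rotated])
  show "interior K \<subseteq> K_int"
  proof
    fix x assume x: "x \<in> interior K"
    then obtain e where e: "e > 0" "ball x e \<subseteq> K" by (auto simp: mem_interior)
    have "0 < lam i x" for i
    proof -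
      obtain j where j: "j \<noteq> i" using exists_other by blast
      define c where "c = a j - a i"
      define m where "m = norm c + 1"
      have m: "0 < m" "norm c \<le> m" unfolding m_def using norm_ge_zero[of c] by linarith+
      define t where "t = e / (2 * m)"
      have t: "t > 0" unfolding t_def using e(1) m(1) by simp
      have "t * norm c \<le> t * m" using mult_left_mono[OF m(2)] t by simp
      also have "\<dots> = e / 2" unfolding t_def using m(1) by simp
      also have "\<dots> < e" using e(1) by simp
      finally have "dist x (x + t *\<^sub>R c) < e" using t by (simp add: dist_norm)
      then have "x + t *\<^sub>R c \<in> K" using e(2) by (meson mem_ball subsetD)
      then have "0 \<le> lam i x + t * dl i c" unfolding lam_scaleR_add[symmetric] by (simp add: K_def)
      moreover have "dl i c = - 1" using j by (simp add: c_def dl_diff)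
      ultimately show ?thesis using t by simp
    qed
    then show "x \<in> K_int" by (simp add: K_int_def)
  qed
qed

lemma frontier_K: "x \<in> frontier K \<longleftrightarrow> x \<in> K \<and> (\<exists>i. lam i x = 0)"
proof -
  have "x \<in> frontier K \<longleftrightarrow> x \<in> K \<and> x \<notin> K_int"
    by (simp add: frontier_def interior_K K_closed)
  then show ?thesis by (auto simp: K_int_def K_def order_less_le)
qed

lemma negligible_frontier_K: "negligible (frontier K)"
  by (rule negligible_convex_frontier[OF K_convex])

section \<open>Integration of polynomials over a simplex\<close>

lemma K_lebesgue: "K \<in> sets lebesgue" and K_borel: "K \<in> sets borel"
  using compact_sets_lebesgue[OF K_compact] K_closed by auto

lemma polynomial_integrable:
  "rpoly f \<Longrightarrow> integrable (lebesgue_on K) f"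
  by (intro integrable_lebesgue_on_compact K_compact continuous_on_rpoly)

lemma polynomial_bounded:
  assumes "rpoly f" shows "\<exists>B\<ge>0. \<forall>x\<in>K. \<bar>f x\<bar> \<le> B"
proof -
  have "bounded (f ` K)"
    by (intro compact_imp_bounded compact_continuous_image K_compact continuous_on_rpoly assms)
  then obtain B where B: "\<And>x. x \<in> K \<Longrightarrow> \<bar>f x\<bar> \<le> B" by (auto simp: bounded_iff)
  have "0 \<le> B" using B[OF vertex_in_K[of None]] abs_ge_zero[of "f (a None)"] by linarith
  then show ?thesis using B by blast
qed

lemma I_add: "rpoly f \<Longrightarrow> rpoly g \<Longrightarrow> I (\<lambda>x. f x + g x) = I f + I g"
  unfolding I_def by (intro Bochner_Integration.integral_add polynomial_integrable)

lemma I_diff: "rpoly f \<Longrightarrow> rpoly g \<Longrightarrow> I (\<lambda>x. f x - g x) = I f - I g"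
  unfolding I_def by (intro Bochner_Integration.integral_diff polynomial_integrable)

lemma I_scale: "I (\<lambda>x. c * f x) = c * I f"
  unfolding I_def by simp

lemma I_sum: "(\<And>i. i \<in> A \<Longrightarrow> rpoly (f i)) \<Longrightarrow> I (\<lambda>x. \<Sum>i\<in>A. f i x) = (\<Sum>i\<in>A. I (f i))"
  unfolding I_def by (intro Bochner_Integration.integral_sum polynomial_integrable)

lemma I_nonneg: "(\<And>x. x \<in> K \<Longrightarrow> 0 \<le> f x) \<Longrightarrow> 0 \<le> I f"
  unfolding I_def by (intro integral_nonneg_AE AE_I2) simp

lemma I_mono:
  "rpoly f \<Longrightarrow> rpoly g \<Longrightarrow> (\<And>x. x \<in> K \<Longrightarrow> f x \<le> g x) \<Longrightarrow> I f \<le> I g"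
  unfolding I_def by (intro integral_mono polynomial_integrable) simp_all

text \<open>Almost everywhere zero on \<open>K\<close> means zero on the open interior by
  continuity, and then everywhere, also outside \<open>K\<close>, by the identity theorem for
  polynomials.\<close>

lemma I_eq_0_imp:
  assumes f: "rpoly f" and nn: "\<And>x. x \<in> K \<Longrightarrow> 0 \<le> f x" and z: "I f = 0"
  shows "f x = 0"
proof -
  have "AE x in lebesgue_on K. f x = 0"
    using integral_nonneg_eq_0_iff_AE[OF polynomial_integrable[OF f]] z AE_I2[of "lebesgue_on K" "\<lambda>x. 0 \<le> f x"] nn
    by (simp add: I_def)
  then have neg: "negligible {x \<in> K. f x \<noteq> 0}"
    unfolding negligible_iff_AE_lebesgue_on[OF K_lebesgue] .
  have "open (K_int \<inter> f -` (- {0}))"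
    using continuous_on_rpoly[OF f] K_int_open
    by (intro continuous_open_preimage) auto
  moreover have "negligible (K_int \<inter> f -` (- {0}))"
    by (rule negligible_subset[OF neg]) (use K_int_subset in auto)
  ultimately have "K_int \<inter> f -` (- {0}) = {}" using open_not_negligible by blast
  then have z: "f x = 0" if "x \<in> K_int" for x using that by auto
  obtain x0 where "x0 \<in> K_int" using K_int_nonempty by blast
  then show ?thesis using polynomial_zero_if_zero_on_open[OF f K_int_open _ z] by blast
qed

lemma I_one_pos: "0 < I (\<lambda>x. 1)"
proof -
  have "I (\<lambda>x. 1) \<noteq> 0" using I_eq_0_imp[of "\<lambda>x. 1"] by (auto simp: rpoly_intros)
  moreover have "0 \<le> I (\<lambda>x. 1)" by (rule I_nonneg) simp
  ultimately show ?thesis by simp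
qed

text \<open>Extending \<open>f\<close> by zero outside \<open>K\<close> gives a function that is Lipschitz along \<open>d\<close>, because \<open>f\<close>
  vanishes on the facets through which a line in direction \<open>d\<close> leaves \<open>K\<close>.\<close>

lemma integral_derivative_eq_0:
  assumes f: "rpoly f"
    and div: "\<And>l. dl l d \<noteq> 0 \<Longrightarrow> \<exists>s. rpoly s \<and> (\<forall>x. f x = lam l x * s x)"
  shows "I (\<lambda>x. frechet_derivative f (at x) d) = 0"
proof -
  let ?D = "\<lambda>x. frechet_derivative f (at x) d"
  have D: "rpoly ?D" by (rule rpoly_frechet_derivative[OF f])
  have diff: "f differentiable (at x)" for x by (rule rpoly_differentiable[OF f])
  obtain C0 where C0: "0 \<le> C0" "\<And>x. x \<in> K \<Longrightarrow> \<bar>?D x\<bar> \<le> C0" using polynomial_bounded[OF D] by blast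
  \<comment> \<open>At a point from which a step of length \<open>t\<close> along \<open>d\<close>
    can cross facet \<open>l\<close>, the coordinate \<open>lam l\<close> is at most
    \<open>t * |dl l d|\<close>; the factor \<open>lam l\<close> of \<open>f\<close> therefore makes
    \<open>f\<close> of order \<open>t\<close> there.\<close>
  have "\<exists>C\<ge>0. dl l d \<noteq> 0 \<longrightarrow> (\<forall>x\<in>K. \<forall>t>0. lam l x \<le> t * \<bar>dl l d\<bar> \<longrightarrow> \<bar>f x\<bar> \<le> C * t)" for l
  proof (cases "dl l d = 0")
    case True
    then show ?thesis by (intro exI[of _ 0]) simp
  next
    case False
    obtain s where s: "rpoly s" "\<And>x. f x = lam l x * s x" using div[OF False] by blast
    obtain B where B: "0 \<le> B" "\<And>x. x \<in> K \<Longrightarrow> \<bar>s x\<bar> \<le> B" using polynomial_bounded[OF s(1)] by blast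
    have "\<bar>f x\<bar> \<le> \<bar>dl l d\<bar> * B * t" if x: "x \<in> K" and t: "0 < t" and le: "lam l x \<le> t * \<bar>dl l d\<bar>" for x t
    proof -
      have l0: "0 \<le> lam l x" using x by (simp add: K_def)
      have "\<bar>f x\<bar> = lam l x * \<bar>s x\<bar>" using l0 by (simp add: s(2) abs_mult)
      also have "\<dots> \<le> (t * \<bar>dl l d\<bar>) * B" using le B(2)[OF x] l0 by (intro mult_mono) auto
      finally show ?thesis by (simp add: mult_ac)
    qed
    then show ?thesis using B(1) by (intro exI[of _ "\<bar>dl l d\<bar> * B"]) simp
  qed
  then obtain Cl where Cl: "\<And>l. 0 \<le> Cl l"
    "\<And>l x t. dl l d \<noteq> 0 \<Longrightarrow> x \<in> K \<Longrightarrow> 0 < t \<Longrightarrow> lam l x \<le> t * \<bar>dl l d\<bar> \<Longrightarrow> \<bar>f x\<bar> \<le> Cl l * t"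
    by metis
  define C where "C = C0 + (\<Sum>l\<in>UNIV. Cl l)"
  have ClC: "Cl l \<le> C" for l
  proof -
    have "Cl l \<le> (\<Sum>l\<in>UNIV. Cl l)" by (intro member_le_sum Cl(1)) auto
    then show ?thesis using C0(1) by (simp add: C_def)
  qed
  have C0C: "C0 \<le> C" unfolding C_def using sum_nonneg[of UNIV Cl] Cl(1) by simp
  define F where "F x = indicator K x * f x" for x
  have cont: "continuous_on UNIV f" "continuous_on UNIV ?D"
    using f D by (simp_all add: continuous_on_rpoly)
  have Kint: "integrable lborel (\<lambda>x. indicator K x * h x)" if "continuous_on UNIV h" for h :: "real ^ 'n \<Rightarrow> real"
    using borel_integrable_compact[OF K_compact continuous_on_subset[OF that subset_UNIV]] by simp
  \<comment> \<open>\<open>\<sigma> = 1\<close> treats a step that leaves \<open>K\<close>;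
    \<open>\<sigma> = -1\<close> treats a step that enters it, read backwards from its end
    point.\<close>
  have exit: "\<bar>f x\<bar> \<le> C * t"
    if x: "x \<in> K" and t: "0 < t" and y: "x + \<sigma> *\<^sub>R t *\<^sub>R d \<notin> K" and \<sigma>: "\<bar>\<sigma>\<bar> = 1" for x t \<sigma>
  proof -
    obtain l where l: "lam l (x + (\<sigma> * t) *\<^sub>R d) < 0" using y by (auto simp: K_def not_le)
    have "(\<sigma> * t) * dl l d \<ge> - (t * \<bar>dl l d\<bar>)"
      using \<sigma> t abs_le_D2[of "\<sigma> * t * dl l d" "t * \<bar>dl l d\<bar>"] by (simp add: abs_mult)
    then have le: "lam l x \<le> t * \<bar>dl l d\<bar>" using l by (simp add: lam_scaleR_add)
    have "dl l d \<noteq> 0" using l x by (auto simp: lam_scaleR_add K_def not_le[symmetric])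
    then have "\<bar>f x\<bar> \<le> Cl l * t" using Cl(2) x t le by blast
    also have "\<dots> \<le> C * t" using ClC t by (intro mult_right_mono) auto
    finally show ?thesis .
  qed
  obtain R where R: "\<And>x. x \<in> K \<Longrightarrow> norm x \<le> R"
    using compact_imp_bounded[OF K_compact] unfolding bounded_iff by blast
  have "integral\<^sup>L lborel (\<lambda>x. indicator K x * ?D x) = 0"
  proof (rule integral_directional_derivative_eq_0[of F _ _ d])
    have mb: "f \<in> borel_measurable borel" "?D \<in> borel_measurable borel"
      using cont by (auto intro: borel_measurable_continuous_onI)
    show "F \<in> borel_measurable borel" unfolding F_def[abs_def]
      by (intro borel_measurable_times borel_measurable_indicator K_borel mb)
    show "(\<lambda>x. indicator K x * ?D x) \<in> borel_measurable borel"
      by (intro borel_measurable_times borel_measurable_indicator K_borel mb)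
    show "integrable lborel F" unfolding F_def[abs_def] by (rule Kint[OF cont(1)])
    show "norm x \<le> R" if "F x \<noteq> 0" for x
      using that R by (cases "x \<in> K") (auto simp: F_def)
    show "\<bar>F (x + t *\<^sub>R d) - F x\<bar> \<le> C * t" if t: "0 < t" "t \<le> 1" for x t
    proof -
      let ?y = "x + t *\<^sub>R d"
      have C: "0 \<le> C * t" using C0(1) C0C t by simp
      consider "x \<in> K" "?y \<in> K" | "x \<in> K" "?y \<notin> K" | "x \<notin> K" "?y \<in> K" | "x \<notin> K" "?y \<notin> K" by blast
      then show ?thesis
      proof cases
        case 1
        obtain z where z: "0 < z" "z < t" "f ?y - f x = t * ?D (x + z *\<^sub>R d)"
          using directional_mvt[OF diff t(1)] by blast
        have "x + z *\<^sub>R d = (1 - z / t) *\<^sub>R x + (z / t) *\<^sub>R ?y"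
          using t by (simp add: algebra_simps)
        also have "\<dots> \<in> K" using z t by (intro convexD[OF K_convex] 1) auto
        finally have "\<bar>?D (x + z *\<^sub>R d)\<bar> \<le> C" using C0(2) C0C by force
        then have "\<bar>f ?y - f x\<bar> \<le> t * C" unfolding z(3) using t by (simp add: abs_mult)
        then show ?thesis using 1 by (simp add: F_def mult.commute)
      next
        case 2
        then show ?thesis using exit[OF 2(1) t(1), of 1] by (simp add: F_def)
      next
        case 3
        have "\<bar>f ?y\<bar> \<le> C * t" using exit[OF 3(2) t(1), of "-1"] 3(1) by simp
        then show ?thesis using 3 by (simp add: F_def)
      next
        case 4
        then show ?thesis using C by (simp add: F_def)
      qed
    qed
    \<comment> \<open>The extension by zero need not be differentiable on the frontier. The frontier
      of a convex set is null, which is why convergence of the quotients was asked for almost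
      everywhere only.\<close>
    have "AE x in lebesgue. x \<notin> frontier K"
      using negligible_frontier_K unfolding eventually_ae_filter_negligible by auto
    then have "AE x in lborel. x \<notin> frontier K" by (simp add: AE_completion_iff)
    then show "AE x in lborel. (\<lambda>n. real (Suc n) * (F (x + (1 / real (Suc n)) *\<^sub>R d) - F x))
        \<longlonglongrightarrow> indicator K x * ?D x"
    proof (rule eventually_mono)
      fix x assume x: "x \<notin> frontier K"
      show "(\<lambda>n. real (Suc n) * (F (x + (1 / real (Suc n)) *\<^sub>R d) - F x)) \<longlonglongrightarrow> indicator K x * ?D x"
      proof (cases "x \<in> K")
        case True
        then have xi: "x \<in> K_int" using x by (simp add: frontier_def K_closed interior_K)
        have "(F has_derivative frechet_derivative f (at x)) (at x)"
        proof (rule has_derivative_transform_within_open[OF has_derivative_frechet[OF diff] K_int_open xi])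
          fix y assume "y \<in> K_int"
          then show "f y = F y" using K_int_subset by (auto simp: F_def)
        qed
        from difference_quotient_tendsto[OF this] show ?thesis using True by simp
      next
        case False
        have "(F has_derivative (\<lambda>d. 0)) (at x)"
        proof (rule has_derivative_transform_within_open[OF has_derivative_const])
          show "open (- K)" using K_closed by (simp add: open_Compl)
          show "x \<in> - K" using False by simp
          show "0 = F y" if "y \<in> - K" for y using that by (simp add: F_def)
        qed
        from difference_quotient_tendsto[OF this] show ?thesis using False by simp
      qed
    qed
  qed
  moreover have "I ?D = integral\<^sup>L lborel (\<lambda>x. indicator K x * ?D x)"
    unfolding I_def using cont by (intro integral_lebesgue_on_eq_lborel K_borel) (auto intro: borel_measurable_continuous_onI)
  ultimately show ?thesis by simp
qed

end

section \<open>Facet forms\<close>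

lemma linear_frechet_rpoly:
  "rpoly f \<Longrightarrow> linear (frechet_derivative f (at x))"
  by (intro linear_frechet_derivative rpoly_differentiable)

context barycentric
begin

text \<open>The algebraic form of vanishing on all facets but the one opposite to
  \<open>a i\<close>. An explicit polynomial cofactor is demanded because
  \<open>integral_derivative_eq_0\<close> bounds it on \<open>K\<close>.\<close>

definition div_except :: "'n option \<Rightarrow> (real ^ 'n \<Rightarrow> real) \<Rightarrow> bool" where
  "div_except i f \<longleftrightarrow> rpoly f \<and>
     (\<forall>l. l \<noteq> i \<longrightarrow> (\<exists>s. rpoly s \<and> (\<forall>x. f x = lam l x * s x)))"

text \<open>An edge direction is transversal only to the two facets opposite to its end points, so
  divisibility by two coordinates is enough.\<close>

lemma edge_integral:
  assumes f: "rpoly f"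
    and i: "\<exists>s. rpoly s \<and> (\<forall>x. f x = lam i x * s x)"
    and j: "\<exists>s. rpoly s \<and> (\<forall>x. f x = lam j x * s x)"
  shows "I (\<lambda>x. frechet_derivative f (at x) (a j - a i)) = 0"
proof (rule integral_derivative_eq_0[OF f])
  fix l assume "dl l (a j - a i) \<noteq> 0"
  then have "l = i \<or> l = j" by (auto simp: dl_diff split: if_splits)
  then show "\<exists>s. rpoly s \<and> (\<forall>x. f x = lam l x * s x)" using i j by blast
qed

text \<open>The two directions differ by \<open>a j - a l\<close>, and \<open>f\<close> is divisible
  by both coordinates that vary along that edge.\<close>

lemma edge_derivative_independent:
  assumes f: "div_except i f" and "j \<noteq> i" "l \<noteq> i"
  shows "I (\<lambda>x. frechet_derivative f (at x) (a j - a i)) = I (\<lambda>x. frechet_derivative f (at x) (a l - a i))"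
proof -
  have pf: "rpoly f" using f by (simp add: div_except_def)
  have "frechet_derivative f (at x) (a j - a i)
      = frechet_derivative f (at x) (a l - a i) + frechet_derivative f (at x) (a j - a l)" for x
    using linear_add[OF linear_frechet_rpoly[OF pf], of x "a l - a i" "a j - a l"] by simp
  then have "I (\<lambda>x. frechet_derivative f (at x) (a j - a i))
      = I (\<lambda>x. frechet_derivative f (at x) (a l - a i)) + I (\<lambda>x. frechet_derivative f (at x) (a j - a l))"
    by (simp add: I_add rpoly_frechet_derivative[OF pf])
  moreover have "I (\<lambda>x. frechet_derivative f (at x) (a j - a l)) = 0"
    using f assms(2,3) by (intro edge_integral) (simp_all add: div_except_def)
  ultimately show ?thesis by simp
qed

text \<open>Up to a factor depending on \<open>i\<close> only, \<open>facet_functional i\<close> is the integral over the facet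
  opposite to \<open>a i\<close>: it is the divergence of the field \<open>f (x - a i)\<close>, which is tangential to the
  other facets.\<close>

definition facet_functional :: "'n option \<Rightarrow> (real ^ 'n \<Rightarrow> real) \<Rightarrow> real" where
  "facet_functional i f = I (\<lambda>x. real CARD('n) * f x + frechet_derivative f (at x) (x - a i))"

lemma sum_lam_edges: "(\<Sum>l\<in>UNIV. lam l x *\<^sub>R (a l - a i)) = x - a i"
proof -
  have "(\<Sum>l\<in>UNIV. lam l x *\<^sub>R (a l - a i)) = (\<Sum>l\<in>UNIV. lam l x *\<^sub>R a l) - (\<Sum>l\<in>UNIV. lam l x) *\<^sub>R a i"
    by (simp add: scaleR_diff_right sum_subtractf scaleR_left.sum)
  then show ?thesis by (simp add: lam_comb lam_sum)
qed

lemma sum_dl_edges: "(\<Sum>l\<in>UNIV. dl l d *\<^sub>R (a l - a i)) = d"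
proof -
  have "(\<Sum>l\<in>UNIV. dl l d *\<^sub>R (a l - a i)) = (\<Sum>l\<in>UNIV. dl l d *\<^sub>R a l) - (\<Sum>l\<in>UNIV. dl l d) *\<^sub>R a i"
    by (simp add: scaleR_diff_right sum_subtractf scaleR_left.sum)
  then show ?thesis by (simp add: dl_comb dl_sum)
qed

text \<open>The direction \<open>x - a i\<close> moves with \<open>x\<close>, so it is not obvious
  that the radial derivative is a polynomial. Expanding it along the edges with coefficients
  \<open>lam l\<close> makes this visible.\<close>

lemma radial_derivative_sum:
  assumes "rpoly f"
  shows "frechet_derivative f (at x) (x - a i) = (\<Sum>l\<in>UNIV. lam l x * frechet_derivative f (at x) (a l - a i))"
proof -
  note lin = linear_frechet_rpoly[OF assms, of x]
  have "frechet_derivative f (at x) (x - a i) = frechet_derivative f (at x) (\<Sum>l\<in>UNIV. lam l x *\<^sub>R (a l - a i))"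
    by (simp only: sum_lam_edges)
  then show ?thesis by (simp add: linear_sum[OF lin] linear_scale[OF lin])
qed

lemma radial_polynomial:
  assumes "rpoly f"
  shows "rpoly (\<lambda>x. frechet_derivative f (at x) (x - a i))"
  unfolding radial_derivative_sum[OF assms]
  by (intro real_polynomial_function_sum rpoly_intros lam_polynomial
      rpoly_frechet_derivative assms) simp

text \<open>Split \<open>f\<close> by the partition of unity \<open>lam l\<close>. The part with
  \<open>lam i\<close> vanishes on all facets and drops out; in the part with
  \<open>l \<noteq> i\<close> the edge direction may be replaced by \<open>a l - a i\<close>. Since
  \<open>dl l (a l - a i) = 1\<close>, the product rule yields one copy of \<open>f\<close> for each
  of the N indices, and the edges weighted by \<open>lam l\<close> add up to
  \<open>x - a i\<close>.\<close>

lemma edge_derivative_facet_functional: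
  assumes f: "div_except i f" and j: "j \<noteq> i"
  shows "I (\<lambda>x. frechet_derivative f (at x) (a j - a i)) = facet_functional i f"
proof -
  have pf: "rpoly f" using f by (simp add: div_except_def)
  note diff = rpoly_differentiable[OF pf]
  define g where "g l x = f x * lam l x" for l x
  have pg: "rpoly (g l)" for l
    unfolding g_def[abs_def] by (intro rpoly_intros pf lam_polynomial)
  have Dg: "frechet_derivative (g l) (at x) d = f x * dl l d + frechet_derivative f (at x) d * lam l x" for l x d
    unfolding g_def[abs_def] by (simp add: frechet_derivative_mult diff lam_differentiable lam_derivative)
  have "frechet_derivative f (at x) d = (\<Sum>l\<in>UNIV. frechet_derivative (g l) (at x) d)" for x d
    by (simp add: Dg sum.distrib sum_distrib_left[symmetric] dl_sum lam_sum)
  then have "I (\<lambda>x. frechet_derivative f (at x) (a j - a i)) = (\<Sum>l\<in>UNIV. I (\<lambda>x. frechet_derivative (g l) (at x) (a j - a i)))"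
    by (simp add: I_sum rpoly_frechet_derivative pg)
  also have "\<dots> = I (\<lambda>x. frechet_derivative (g i) (at x) (a j - a i)) + (\<Sum>l\<in>UNIV - {i}. I (\<lambda>x. frechet_derivative (g l) (at x) (a j - a i)))"
    by (intro sum.remove) simp_all
  also have "I (\<lambda>x. frechet_derivative (g i) (at x) (a j - a i)) = 0"
  proof (rule edge_integral[OF pg])
    show "\<exists>s. rpoly s \<and> (\<forall>x. g i x = lam i x * s x)"
      using pf by (intro exI[of _ f]) (simp add: g_def)
    obtain s where s: "rpoly s" "\<And>x. f x = lam j x * s x"
      using f j unfolding div_except_def by blast
    show "\<exists>s. rpoly s \<and> (\<forall>x. g i x = lam j x * s x)"
      by (intro exI[of _ "\<lambda>x. s x * lam i x"] conjI rpoly_intros s(1) lam_polynomial)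
        (simp add: g_def s(2))
  qed
  also have "(\<Sum>l\<in>UNIV - {i}. I (\<lambda>x. frechet_derivative (g l) (at x) (a j - a i)))
      = (\<Sum>l\<in>UNIV - {i}. I (\<lambda>x. frechet_derivative (g l) (at x) (a l - a i)))"
  proof (rule sum.cong[OF refl])
    fix l assume l: "l \<in> UNIV - {i}"
    have "div_except i (g l)" unfolding div_except_def
    proof (intro conjI allI impI pg)
      fix m assume "m \<noteq> i"
      then obtain s where s: "rpoly s" "\<And>x. f x = lam m x * s x"
        using f unfolding div_except_def by blast
      show "\<exists>s. rpoly s \<and> (\<forall>x. g l x = lam m x * s x)"
        by (intro exI[of _ "\<lambda>x. s x * lam l x"] conjI rpoly_intros s(1) lam_polynomial)
          (simp add: g_def s(2))
    qed
    then show "I (\<lambda>x. frechet_derivative (g l) (at x) (a j - a i)) = I (\<lambda>x. frechet_derivative (g l) (at x) (a l - a i))"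
      using j l by (intro edge_derivative_independent) auto
  qed
  also have "\<dots> = I (\<lambda>x. \<Sum>l\<in>UNIV - {i}. frechet_derivative (g l) (at x) (a l - a i))"
    by (intro I_sum[symmetric] rpoly_frechet_derivative pg)
  also have "(\<lambda>x. \<Sum>l\<in>UNIV - {i}. frechet_derivative (g l) (at x) (a l - a i))
      = (\<lambda>x. real CARD('n) * f x + frechet_derivative f (at x) (x - a i))"
  proof
    fix x
    have "(\<Sum>l\<in>UNIV - {i}. frechet_derivative (g l) (at x) (a l - a i))
        = (\<Sum>l\<in>UNIV - {i}. f x) + (\<Sum>l\<in>UNIV - {i}. frechet_derivative f (at x) (a l - a i) * lam l x)"
      unfolding Dg sum.distrib[symmetric] by (intro sum.cong refl) (simp add: dl_diff)
    also have "(\<Sum>l\<in>UNIV - {i}. f x) = real CARD('n) * f x" by (simp add: card_Diff_subset)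
    also have "(\<Sum>l\<in>UNIV - {i}. frechet_derivative f (at x) (a l - a i) * lam l x)
        = frechet_derivative f (at x) (x - a i)"
      using linear_0[OF linear_frechet_rpoly[OF pf]]
      by (subst radial_derivative_sum[OF pf], subst sum.remove[of UNIV i]) (simp_all add: mult.commute)
    finally show "(\<Sum>l\<in>UNIV - {i}. frechet_derivative (g l) (at x) (a l - a i))
      = real CARD('n) * f x + frechet_derivative f (at x) (x - a i)" .
  qed
  finally show ?thesis by (simp add: facet_functional_def)
qed

text \<open>The divergence theorem for the constant field \<open>d\<close>: expand \<open>d\<close>
  along the edges at \<open>a i\<close>, on which all edge integrals agree, and use that the
  remaining differentials sum to \<open>- dl i d\<close>. This factor has the sign of the outward
  flux, the outward normal being a negative multiple of the gradient of
  \<open>lam i\<close>.\<close>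

lemma integral_derivative_facet_functional:
  assumes f: "div_except i f"
  shows "I (\<lambda>x. frechet_derivative f (at x) d) = - dl i d * facet_functional i f"
proof -
  have pf: "rpoly f" using f by (simp add: div_except_def)
  have "frechet_derivative f (at x) d = (\<Sum>l\<in>UNIV. dl l d * frechet_derivative f (at x) (a l - a i))" for x
  proof -
    note lin = linear_frechet_rpoly[OF pf, of x]
    have "frechet_derivative f (at x) d = frechet_derivative f (at x) (\<Sum>l\<in>UNIV. dl l d *\<^sub>R (a l - a i))"
      by (simp only: sum_dl_edges)
    then show ?thesis by (simp add: linear_sum[OF lin] linear_scale[OF lin])
  qed
  then have "I (\<lambda>x. frechet_derivative f (at x) d) = (\<Sum>l\<in>UNIV. dl l d * I (\<lambda>x. frechet_derivative f (at x) (a l - a i)))"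
    by (simp add: I_sum I_scale rpoly_frechet_derivative[OF pf] rpoly_intros)
  also have "\<dots> = (\<Sum>l\<in>UNIV - {i}. dl l d * I (\<lambda>x. frechet_derivative f (at x) (a l - a i)))"
    using linear_0[OF linear_frechet_rpoly[OF pf]] by (subst sum.remove[of UNIV i]) (simp_all add: I_def)
  also have "\<dots> = (\<Sum>l\<in>UNIV - {i}. dl l d * facet_functional i f)"
    by (intro sum.cong refl) (simp add: edge_derivative_facet_functional[OF f])
  also have "\<dots> = (\<Sum>l\<in>UNIV - {i}. dl l d) * facet_functional i f" by (rule sum_distrib_right[symmetric])
  also have "(\<Sum>l\<in>UNIV - {i}. dl l d) = - dl i d"
    using dl_sum[of d] sum.remove[of UNIV i "\<lambda>l. dl l d"] by simp
  finally show ?thesis .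
qed

lemma facet_functional_add:
  assumes "rpoly f" "rpoly g"
  shows "facet_functional i (\<lambda>x. f x + g x) = facet_functional i f + facet_functional i g"
proof -
  have "facet_functional i (\<lambda>x. f x + g x)
      = I (\<lambda>x. (real CARD('n) * f x + frechet_derivative f (at x) (x - a i)) + (real CARD('n) * g x + frechet_derivative g (at x) (x - a i)))"
    unfolding facet_functional_def using assms
    by (simp add: frechet_derivative_add rpoly_differentiable algebra_simps)
  also have "\<dots> = facet_functional i f + facet_functional i g"
    unfolding facet_functional_def
    by (intro I_add rpoly_intros radial_polynomial assms)
  finally show ?thesis .
qed

lemma facet_functional_scale:
  assumes "rpoly f"
  shows "facet_functional i (\<lambda>x. c * f x) = c * facet_functional i f"
proof -
  have "frechet_derivative (\<lambda>x. c * f x) (at x) d = c * frechet_derivative f (at x) d" for x d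
    using frechet_derivative_mult[of "\<lambda>_. c" x f d] assms
    by (simp add: rpoly_differentiable)
  then show ?thesis
    unfolding facet_functional_def I_scale[symmetric] by (simp add: algebra_simps)
qed

section \<open>Bubbles and the facet forms weighted by them\<close>

definition bub :: "real ^ 'n \<Rightarrow> real" where "bub x = (\<Prod>j\<in>UNIV. lam j x)"

definition fbub :: "'n option \<Rightarrow> real ^ 'n \<Rightarrow> real" where "fbub i x = (\<Prod>j\<in>UNIV - {i}. lam j x)"

lemma fbub_polynomial: "rpoly (fbub i)"
  unfolding fbub_def[abs_def] by (intro real_polynomial_function_prod lam_polynomial) simp

lemma bub_polynomial: "rpoly bub"
  unfolding bub_def[abs_def] by (intro real_polynomial_function_prod lam_polynomial) simp

lemma bub_eq: "bub x = lam i x * fbub i x"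
  unfolding bub_def fbub_def by (intro prod.remove) simp_all

lemma fbub_divides: "l \<noteq> i \<Longrightarrow> \<exists>s. rpoly s \<and> (\<forall>x. fbub i x = lam l x * s x)"
proof (intro exI conjI allI)
  assume "l \<noteq> i"
  then show "fbub i x = lam l x * (\<Prod>j\<in>UNIV - {i} - {l}. lam j x)" for x
    unfolding fbub_def by (intro prod.remove) simp_all
  show "rpoly (\<lambda>x. \<Prod>j\<in>UNIV - {i} - {l}. lam j x)"
    by (intro real_polynomial_function_prod lam_polynomial) simp
qed

lemma div_except_fbub:
  assumes "rpoly p" shows "div_except i (\<lambda>x. fbub i x * p x)"
  unfolding div_except_def
proof (intro conjI allI impI)
  show "rpoly (\<lambda>x. fbub i x * p x)"
    by (intro rpoly_intros fbub_polynomial assms)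
  fix l assume "l \<noteq> i"
  then obtain s where s: "rpoly s" "\<And>x. fbub i x = lam l x * s x" using fbub_divides by blast
  show "\<exists>s. rpoly s \<and> (\<forall>x. fbub i x * p x = lam l x * s x)"
    by (intro exI[of _ "\<lambda>x. s x * p x"] conjI rpoly_intros s(1) assms) (simp add: s(2))
qed

lemma integral_derivative_bub:
  assumes "rpoly p"
  shows "I (\<lambda>x. frechet_derivative (\<lambda>x. bub x * p x) (at x) d) = 0"
proof (rule integral_derivative_eq_0)
  show "rpoly (\<lambda>x. bub x * p x)"
    by (intro rpoly_intros bub_polynomial assms)
  show "\<exists>s. rpoly s \<and> (\<forall>x. bub x * p x = lam l x * s x)" for l
    by (intro exI[of _ "\<lambda>x. fbub l x * p x"] conjI rpoly_intros fbub_polynomial assms)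
      (simp add: bub_eq[of _ l])
qed

text \<open>The algebraic trace property: a function divisible by \<open>lam i\<close> as well
  vanishes on the remaining facet, so the functional does not see it.\<close>

lemma facet_functional_bub:
  assumes "rpoly p"
  shows "facet_functional i (\<lambda>x. bub x * p x) = 0"
proof -
  have "div_except i (\<lambda>x. fbub i x * (lam i x * p x))"
    by (intro div_except_fbub rpoly_intros lam_polynomial assms)
  then have d: "div_except i (\<lambda>x. bub x * p x)" by (simp add: bub_eq[of _ i] mult_ac)
  obtain j where "j \<noteq> i" using exists_other by blast
  from edge_derivative_facet_functional[OF d this] show ?thesis
    using integral_derivative_bub[OF assms, of "a j - a i"] by simp
qed

text \<open>The weight \<open>fbub i\<close> vanishes on every other facet, which makes the
  integrand satisfy \<open>div_except i\<close> for arbitrary polynomials \<open>f\<close> and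
  \<open>g\<close>.\<close>

definition facet_form :: "'n option \<Rightarrow> (real ^ 'n \<Rightarrow> real) \<Rightarrow> (real ^ 'n \<Rightarrow> real) \<Rightarrow> real" where
  "facet_form i f g = facet_functional i (\<lambda>x. fbub i x * (f x * g x))"

lemma facet_form_sym: "facet_form i f g = facet_form i g f"
  unfolding facet_form_def by (simp add: mult.commute)

lemma facet_form_add:
  assumes "rpoly f" "rpoly g" "rpoly h"
  shows "facet_form i h (\<lambda>x. f x + g x) = facet_form i h f + facet_form i h g"
proof -
  have "rpoly (\<lambda>x. fbub i x * (h x * f x))" "rpoly (\<lambda>x. fbub i x * (h x * g x))"
    by (intro rpoly_intros fbub_polynomial assms)+
  from facet_functional_add[OF this, of i] show ?thesis
    unfolding facet_form_def by (simp only: distrib_left)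
qed

lemma facet_form_scale:
  assumes "rpoly f" "rpoly h"
  shows "facet_form i h (\<lambda>x. c * f x) = c * facet_form i h f"
proof -
  have "rpoly (\<lambda>x. fbub i x * (h x * f x))"
    by (intro rpoly_intros fbub_polynomial assms)+
  from facet_functional_scale[OF this, of i c] show ?thesis
    unfolding facet_form_def by (simp only: mult.left_commute)
qed

text \<open>The extra term brings a factor \<open>lam i\<close>, which completes
  \<open>fbub i\<close> to \<open>bub\<close>. Hence an argument may be replaced by any polynomial
  with the same values on the hyperplane of the facet, up to an explicit cofactor.\<close>

lemma facet_form_cong:
  assumes "rpoly g" "rpoly s" "rpoly h"
    and f: "\<And>x. f x = g x + lam i x * s x"
  shows "facet_form i h f = facet_form i h g"
proof -
  have p: "rpoly (\<lambda>x. lam i x * s x)"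
    by (intro rpoly_intros lam_polynomial assms)
  have "facet_form i h f = facet_form i h (\<lambda>x. g x + lam i x * s x)"
    using f by presburger
  also have "\<dots> = facet_form i h g + facet_form i h (\<lambda>x. lam i x * s x)"
    by (rule facet_form_add[OF assms(1) p assms(3)])
  also have "facet_form i h (\<lambda>x. lam i x * s x) = facet_functional i (\<lambda>x. bub x * (h x * s x))"
    unfolding facet_form_def by (simp add: bub_eq[of _ i] mult_ac)
  also have "\<dots> = 0"
    by (intro facet_functional_bub rpoly_intros assms)
  finally show ?thesis by simp
qed

text \<open>Euler's identity serves as the definition of homogeneity about \<open>a i\<close>. The
  facet functional contains exactly this radial derivative, so on homogeneous functions it is a
  positive multiple of the volume integral.\<close>

definition homog :: "'n option \<Rightarrow> nat \<Rightarrow> (real ^ 'n \<Rightarrow> real) \<Rightarrow> bool" where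
  "homog i m f \<longleftrightarrow> rpoly f \<and> (\<forall>x. frechet_derivative f (at x) (x - a i) = real m * f x)"

lemma homog_polynomial: "homog i m f \<Longrightarrow> rpoly f"
  by (simp add: homog_def)

lemma homog_mult: "homog i m f \<Longrightarrow> homog i n g \<Longrightarrow> homog i (m + n) (\<lambda>x. f x * g x)"
  unfolding homog_def
  by (auto simp: frechet_derivative_mult rpoly_differentiable algebra_simps
      intro: rpoly_intros)

lemma homog_one: "homog i 0 (\<lambda>x. 1)"
  unfolding homog_def by (simp add: rpoly_intros frechet_derivative_const)

lemma homog_prod:
  "finite A \<Longrightarrow> (\<And>l. l \<in> A \<Longrightarrow> homog i (m l) (f l)) \<Longrightarrow> homog i (\<Sum>l\<in>A. m l) (\<lambda>x. \<Prod>l\<in>A. f l x)"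
  by (induction rule: finite_induct) (simp_all add: homog_one homog_mult)

lemma homog_add: "homog i m f \<Longrightarrow> homog i m g \<Longrightarrow> homog i m (\<lambda>x. f x + g x)"
  unfolding homog_def
  by (auto simp: frechet_derivative_add rpoly_differentiable algebra_simps
      intro: rpoly_intros)

lemma homog_scale: "homog i m f \<Longrightarrow> homog i m (\<lambda>x. c * f x)"
  using homog_mult[of i 0 "\<lambda>_. c" m f]
  by (simp add: homog_def rpoly_intros frechet_derivative_const)

lemma dl_radial: "dl l (x - a i) = lam l x - (if l = i then 1 else 0)"
  using lam_add[of l "a i" "x - a i"] by (simp add: lam_vertex)

lemma homog_lam: "l \<noteq> i \<Longrightarrow> homog i 1 (lam l)"
  unfolding homog_def by (simp add: lam_polynomial lam_derivative dl_radial)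

lemma homog_fbub: "homog i CARD('n) (fbub i)"
proof -
  have "homog i (\<Sum>l\<in>UNIV - {i}. 1) (\<lambda>x. \<Prod>l\<in>UNIV - {i}. lam l x)"
    by (intro homog_prod homog_lam) auto
  then show ?thesis unfolding fbub_def[abs_def] by (simp add: card_Diff_subset)
qed

text \<open>\<open>g\<close> is the homogeneous substitute for \<open>f\<close>; the cofactor
  records that both agree where \<open>lam i\<close> vanishes.\<close>

definition homogenized :: "'n option \<Rightarrow> nat \<Rightarrow> (real ^ 'n \<Rightarrow> real) \<Rightarrow> (real ^ 'n \<Rightarrow> real) \<Rightarrow> bool" where
  "homogenized i m f g \<longleftrightarrow> homog i m g \<and>
     (\<exists>s. rpoly s \<and> (\<forall>x. f x = g x + lam i x * s x))"

lemma homogenized_polynomial: "homogenized i m f g \<Longrightarrow> rpoly f"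
proof -
  assume "homogenized i m f g"
  then obtain s where s: "homog i m g" "rpoly s" "\<And>x. f x = g x + lam i x * s x"
    unfolding homogenized_def by blast
  have "rpoly (\<lambda>x. g x + lam i x * s x)"
    by (intro rpoly_intros lam_polynomial s(2) homog_polynomial[OF s(1)])
  then show ?thesis by (simp add: s(3)[symmetric])
qed

lemma homogenized_mult:
  assumes f: "homogenized i m f g" and f': "homogenized i n f' g'"
  shows "homogenized i (m + n) (\<lambda>x. f x * f' x) (\<lambda>x. g x * g' x)"
proof -
  obtain s where s: "homog i m g" "rpoly s" "\<And>x. f x = g x + lam i x * s x"
    using f unfolding homogenized_def by blast
  obtain t where t: "homog i n g'" "rpoly t" "\<And>x. f' x = g' x + lam i x * t x"
    using f' unfolding homogenized_def by blast
  show ?thesis unfolding homogenized_def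
  proof (intro conjI exI allI)
    show "homog i (m + n) (\<lambda>x. g x * g' x)" by (rule homog_mult[OF s(1) t(1)])
    show "rpoly (\<lambda>x. s x * g' x + g x * t x + lam i x * (s x * t x))"
      by (intro rpoly_intros lam_polynomial s(2) t(2) homog_polynomial[OF s(1)] homog_polynomial[OF t(1)])
    show "f x * f' x = g x * g' x + lam i x * (s x * g' x + g x * t x + lam i x * (s x * t x))" for x
      unfolding s(3) t(3) by (simp add: algebra_simps)
  qed
qed

lemma homogenized_refl: "homog i m f \<Longrightarrow> homogenized i m f f"
  unfolding homogenized_def by (intro conjI exI[of _ "\<lambda>_. 0"]) (simp_all add: rpoly_intros)

lemma homogenized_prod:
  "finite A \<Longrightarrow> (\<And>l. l \<in> A \<Longrightarrow> homogenized i (m l) (f l) (g l)) \<Longrightarrow>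
    homogenized i (\<Sum>l\<in>A. m l) (\<lambda>x. \<Prod>l\<in>A. f l x) (\<lambda>x. \<Prod>l\<in>A. g l x)"
  by (induction rule: finite_induct) (simp_all add: homogenized_refl[OF homog_one] homogenized_mult)

lemma homogenized_power: "homogenized i m f g \<Longrightarrow> homogenized i (n * m) (\<lambda>x. f x ^ n) (\<lambda>x. g x ^ n)"
  by (induction n) (simp_all add: homogenized_refl[OF homog_one] homogenized_mult)

text \<open>\<open>1 - lam i\<close> is the affine function that is zero at \<open>a i\<close> and
  one on the opposite facet. Its powers raise the degree without changing values on the
  facet.\<close>

lemma homogenized_one: "homogenized i 1 (\<lambda>x. 1) (\<lambda>x. 1 + (-1) * lam i x)"
  unfolding homogenized_def
proof (intro conjI exI allI)
  have "frechet_derivative (\<lambda>x. (-1) * lam i x) (at x) d = (-1) * dl i d" for x d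
    using frechet_derivative_mult[of "\<lambda>_. -1" x "lam i" d] lam_differentiable by (simp add: lam_derivative)
  then show "homog i 1 (\<lambda>x. 1 + (-1) * lam i x)"
  proof -
    fix x d
    assume D: "\<And>x d. frechet_derivative (\<lambda>x. (-1) * lam i x) (at x) d = (-1) * dl i d"
    have pl: "rpoly (\<lambda>x. (-1) * lam i x)"
      by (intro rpoly_intros lam_polynomial)
    have "rpoly (\<lambda>x. 1 + (-1) * lam i x)"
      by (intro rpoly_intros lam_polynomial)
    moreover have "frechet_derivative (\<lambda>x. 1 + (-1) * lam i x) (at x) d = - dl i d" for x d
      unfolding frechet_derivative_add[OF differentiable_const rpoly_differentiable[OF pl]] D
      by (simp add: frechet_derivative_const)
    ultimately show ?thesis unfolding homog_def by (simp add: dl_radial)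
  qed
  show "rpoly (\<lambda>x::real^'n. 1)" by (rule rpoly_intros)
qed simp

text \<open>Write the coordinate as \<open>(x - a i) $ l\<close> plus the constant
  \<open>a i $ l\<close>, and homogenize only the constant.\<close>

lemma homogenized_component:
  "\<exists>g. homogenized i 1 (\<lambda>x. x $ l) g"
proof -
  define h where "h x = (x - a i) $ l" for x
  have h: "h = (\<lambda>x. - a i $ l + x $ l)" by (auto simp: h_def)
  have hp: "rpoly h" unfolding h
    by (intro rpoly_intros bounded_linear_vec_nth)
  have "(h has_derivative (\<lambda>d. 0 + d $ l)) (at x)" for x unfolding h
    by (intro has_derivative_add has_derivative_const bounded_linear_imp_has_derivative bounded_linear_vec_nth)
  then have "frechet_derivative h (at x) = (\<lambda>d. d $ l)" for x
    by (simp add: frechet_derivative_at[symmetric])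
  then have hh: "homog i 1 h" using hp by (simp add: homog_def h_def)
  have g: "homog i 1 (\<lambda>x. h x + a i $ l * (1 + (-1) * lam i x))"
    by (intro homog_add[OF hh homog_scale] conjunct1[OF homogenized_one[of i, unfolded homogenized_def]])
  have "homogenized i 1 (\<lambda>x. x $ l) (\<lambda>x. h x + a i $ l * (1 + (-1) * lam i x))"
    unfolding homogenized_def
    by (intro conjI g exI[of _ "\<lambda>_. a i $ l"]) (simp_all add: rpoly_intros h_def algebra_simps)
  then show ?thesis by (rule exI[of _ "\<lambda>x. h x + a i $ l * (1 + (-1) * lam i x)"])
qed

lemma homogenize:
  assumes "r \<in> Pol (int k)" shows "\<exists>g. homogenized i k r g"
  using assms
proof (induction rule: Pol_induct)
  case zero
  have "homog i k (\<lambda>x. 0 * fbub i x)"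
    unfolding homog_def by (simp add: rpoly_intros frechet_derivative_const)
  then show ?case using homogenized_refl[of i k "\<lambda>x. 0"] by auto
next
  case (add f f')
  obtain g s where g: "homog i k g" "rpoly s" "\<And>x. f x = g x + lam i x * s x"
    using add(3) unfolding homogenized_def by blast
  obtain g' s' where g': "homog i k g'" "rpoly s'" "\<And>x. f' x = g' x + lam i x * s' x"
    using add(4) unfolding homogenized_def by blast
  show ?case unfolding homogenized_def
    by (intro exI[of _ "\<lambda>x. g x + g' x"] exI[of _ "\<lambda>x. s x + s' x"] conjI homog_add g g' rpoly_intros)
      (simp add: g(3) g'(3) algebra_simps)
next
  case (scale c f)
  obtain g s where g: "homog i k g" "rpoly s" "\<And>x. f x = g x + lam i x * s x"
    using scale(2) unfolding homogenized_def by blast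
  show ?case unfolding homogenized_def
    by (intro exI[of _ "\<lambda>x. c * g x"] exI[of _ "\<lambda>x. c * s x"] conjI homog_scale g rpoly_intros)
      (simp add: g(3) algebra_simps)
next
  case (monomial \<alpha>)
  obtain g where g: "\<And>l. homogenized i 1 (\<lambda>x. x $ l) (g l)"
    using homogenized_component by metis
  let ?n = "\<Sum>l\<in>UNIV. \<alpha> l"
  have n: "?n \<le> k" using monomial by (simp del: of_nat_sum)
  have "homogenized i (\<Sum>l\<in>UNIV. \<alpha> l * 1) (\<lambda>x. \<Prod>l\<in>UNIV. (x $ l) ^ \<alpha> l) (\<lambda>x. \<Prod>l\<in>UNIV. g l x ^ \<alpha> l)"
    by (intro homogenized_prod homogenized_power g) simp
  \<comment> \<open>Monomials of lower degree are padded by a power of \<open>1 - lam i\<close>, so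
    that all terms reach the common degree \<open>k\<close> and can be added.\<close>
  from homogenized_mult[OF this homogenized_power[OF homogenized_one, of i "k - ?n"]]
  have "homogenized i k (\<lambda>x. \<Prod>l\<in>UNIV. (x $ l) ^ \<alpha> l) (\<lambda>x. (\<Prod>l\<in>UNIV. g l x ^ \<alpha> l) * (1 + (-1) * lam i x) ^ (k - ?n))"
    using n by simp
  then show ?case unfolding monomial_def[abs_def]
    by (rule exI[of _ "\<lambda>x. (\<Prod>l\<in>UNIV. g l x ^ \<alpha> l) * (1 + (-1) * lam i x) ^ (k - ?n)"])
qed

text \<open>Both arguments may be replaced by \<open>g\<close>. The integrand then has degree
  \<open>N + 2 k\<close>, since \<open>fbub i\<close> contributes N; together with the explicit N in
  the functional this is the factor \<open>2 N + 2 k\<close>.\<close>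

lemma facet_form_homogenized:
  assumes "homogenized i k r g"
  shows "facet_form i r r = (2 * real CARD('n) + 2 * real k) * I (\<lambda>x. fbub i x * (g x * g x))"
proof -
  obtain s where s: "homog i k g" "rpoly s" "\<And>x. r x = g x + lam i x * s x"
    using assms unfolding homogenized_def by blast
  note pr = homogenized_polynomial[OF assms] and pg = homog_polynomial[OF s(1)]
  have "facet_form i r r = facet_form i r g" by (rule facet_form_cong[OF pg s(2) pr s(3)])
  also have "\<dots> = facet_form i g r" by (rule facet_form_sym)
  also have "\<dots> = facet_form i g g" by (rule facet_form_cong[OF pg s(2) pg s(3)])
  also have "\<dots> = I (\<lambda>x. (2 * real CARD('n) + 2 * real k) * (fbub i x * (g x * g x)))"
  proof -
    have "homog i (CARD('n) + (k + k)) (\<lambda>x. fbub i x * (g x * g x))"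
      by (intro homog_mult homog_fbub s(1))
    then show ?thesis unfolding facet_form_def facet_functional_def homog_def by (simp add: algebra_simps)
  qed
  finally show ?thesis by (simp add: I_scale)
qed

lemma fbub_nonneg: "x \<in> K \<Longrightarrow> 0 \<le> fbub i x"
  unfolding fbub_def K_def by (intro prod_nonneg) auto

lemma bub_nonneg: "x \<in> K \<Longrightarrow> 0 \<le> bub x"
  unfolding bub_def K_def by (intro prod_nonneg) auto

text \<open>Bubble weights vanish on the boundary, so the square can be isolated only in the
  interior; the identity theorem does the rest.\<close>

lemma weighted_square_zero:
  assumes g: "rpoly g" and w: "rpoly w"
    and nn: "\<And>x. x \<in> K \<Longrightarrow> 0 \<le> w x" and pos: "\<And>x. x \<in> K_int \<Longrightarrow> 0 < w x"
    and z: "I (\<lambda>x. w x * (g x * g x)) = 0"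
  shows "g x = 0"
proof -
  have "rpoly (\<lambda>x. w x * (g x * g x))" by (intro rpoly_intros g w)
  then have wg: "w x * (g x * g x) = 0" for x
    by (rule I_eq_0_imp[OF _ _ z]) (simp add: nn)
  have "g x = 0" if "x \<in> K_int" for x using wg[of x] pos[OF that] by simp
  moreover obtain x0 where "x0 \<in> K_int" using K_int_nonempty by blast
  ultimately show ?thesis using polynomial_zero_if_zero_on_open[OF g K_int_open] by blast
qed

lemma fbub_pos: "x \<in> K_int \<Longrightarrow> 0 < fbub i x"
  unfolding fbub_def K_int_def by (intro prod_pos) auto

lemma bub_pos: "x \<in> K_int \<Longrightarrow> 0 < bub x"
  unfolding bub_def K_int_def by (intro prod_pos) auto

lemma facet_form_nonneg:
  assumes "r \<in> Pol (int k)" shows "0 \<le> facet_form i r r"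
proof -
  obtain g where g: "homogenized i k r g" using homogenize[OF assms] by blast
  show ?thesis unfolding facet_form_homogenized[OF g]
    by (intro mult_nonneg_nonneg I_nonneg fbub_nonneg zero_le_square) auto
qed

text \<open>A zero form forces the homogenized polynomial to vanish identically, which makes
  \<open>r\<close> a multiple of \<open>lam i\<close>. The conclusion therefore holds on the whole
  hyperplane of the facet.\<close>

lemma facet_form_eq_0:
  assumes "r \<in> Pol (int k)" and z: "facet_form i r r = 0" and x: "lam i x = 0"
  shows "r x = 0"
proof -
  obtain g where g: "homogenized i k r g" using homogenize[OF assms(1)] by blast
  then have pg: "rpoly g" unfolding homogenized_def by (blast intro: homog_polynomial)
  have "0 < real CARD('n)" by simp
  then have "2 * real CARD('n) + 2 * real k \<noteq> 0" by linarith
  then have "I (\<lambda>x. fbub i x * (g x * g x)) = 0"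
    using z unfolding facet_form_homogenized[OF g] by simp
  from weighted_square_zero[OF pg fbub_polynomial fbub_nonneg fbub_pos this]
  have "g x = 0" .
  then show ?thesis using g x unfolding homogenized_def by force
qed

end

section \<open>Geometry of a simplex and transport from the reference simplex\<close>

context barycentric
begin

section \<open>Coordinates, normals and diameter of a simplex\<close>

lemma lam_affine_combination:
  assumes "(\<Sum>j\<in>UNIV. c j) = 1" shows "lam i (\<Sum>j\<in>UNIV. c j *\<^sub>R a j) = c i"
proof -
  have "(\<Sum>j\<in>UNIV. c j *\<^sub>R a j) = a i + (\<Sum>j\<in>UNIV. c j *\<^sub>R (a j - a i))"
    using assms by (simp add: scaleR_diff_right sum_subtractf scaleR_left.sum[symmetric])
  then have "lam i (\<Sum>j\<in>UNIV. c j *\<^sub>R a j) = 1 + (\<Sum>j\<in>UNIV. c j * dl i (a j - a i))"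
    by (simp only: lam_add lam_vertex linear_sum[OF dl_linear] linear_scale[OF dl_linear] real_scaleR_def simp_thms if_True)
  also have "(\<Sum>j\<in>UNIV. c j * dl i (a j - a i)) = (\<Sum>j\<in>UNIV. (if i = j then c j else 0) - c j)"
    by (intro sum.cong refl) (simp add: dl_diff)
  also have "\<dots> = c i - 1" by (simp add: sum_subtractf assms)
  finally show ?thesis by simp
qed

lemma bary_eq: "bary a i x = lam i x"
proof -
  have "(THE c. (\<Sum>j\<in>UNIV. c j) = 1 \<and> (\<Sum>j\<in>UNIV. c j *\<^sub>R a j) = x) = (\<lambda>i. lam i x)"
  proof (rule the_equality)
    show "(\<Sum>j\<in>UNIV. lam j x) = 1 \<and> (\<Sum>j\<in>UNIV. lam j x *\<^sub>R a j) = x" by (simp add: lam_sum lam_comb)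
    fix c assume "(\<Sum>j\<in>UNIV. c j) = 1 \<and> (\<Sum>j\<in>UNIV. c j *\<^sub>R a j) = x"
    then show "c = (\<lambda>i. lam i x)" using lam_affine_combination by auto
  qed
  then show ?thesis by (simp add: bary_def)
qed

lemma bubble_eq: "bubble a = bub"
  by (simp add: fun_eq_iff bubble_def bub_def bary_eq)

lemma facet_bubble_eq: "facet_bubble a i = fbub i"
  by (simp add: fun_eq_iff facet_bubble_def fbub_def bary_eq)

text \<open>The vector representing the linear form \<open>dl i\<close>, that is, the constant
  gradient of \<open>lam i\<close>.\<close>

definition grad :: "'n option \<Rightarrow> real ^ 'n" where "grad i = adjoint (dl i) 1"

lemma grad_inner: "grad i \<bullet> d = dl i d"
  using adjoint_works[OF dl_linear, of d i 1] by (simp add: grad_def inner_commute)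

lemma facet_subset: "x \<in> facet a i \<Longrightarrow> x \<in> K \<and> lam i x = 0"
proof -
  assume x: "x \<in> facet a i"
  have conv: "convex {x. x \<in> K \<and> lam i x = 0}"
  proof (rule convexI)
    fix x y and u v :: real
    assume xy: "x \<in> {x. x \<in> K \<and> lam i x = 0}" "y \<in> {x. x \<in> K \<and> lam i x = 0}" and uv: "0 \<le> u" "0 \<le> v" "u + v = 1"
    have u: "u = 1 - v" using uv by simp
    have "u *\<^sub>R x + v *\<^sub>R y \<in> K" using xy uv by (intro convexD[OF K_convex]) auto
    then show "u *\<^sub>R x + v *\<^sub>R y \<in> {x. x \<in> K \<and> lam i x = 0}"
      using xy unfolding u by (simp add: lam_segment)
  qed
  have "facet a i \<subseteq> {x. x \<in> K \<and> lam i x = 0}"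
    unfolding facet_def by (rule hull_minimal[where S = convex, OF _ conv]) (auto simp: vertex_in_K lam_vertex)
  then show ?thesis using x by blast
qed

lemma vertex_in_facet: "j \<noteq> i \<Longrightarrow> a j \<in> facet a i"
  unfolding facet_def by (intro hull_inc) auto

lemma grad_nonzero: "0 < norm (grad i)"
proof -
  obtain j where "j \<noteq> i" using exists_other by blast
  then have "grad i \<bullet> (a i - a j) = 1" by (simp add: grad_inner dl_diff)
  then show ?thesis by auto
qed

text \<open>For uniqueness, expand a direction along the edges at a vertex \<open>a j\<close> of the
  facet. A normal is orthogonal to all of them except the edge to \<open>a i\<close>, so it is a
  multiple of the gradient; the sign and the norm condition fix the multiple.\<close>

lemma outward_normal_eq: "outward_normal K (facet a i) = (- 1 / norm (grad i)) *\<^sub>R grad i"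
  unfolding outward_normal_def
proof (rule the_equality)
  let ?n = "(- 1 / norm (grad i)) *\<^sub>R grad i"
  have nd: "?n \<bullet> d = - dl i d / norm (grad i)" for d by (simp add: grad_inner)
  have dl: "dl i (y - x) = lam i y - lam i x" for x y using lam_add[of i x "y - x"] by simp
  show "norm ?n = 1 \<and> (\<forall>x\<in>facet a i. \<forall>y\<in>facet a i. ?n \<bullet> (y - x) = 0) \<and> (\<forall>x\<in>facet a i. \<forall>y\<in>K. ?n \<bullet> (y - x) \<le> 0)"
  proof (intro conjI ballI)
    show "norm ?n = 1" using grad_nonzero[of i] by simp
    show "?n \<bullet> (y - x) = 0" if "x \<in> facet a i" "y \<in> facet a i" for x y
      unfolding nd dl using facet_subset that by simp
    show "?n \<bullet> (y - x) \<le> 0" if "x \<in> facet a i" "y \<in> K" for x y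
    proof -
      have "lam i x = 0" "0 \<le> lam i y" using facet_subset[OF that(1)] that(2) by (simp_all add: K_def)
      then show ?thesis unfolding nd dl using grad_nonzero[of i] by (simp add: divide_nonneg_pos)
    qed
  qed
  fix n assume n: "norm n = 1 \<and> (\<forall>x\<in>facet a i. \<forall>y\<in>facet a i. n \<bullet> (y - x) = 0) \<and> (\<forall>x\<in>facet a i. \<forall>y\<in>K. n \<bullet> (y - x) \<le> 0)"
  obtain j where j: "j \<noteq> i" using exists_other by blast
  \<comment> \<open>The one free parameter of a normal: minus its component along the edge leading
    from the facet to \<open>a i\<close>, which is nonnegative because \<open>a i\<close> lies on
    the inner side.\<close>
  define \<tau> where "\<tau> = - (n \<bullet> (a i - a j))"
  have \<tau>: "0 \<le> \<tau>" unfolding \<tau>_def using n vertex_in_facet[OF j] vertex_in_K[of i] by auto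
  have "n \<bullet> d = (- \<tau>) * dl i d" for d
  proof -
    have "n \<bullet> d = n \<bullet> (\<Sum>l\<in>UNIV. dl l d *\<^sub>R (a l - a j))" by (simp only: sum_dl_edges)
    also have "\<dots> = (\<Sum>l\<in>UNIV. dl l d * (n \<bullet> (a l - a j)))" by (simp add: inner_sum_right)
    also have "\<dots> = (\<Sum>l\<in>UNIV. if l = i then dl l d * (- \<tau>) else 0)"
    proof (intro sum.cong refl)
      fix l
      show "dl l d * (n \<bullet> (a l - a j)) = (if l = i then dl l d * (- \<tau>) else 0)"
        using n vertex_in_facet[OF j] vertex_in_facet[of l i] by (auto simp: \<tau>_def)
    qed
    also have "\<dots> = (- \<tau>) * dl i d" by (simp add: mult.commute)
    finally show ?thesis .
  qed
  then have "n \<bullet> d = ((- \<tau>) *\<^sub>R grad i) \<bullet> d" for d by (simp add: grad_inner)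
  then have eq: "n = (- \<tau>) *\<^sub>R grad i" by (metis vector_eq_rdot inner_commute)
  then have "\<tau> * norm (grad i) = 1" using n \<tau> by simp
  then have "\<tau> = 1 / norm (grad i)" using grad_nonzero[of i] by (simp add: field_simps)
  then show "n = ?n" using eq by simp
qed

lemma normal_inner: "\<beta> \<bullet> outward_normal K (facet a i) = - dl i \<beta> / norm (grad i)"
  unfolding outward_normal_eq by (simp add: inner_commute[of \<beta>] grad_inner)

lemma facet_sign_eq: "facet_sign \<beta> K a i = - sgn (dl i \<beta>)"
  unfolding facet_sign_def normal_inner using grad_nonzero[of i] by (simp add: sgn_divide sgn_minus)

lemma diameter_edge: "norm (a i - a j) \<le> diameter K"
  using diameter_bounded_bound[OF compact_imp_bounded[OF K_compact] vertex_in_K vertex_in_K, of i j]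
  by (simp add: dist_norm)

lemma diameter_pos: "0 < diameter K"
proof -
  obtain j :: "'n option" where j: "j \<noteq> None" using exists_other by blast
  have "a j \<noteq> a None" using j lam_vertex[of j j] lam_vertex[of j None] by auto
  then have "0 < norm (a j - a None)" by simp
  then show ?thesis using diameter_edge[of j None] by linarith
qed

text \<open>\<open>1 / norm (grad i)\<close> is the height of the simplex over the facet, and a
  height is at most the diameter.\<close>

lemma dl_lower_bound:
  assumes "\<theta> * norm \<beta> \<le> \<bar>\<beta> \<bullet> outward_normal K (facet a i)\<bar>" "0 \<le> \<theta>"
  shows "\<theta> * norm \<beta> / diameter K \<le> \<bar>dl i \<beta>\<bar>"
proof -
  obtain j where "j \<noteq> i" using exists_other by blast
  then have "1 = grad i \<bullet> (a i - a j)" by (simp add: grad_inner dl_diff)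
  also have "\<dots> \<le> norm (grad i) * norm (a i - a j)" by (rule norm_cauchy_schwarz)
  also have "\<dots> \<le> norm (grad i) * diameter K" by (intro mult_left_mono diameter_edge) simp
  finally have g: "1 \<le> norm (grad i) * diameter K" .
  have "\<theta> * norm \<beta> \<le> \<bar>dl i \<beta>\<bar> / norm (grad i)" using assms(1) unfolding normal_inner by simp
  then have "\<theta> * norm \<beta> * norm (grad i) \<le> \<bar>dl i \<beta>\<bar>" using grad_nonzero[of i] by (simp add: pos_le_divide_eq)
  moreover have "\<theta> * norm \<beta> / diameter K \<le> \<theta> * norm \<beta> * norm (grad i)"
  proof -
    have "\<theta> * norm \<beta> * 1 \<le> \<theta> * norm \<beta> * (norm (grad i) * diameter K)"
      using g assms(2) by (intro mult_left_mono) auto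
    then show ?thesis using diameter_pos by (simp add: pos_divide_le_eq mult.assoc)
  qed
  ultimately show ?thesis by linarith
qed

section \<open>Integrals of monomials in the barycentric coordinates\<close>

definition bmono :: "('n option \<Rightarrow> nat) \<Rightarrow> real ^ 'n \<Rightarrow> real" where
  "bmono \<alpha> x = (\<Prod>l\<in>UNIV. lam l x ^ \<alpha> l)"

lemma bmono_polynomial: "rpoly (bmono \<alpha>)"
  unfolding bmono_def[abs_def]
  by (intro real_polynomial_function_prod real_polynomial_function_power lam_polynomial) simp

text \<open>Multiplying by \<open>lam l\<close> avoids the exponent \<open>n - 1\<close>, and with
  it a case distinction at \<open>n = 0\<close>.\<close>

lemma lam_power_derivative:
  "lam l x * frechet_derivative (\<lambda>x. lam l x ^ n) (at x) d = real n * dl l d * lam l x ^ n"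
proof (induction n)
  case 0
  then show ?case by (simp add: frechet_derivative_const)
next
  case (Suc n)
  have p: "rpoly (\<lambda>x. lam l x ^ n)" by (intro real_polynomial_function_power lam_polynomial)
  have "frechet_derivative (\<lambda>x. lam l x ^ Suc n) (at x) d
      = lam l x * frechet_derivative (\<lambda>x. lam l x ^ n) (at x) d + dl l d * lam l x ^ n"
    unfolding power_Suc
    by (subst frechet_derivative_mult[OF lam_differentiable rpoly_differentiable[OF p]])
      (simp add: lam_derivative)
  then show ?case using Suc.IH by (simp add: algebra_simps)
qed

text \<open>The factor \<open>lam i x * lam j x\<close> again keeps all exponents unchanged. The
  product runs over a subset \<open>S\<close> only to permit induction on the number of
  factors.\<close>

lemma bmono_derivative_aux:
  "finite S \<Longrightarrow> i \<noteq> j \<Longrightarrow> lam i x * lam j x * frechet_derivative (\<lambda>x. \<Prod>l\<in>S. lam l x ^ \<alpha> l) (at x) (a i - a j)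
    = ((if i \<in> S then real (\<alpha> i) * lam j x else 0) - (if j \<in> S then real (\<alpha> j) * lam i x else 0)) * (\<Prod>l\<in>S. lam l x ^ \<alpha> l)"
proof (induction rule: finite_induct)
  case empty
  then show ?case by (simp add: frechet_derivative_const)
next
  case (insert l S)
  have p: "rpoly (\<lambda>x. lam l x ^ \<alpha> l)" "rpoly (\<lambda>x. \<Prod>l\<in>S. lam l x ^ \<alpha> l)"
    by (intro real_polynomial_function_power real_polynomial_function_prod lam_polynomial insert(1))+
  let ?d = "a i - a j" and ?P = "\<Prod>l\<in>S. lam l x ^ \<alpha> l"
  have D: "frechet_derivative (\<lambda>x. \<Prod>l\<in>insert l S. lam l x ^ \<alpha> l) (at x) ?d
      = lam l x ^ \<alpha> l * frechet_derivative (\<lambda>x. \<Prod>l\<in>S. lam l x ^ \<alpha> l) (at x) ?d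
        + frechet_derivative (\<lambda>x. lam l x ^ \<alpha> l) (at x) ?d * ?P"
    using insert(1,2) frechet_derivative_mult[OF p[THEN rpoly_differentiable]] by simp
  have *: "lam i x * lam j x * frechet_derivative (\<lambda>x. lam l x ^ \<alpha> l) (at x) ?d
     = ((if i = l then real (\<alpha> i) * lam j x else 0) - (if j = l then real (\<alpha> j) * lam i x else 0)) * lam l x ^ \<alpha> l"
  proof -
    consider "l = i" | "l = j" | "l \<noteq> i" "l \<noteq> j" by blast
    then show ?thesis
    proof cases
      case 1
      then show ?thesis
        using arg_cong[OF lam_power_derivative[of i x "\<alpha> i" ?d], of "\<lambda>t. lam j x * t"] insert(4)
        by (simp add: dl_diff mult_ac)
    next
      case 2
      then show ?thesis
        using arg_cong[OF lam_power_derivative[of j x "\<alpha> j" ?d], of "\<lambda>t. lam i x * t"] insert(4)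
        by (simp add: dl_diff mult_ac)
    next
      case 3
      have "frechet_derivative (\<lambda>x. lam l x ^ n) (at x) ?d = 0" for n
      proof (induction n)
        case (Suc n)
        have p: "rpoly (\<lambda>x. lam l x ^ n)" by (intro real_polynomial_function_power lam_polynomial)
        show ?case unfolding power_Suc
          by (subst frechet_derivative_mult[OF lam_differentiable rpoly_differentiable[OF p]])
            (use 3 in \<open>simp add: lam_derivative dl_diff Suc\<close>)
      qed (simp add: frechet_derivative_const)
      then show ?thesis using 3 by simp
    qed
  qed
  have "lam i x * lam j x * frechet_derivative (\<lambda>x. \<Prod>l\<in>insert l S. lam l x ^ \<alpha> l) (at x) ?d
     = lam l x ^ \<alpha> l * (lam i x * lam j x * frechet_derivative (\<lambda>x. \<Prod>l\<in>S. lam l x ^ \<alpha> l) (at x) ?d)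
       + (lam i x * lam j x * frechet_derivative (\<lambda>x. lam l x ^ \<alpha> l) (at x) ?d) * ?P"
    unfolding D by (simp add: algebra_simps)
  also have "\<dots> = ((if i \<in> insert l S then real (\<alpha> i) * lam j x else 0) - (if j \<in> insert l S then real (\<alpha> j) * lam i x else 0)) * (lam l x ^ \<alpha> l * ?P)"
    unfolding * insert.IH[OF insert(4)] using insert(2) by (auto simp: algebra_simps)
  finally show ?case using insert(1,2) by simp
qed

text \<open>The derivative of \<open>lam i * lam j * bmono \<alpha>\<close> along
  \<open>a i - a j\<close> has integral zero; this relates the integrals with one extra factor
  \<open>lam i\<close> or \<open>lam j\<close>. Summing over \<open>j\<close> and using that the
  coordinates add up to one gives a recursion in the exponents.\<close>

lemma bmono_integral_step:
  "real (\<Sum>j\<in>UNIV. \<alpha> j + 1) * I (\<lambda>x. lam i x * bmono \<alpha> x) = real (\<alpha> i + 1) * I (bmono \<alpha>)"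
proof -
  let ?T = "\<lambda>j. I (\<lambda>x. lam j x * bmono \<alpha> x)"
  have pT: "rpoly (\<lambda>x. c * (lam j x * bmono \<alpha> x))" for c j
    by (intro rpoly_intros lam_polynomial bmono_polynomial)
  have "real (\<alpha> i + 1) * ?T j = real (\<alpha> j + 1) * ?T i" for j
  proof (cases "i = j")
    case False
    let ?f = "\<lambda>x. (lam i x * lam j x) * bmono \<alpha> x"
    have pf: "rpoly ?f" "rpoly (\<lambda>x. lam i x * lam j x)"
      by (intro rpoly_intros lam_polynomial bmono_polynomial)+
    have "frechet_derivative ?f (at x) (a i - a j)
       = real (\<alpha> i + 1) * (lam j x * bmono \<alpha> x) - real (\<alpha> j + 1) * (lam i x * bmono \<alpha> x)" for x
    proof -
      have "frechet_derivative ?f (at x) (a i - a j) = lam i x * lam j x * frechet_derivative (bmono \<alpha>) (at x) (a i - a j)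
          + (lam i x * dl j (a i - a j) + dl i (a i - a j) * lam j x) * bmono \<alpha> x"
        unfolding frechet_derivative_mult[OF pf(2)[THEN rpoly_differentiable]
          bmono_polynomial[THEN rpoly_differentiable]]
          frechet_derivative_mult[OF lam_differentiable lam_differentiable] lam_derivative ..
      also have "lam i x * lam j x * frechet_derivative (bmono \<alpha>) (at x) (a i - a j)
        = (real (\<alpha> i) * lam j x - real (\<alpha> j) * lam i x) * bmono \<alpha> x"
        using bmono_derivative_aux[OF _ False, of UNIV x \<alpha>] unfolding bmono_def[abs_def] by simp
      finally show ?thesis using False by (simp add: dl_diff algebra_simps)
    qed
    moreover have "I (\<lambda>x. frechet_derivative ?f (at x) (a i - a j)) = 0"
    proof (rule edge_integral[OF pf(1)])
      show "\<exists>s. rpoly s \<and> (\<forall>x. ?f x = lam j x * s x)"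
        by (intro exI[of _ "\<lambda>x. lam i x * bmono \<alpha> x"] conjI rpoly_intros lam_polynomial bmono_polynomial)
          (simp add: mult_ac)
      show "\<exists>s. rpoly s \<and> (\<forall>x. ?f x = lam i x * s x)"
        by (intro exI[of _ "\<lambda>x. lam j x * bmono \<alpha> x"] conjI rpoly_intros lam_polynomial bmono_polynomial)
          (simp add: mult_ac)
    qed
    ultimately have "I (\<lambda>x. real (\<alpha> i + 1) * (lam j x * bmono \<alpha> x) - real (\<alpha> j + 1) * (lam i x * bmono \<alpha> x)) = 0"
      by (simp only:)
    then show ?thesis by (simp only: I_diff[OF pT pT] I_scale right_minus_eq)
  qed simp
  then have "real (\<alpha> i + 1) * (\<Sum>j\<in>UNIV. ?T j) = (\<Sum>j\<in>UNIV. real (\<alpha> j + 1)) * ?T i"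
    by (simp only: sum_distrib_left sum_distrib_right)
  moreover have "(\<Sum>j\<in>UNIV. ?T j) = I (\<lambda>x. \<Sum>j\<in>UNIV. lam j x * bmono \<alpha> x)"
    by (intro I_sum[symmetric] rpoly_intros lam_polynomial bmono_polynomial)
  moreover have "(\<lambda>x. \<Sum>j\<in>UNIV. lam j x * bmono \<alpha> x) = bmono \<alpha>"
    by (simp add: sum_distrib_right[symmetric] lam_sum)
  ultimately show ?thesis by (simp add: of_nat_sum)
qed

lemma bmono_Suc: "bmono (\<lambda>l. \<alpha> l + (if l = i then 1 else 0)) x = lam i x * bmono \<alpha> x"
proof -
  have "(\<Prod>l\<in>UNIV. lam l x ^ (if l = i then 1 else 0)) = lam i x"
    by (simp add: if_distrib[of "\<lambda>e. _ ^ e"] prod.delta cong: if_cong)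
  then show ?thesis by (simp add: bmono_def power_add prod.distrib)
qed

end

text \<open>The coefficients of the recursion depend on the exponents only, not on the simplex.
  Induction on the total degree therefore relates any two simplices; the statement is multiplied out
  to avoid quotients.\<close>

lemma bmono_integral_ratio:
  fixes a a' :: "'n option \<Rightarrow> real ^ 'n"
  assumes b: "barycentric a lam dl" and b': "barycentric a' lam' dl'"
  shows "barycentric.I lam (barycentric.bmono lam \<alpha>) * barycentric.I lam' (\<lambda>x. 1)
       = barycentric.I lam' (barycentric.bmono lam' \<alpha>) * barycentric.I lam (\<lambda>x. 1)"
proof (induction "\<Sum>l\<in>UNIV. \<alpha> l" arbitrary: \<alpha>)
  interpret A: barycentric a lam dl by (rule b)
  interpret B: barycentric a' lam' dl' by (rule b')
  {
    case 0
    then have "\<alpha> = (\<lambda>_. 0)" by auto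
    then show ?case by (simp add: A.bmono_def[abs_def] B.bmono_def[abs_def])
  next
    case (Suc n)
    then obtain i where i: "\<alpha> i > 0" by (metis gr0I sum.neutral nat.distinct(1))
    define \<gamma> where "\<gamma> l = \<alpha> l - (if l = i then 1 else 0)" for l
    have \<alpha>: "\<alpha> = (\<lambda>l. \<gamma> l + (if l = i then 1 else 0))" using i by (auto simp: \<gamma>_def)
    have "(\<Sum>l\<in>UNIV. \<alpha> l) = (\<Sum>l\<in>UNIV. \<gamma> l) + 1"
      by (subst \<alpha>) (simp add: sum.distrib)
    then have IH: "A.I (A.bmono \<gamma>) * B.I (\<lambda>x. 1) = B.I (B.bmono \<gamma>) * A.I (\<lambda>x. 1)"
      using Suc(2) by (intro Suc(1)) simp
    let ?s = "real (\<Sum>j\<in>UNIV. \<gamma> j + 1)"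
    have "0 < (\<Sum>j\<in>UNIV. \<gamma> j + 1)" by (rule sum_pos) auto
    then have s: "?s \<noteq> 0" by (simp only: of_nat_eq_0_iff)
    have sA: "?s * A.I (A.bmono \<alpha>) = real (\<gamma> i + 1) * A.I (A.bmono \<gamma>)"
      using A.bmono_integral_step[of \<gamma> i] unfolding A.bmono_Suc[symmetric] \<alpha>[symmetric] .
    have sB: "?s * B.I (B.bmono \<alpha>) = real (\<gamma> i + 1) * B.I (B.bmono \<gamma>)"
      using B.bmono_integral_step[of \<gamma> i] unfolding B.bmono_Suc[symmetric] \<alpha>[symmetric] .
    have "?s * (A.I (A.bmono \<alpha>) * B.I (\<lambda>x. 1)) = (?s * A.I (A.bmono \<alpha>)) * B.I (\<lambda>x. 1)" by (rule mult.assoc[symmetric])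
    also have "\<dots> = real (\<gamma> i + 1) * (A.I (A.bmono \<gamma>) * B.I (\<lambda>x. 1))" unfolding sA by (rule mult.assoc)
    also have "\<dots> = (?s * B.I (B.bmono \<alpha>)) * A.I (\<lambda>x. 1)" unfolding IH sB by (rule mult.assoc[symmetric])
    also have "\<dots> = ?s * (B.I (B.bmono \<alpha>) * A.I (\<lambda>x. 1))" by (rule mult.assoc)
    finally show ?case unfolding mult_left_cancel[OF s] .
  }
qed

section \<open>The reference simplex and its affine images\<close>

definition ref_lam :: "'n option \<Rightarrow> real ^ 'n \<Rightarrow> real" where
  "ref_lam i x = (case i of None \<Rightarrow> 1 - (\<Sum>j\<in>UNIV. x $ j) | Some j \<Rightarrow> x $ j)"

definition ref_dl :: "'n option \<Rightarrow> real ^ 'n \<Rightarrow> real" where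
  "ref_dl i x = (case i of None \<Rightarrow> - (\<Sum>j\<in>UNIV. x $ j) | Some j \<Rightarrow> x $ j)"

lemma linear_ref_dl: "linear (ref_dl i)"
  by (cases i) (auto intro!: linearI simp: ref_dl_def sum.distrib sum_distrib_left)

lemma sum_ref_lam: "(\<Sum>i\<in>UNIV. ref_lam i x) = 1"
  by (simp add: sum_option ref_lam_def)

lemma ref_lam_combination: "(\<Sum>i\<in>UNIV. ref_lam i x *\<^sub>R ref_vertex i) = x"
  using basis_expansion[of x] by (simp add: sum_option ref_lam_def scalar_mult_eq_scaleR)

lemma ref_lam_vertex: "ref_lam i (ref_vertex j) = (if i = j then 1 else 0)"
  by (cases i; cases j) (auto simp: ref_lam_def axis_def)

interpretation ref: barycentric ref_vertex ref_lam ref_dl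
proof (rule barycentric.intro)
  show "ref_lam i (x + d) = ref_lam i x + ref_dl i d" for i and x d :: "real ^ 'n"
    by (cases i) (simp_all add: ref_lam_def ref_dl_def sum.distrib)
qed (rule linear_ref_dl sum_ref_lam ref_lam_combination ref_lam_vertex)+

lemma ref_K: "ref.K = ref_simplex"
  by (simp add: ref.K_eq_hull ref_simplex_def)

lemma matrix_inv_works:
  assumes "invertible M" shows "M ** matrix_inv M = mat 1" "matrix_inv M ** M = mat 1"
proof -
  have "M ** matrix_inv M = mat 1 \<and> matrix_inv M ** M = mat 1"
    unfolding matrix_inv_def using assms unfolding invertible_def by (rule someI_ex)
  then show "M ** matrix_inv M = mat 1" "matrix_inv M ** M = mat 1" by blast+
qed

definition pull :: "real ^ 'n ^ 'n \<Rightarrow> real ^ 'n \<Rightarrow> real ^ 'n \<Rightarrow> real ^ 'n" where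
  "pull M g x = matrix_inv M *v (x - g)"

definition aff_lam where "aff_lam M g i x = ref_lam i (pull M g x)"
definition aff_dl where "aff_dl M i d = ref_dl i (matrix_inv M *v d)"

lemma pull_affine_map: "invertible M \<Longrightarrow> pull M g (affine_map M g x) = x"
  by (simp add: pull_def affine_map_def matrix_vector_mul_assoc matrix_inv_works)

lemma affine_map_pull: "invertible M \<Longrightarrow> affine_map M g (pull M g x) = x"
  by (simp add: pull_def affine_map_def matrix_vector_mul_assoc matrix_inv_works)

lemma pull_add: "pull M g (x + d) = pull M g x + matrix_inv M *v d"
  by (simp add: pull_def matrix_vector_right_distrib matrix_vector_mult_diff_distrib)

lemma barycentric_affine:
  fixes M :: "real ^ 'n ^ 'n"
  assumes M: "invertible M"
  shows "barycentric (vertices M g) (aff_lam M g) (aff_dl M)"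
proof (rule barycentric.intro)
  fix i j and x d :: "real ^ 'n"
  have "linear (ref_dl i \<circ> (*v) (matrix_inv M))"
    by (intro linear_compose linear_ref_dl matrix_vector_mul_linear)
  then show "linear (aff_dl M i)" by (simp add: aff_dl_def[abs_def] o_def)
  show "aff_lam M g i (x + d) = aff_lam M g i x + aff_dl M i d"
    by (simp add: aff_lam_def aff_dl_def pull_add ref.lam_add)
  show "(\<Sum>i\<in>UNIV. aff_lam M g i x) = 1" by (simp add: aff_lam_def sum_ref_lam)
  show "aff_lam M g i (vertices M g j) = (if i = j then 1 else 0)"
    by (simp add: aff_lam_def vertices_def pull_affine_map[OF M] ref_lam_vertex)
  have "(\<Sum>i\<in>UNIV. aff_lam M g i x *\<^sub>R vertices M g i)
      = (\<Sum>i\<in>UNIV. M *v (ref_lam i (pull M g x) *\<^sub>R ref_vertex i)) + (\<Sum>i\<in>UNIV. ref_lam i (pull M g x)) *\<^sub>R g"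
    by (simp add: aff_lam_def vertices_def affine_map_def scaleR_add_right sum.distrib scaleR_left.sum matrix_vector_mult_scaleR)
  also have "\<dots> = M *v (\<Sum>i\<in>UNIV. ref_lam i (pull M g x) *\<^sub>R ref_vertex i) + g"
    by (simp add: sum_ref_lam linear_sum[OF matrix_vector_mul_linear])
  also have "\<dots> = affine_map M g (pull M g x)" by (simp only: ref_lam_combination affine_map_def)
  finally show "(\<Sum>i\<in>UNIV. aff_lam M g i x *\<^sub>R vertices M g i) = x" by (simp only: affine_map_pull[OF M])
qed

lemma affine_K:
  assumes M: "invertible M" shows "barycentric.K (aff_lam M g) = affine_map M g ` ref_simplex"
proof -
  interpret A: barycentric "vertices M g" "aff_lam M g" "aff_dl M" by (rule barycentric_affine[OF M])
  have "x \<in> A.K \<longleftrightarrow> pull M g x \<in> ref_simplex" for x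
    unfolding ref_K[symmetric] by (simp add: A.K_def ref.K_def aff_lam_def)
  then show ?thesis using pull_affine_map[OF M, of g] affine_map_pull[OF M, of g]
    by (auto simp: image_iff) metis
qed

text \<open>The monomials in the barycentric coordinates have the same mean value on all simplices.\<close>

lemma integral_pull:
  fixes M :: "real ^ 'n ^ 'n" and h :: "real ^ 'n \<Rightarrow> real"
  assumes M: "invertible M" and h: "rpoly h"
  shows "barycentric.I (aff_lam M g) (\<lambda>x. h (pull M g x))
    = barycentric.I (aff_lam M g) (\<lambda>x. 1) / ref.I (\<lambda>x::real^'n. 1) * ref.I h"
proof -
  interpret A: barycentric "vertices M g" "aff_lam M g" "aff_dl M" by (rule barycentric_affine[OF M])
  define J where "J = A.I (\<lambda>x. 1) / ref.I (\<lambda>x::real^'n. 1)"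
  have pull_poly: "rpoly (\<lambda>x. f (pull M g x))" if "rpoly f" for f :: "real^'n \<Rightarrow> real"
  proof -
    obtain j where j: "f \<in> Pol j" using rpoly_Pol[OF \<open>rpoly f\<close>] by blast
    have "(\<lambda>x. pull M g x $ i) = aff_lam M g (Some i)" for i by (simp add: aff_lam_def ref_lam_def fun_eq_iff)
    then have "(\<lambda>x. f (pull M g x)) \<in> Pol j" using Pol_compose[OF j, of "pull M g"] A.lam_Pol by simp
    then show ?thesis by (rule Pol_rpoly)
  qed
  obtain j where "h \<in> Pol j" using rpoly_Pol[OF h] by blast
  then have "A.I (\<lambda>x. h (pull M g x)) = J * ref.I h"
  proof (induction rule: Pol_induct)
    case zero
    show ?case by (simp add: A.I_def ref.I_def)
  next
    case (add f f')
    then show ?case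
      by (simp add: A.I_add ref.I_add pull_poly Pol_rpoly distrib_left)
  next
    case (scale c f)
    then show ?case by (simp add: A.I_scale ref.I_scale)
  next
    case (monomial \<alpha>)
    \<comment> \<open>On the reference simplex \<open>x $ j\<close> is the coordinate with index
      \<open>Some j\<close>, so an ordinary monomial is a barycentric one with exponent 0 at
      \<open>None\<close>.\<close>
    define \<gamma> where "\<gamma> l = (case l of None \<Rightarrow> 0 | Some j \<Rightarrow> \<alpha> j)" for l
    have m: "ref.bmono \<gamma> = monomial \<alpha>"
      by (simp add: fun_eq_iff ref.bmono_def monomial_def UNIV_option_conv prod.reindex \<gamma>_def ref_lam_def)
    have mA: "A.bmono \<gamma> = (\<lambda>x. monomial \<alpha> (pull M g x))"
      unfolding m[symmetric] by (simp add: fun_eq_iff ref.bmono_def A.bmono_def aff_lam_def)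
    have "A.I (A.bmono \<gamma>) * ref.I (\<lambda>x::real^'n. 1) = ref.I (ref.bmono \<gamma>) * A.I (\<lambda>x. 1)"
      by (rule bmono_integral_ratio[OF A.barycentric_axioms ref.barycentric_axioms])
    then have "A.I (A.bmono \<gamma>) = J * ref.I (ref.bmono \<gamma>)"
    proof -
      have "0 < ref.I (\<lambda>x::real^'n. 1)" by (rule ref.I_one_pos)
      then show ?thesis using \<open>A.I (A.bmono \<gamma>) * _ = _\<close> unfolding J_def by (simp add: field_simps)
    qed
    then show ?case unfolding mA m .
  qed
  then show ?thesis by (simp only: J_def)
qed

section \<open>Lebesgue norms and norm equivalences\<close>

lemma borel_measurable_cong_negligible:
  fixes f g :: "'a::euclidean_space \<Rightarrow> real"
  assumes K: "K \<in> sets lebesgue" and neg: "negligible {x \<in> K. f x \<noteq> g x}"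
    and g: "g \<in> borel_measurable (lebesgue_on K)"
  shows "f \<in> borel_measurable (lebesgue_on K)"
proof -
  have "g measurable_on K" using g measurable_on_iff_borel_measurable[OF K] by blast
  then have "f measurable_on K" by (rule measurable_on_spike[OF _ neg]) auto
  then show ?thesis using measurable_on_iff_borel_measurable[OF K] by blast
qed

lemma integral_mult_cong_negligible:
  fixes f g :: "'a::euclidean_space \<Rightarrow> real"
  assumes K: "K \<in> sets lebesgue" and neg: "negligible {x \<in> K. f x \<noteq> g x}"
    and g: "g \<in> borel_measurable (lebesgue_on K)" and w: "w \<in> borel_measurable (lebesgue_on K)"
  shows "integral\<^sup>L (lebesgue_on K) (\<lambda>x. w x * f x) = integral\<^sup>L (lebesgue_on K) (\<lambda>x. w x * g x)"
proof (rule integral_cong_AE)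
  have f: "f \<in> borel_measurable (lebesgue_on K)" by (rule borel_measurable_cong_negligible[OF K neg g])
  show "(\<lambda>x. w x * f x) \<in> borel_measurable (lebesgue_on K)" "(\<lambda>x. w x * g x) \<in> borel_measurable (lebesgue_on K)"
    by (intro borel_measurable_times w f g)+
  have "AE x in lebesgue_on K. f x = g x" using neg negligible_iff_AE_lebesgue_on[OF K] by blast
  then show "AE x in lebesgue_on K. w x * f x = w x * g x" by (rule eventually_mono) simp
qed

lemma Lr_norm_cong_negligible:
  assumes K: "K \<in> sets lebesgue" and neg: "negligible {x \<in> K. f x \<noteq> g x}"
    and g: "g \<in> borel_measurable (lebesgue_on K)"
  shows "Lr_norm q K f = Lr_norm q K g"
proof -
  have f: "f \<in> borel_measurable (lebesgue_on K)" by (rule borel_measurable_cong_negligible[OF K neg g])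
  have "AE x in lebesgue_on K. f x = g x" using neg negligible_iff_AE_lebesgue_on[OF K] by blast
  then have ae: "AE x in lebesgue_on K. \<bar>f x\<bar> powr q = \<bar>g x\<bar> powr q" by (rule eventually_mono) simp
  have "integral\<^sup>L (lebesgue_on K) (\<lambda>x. \<bar>f x\<bar> powr q) = integral\<^sup>L (lebesgue_on K) (\<lambda>x. \<bar>g x\<bar> powr q)"
    by (rule integral_cong_AE[OF _ _ ae]) (use f g in measurable)
  then show ?thesis by (simp add: Lr_norm_def)
qed

text \<open>Young's inequality for \<open>t / s\<close> and 1. The free scale \<open>s\<close> is 1
  for mere integrability and is optimised for Hoelder's inequality.\<close>

lemma abs_le_power_sum:
  fixes t q s :: real
  assumes "1 < q" "0 \<le> t" "0 < s"
  shows "t \<le> s * (t powr q / s powr q / q + (1 - 1 / q))"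
proof -
  define p where "p = q / (q - 1)"
  have p: "1 < p" "1 / p + 1 / q = 1" "1 / p = 1 - 1 / q" using assms by (auto simp: p_def field_simps)
  have "t / s = t / s * 1" by simp
  also have "\<dots> \<le> (t / s) powr q / q + 1 powr p / p"
    using p assms by (intro Youngs_inequality) auto
  also have "(t / s) powr q = t powr q / s powr q" using assms by (simp add: powr_divide)
  also have "1 powr p / p = 1 - 1 / q" using p(3) by simp
  finally have "t / s \<le> t powr q / s powr q / q + (1 - 1 / q)" .
  then have "s * (t / s) \<le> s * (t powr q / s powr q / q + (1 - 1 / q))" using assms by (intro mult_left_mono) auto
  then show ?thesis using assms by simp
qed

lemma Lr_integrable:
  assumes f: "f \<in> Lr q K" and q: "1 < q" and one: "integrable (lebesgue_on K) (\<lambda>x. 1 :: real)"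
  shows "integrable (lebesgue_on K) f"
proof (rule Bochner_Integration.integrable_bound)
  show "integrable (lebesgue_on K) (\<lambda>x. \<bar>f x\<bar> powr q / q + (1 - 1 / q) * 1)"
    using f one unfolding Lr_def by (intro Bochner_Integration.integrable_add integrable_divide integrable_mult_right) auto
  show "f \<in> borel_measurable (lebesgue_on K)" using f by (simp add: Lr_def)
  show "AE x in lebesgue_on K. norm (f x) \<le> norm (\<bar>f x\<bar> powr q / q + (1 - 1 / q) * 1)"
  proof (rule AE_I2)
    fix x
    have "\<bar>f x\<bar> \<le> \<bar>f x\<bar> powr q / q + (1 - 1 / q)" using abs_le_power_sum[OF q, of "\<bar>f x\<bar>" 1] by simp
    then show "norm (f x) \<le> norm (\<bar>f x\<bar> powr q / q + (1 - 1 / q) * 1)" by simp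
  qed
qed

text \<open>Integrate the scaled Young inequality with \<open>s\<close> chosen such that
  \<open>s powr q\<close> is the mean of the q-th power of \<open>f\<close>; both summands then
  combine to \<open>s * vol\<close>. A vanishing integral is treated separately, since
  \<open>s\<close> must be positive.\<close>

lemma Lr_hoelder:
  assumes f: "f \<in> Lr q K" and q: "1 < q" and one: "integrable (lebesgue_on K) (\<lambda>x. 1 :: real)"
    and vol: "vol = integral\<^sup>L (lebesgue_on K) (\<lambda>x. 1)" "0 < vol"
  shows "integral\<^sup>L (lebesgue_on K) (\<lambda>x. \<bar>f x\<bar>) \<le> vol powr (1 - 1 / q) * Lr_norm q K f"
proof -
  note int = Lr_integrable[OF f q one]
  define A where "A = integral\<^sup>L (lebesgue_on K) (\<lambda>x. \<bar>f x\<bar> powr q)"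
  have intq: "integrable (lebesgue_on K) (\<lambda>x. \<bar>f x\<bar> powr q)" using f by (simp add: Lr_def)
  have A0: "0 \<le> A" by (simp add: A_def)
  show ?thesis
  proof (cases "A = 0")
    case True
    then have "AE x in lebesgue_on K. \<bar>f x\<bar> powr q = 0"
      using integral_nonneg_eq_0_iff_AE[OF intq] by (simp add: A_def)
    then have "AE x in lebesgue_on K. \<bar>f x\<bar> = 0" by (rule eventually_mono) simp
    then have "integral\<^sup>L (lebesgue_on K) (\<lambda>x. \<bar>f x\<bar>) = 0" by (rule integral_eq_zero_AE)
    then show ?thesis by (simp add: Lr_norm_def)
  next
    case False
    then have A: "0 < A" using A0 by simp
    define s where "s = (A / vol) powr (1 / q)"
    have s: "0 < s" using A vol(2) by (simp add: s_def)
    have sq: "s powr q = A / vol" using A vol(2) q by (simp add: s_def powr_powr)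
    have "integral\<^sup>L (lebesgue_on K) (\<lambda>x. \<bar>f x\<bar>)
        \<le> integral\<^sup>L (lebesgue_on K) (\<lambda>x. s * (\<bar>f x\<bar> powr q / s powr q / q + (1 - 1 / q) * 1))"
    proof (rule integral_mono)
      show "integrable (lebesgue_on K) (\<lambda>x. \<bar>f x\<bar>)" using int by simp
      show "integrable (lebesgue_on K) (\<lambda>x. s * (\<bar>f x\<bar> powr q / s powr q / q + (1 - 1 / q) * 1))"
        using intq one by (intro Bochner_Integration.integrable_add integrable_divide integrable_mult_right)
      show "\<bar>f x\<bar> \<le> s * (\<bar>f x\<bar> powr q / s powr q / q + (1 - 1 / q) * 1)" for x
        using abs_le_power_sum[OF q _ s, of "\<bar>f x\<bar>"] by simp
    qed
    also have "\<dots> = s * (A / s powr q / q + (1 - 1 / q) * vol)"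
    proof -
      have "integral\<^sup>L (lebesgue_on K) (\<lambda>x. \<bar>f x\<bar> powr q / s powr q / q + (1 - 1 / q) * 1)
          = integral\<^sup>L (lebesgue_on K) (\<lambda>x. \<bar>f x\<bar> powr q / s powr q / q) + integral\<^sup>L (lebesgue_on K) (\<lambda>x. (1 - 1 / q) * 1)"
        using intq one by (intro Bochner_Integration.integral_add integrable_divide integrable_mult_right)
      also have "integral\<^sup>L (lebesgue_on K) (\<lambda>x. (1 - 1 / q) * 1) = (1 - 1 / q) * vol"
        unfolding vol(1) by (rule integral_mult_right_zero)
      also have "integral\<^sup>L (lebesgue_on K) (\<lambda>x. \<bar>f x\<bar> powr q / s powr q / q) = A / s powr q / q"
        by (simp add: A_def)
      finally show ?thesis by (simp only: integral_mult_right_zero)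
    qed
    also have "\<dots> = s * vol" unfolding sq using A vol(2) q by (simp add: field_simps)
    also have "\<dots> = vol powr (1 - 1 / q) * A powr (1 / q)"
      using A vol(2) by (simp add: s_def powr_divide powr_diff)
    finally show ?thesis by (simp add: Lr_norm_def A_def)
  qed
qed

lemma Lr_norm_le_sup:
  assumes f: "f \<in> borel_measurable (lebesgue_on K)" and R: "\<And>x. x \<in> K \<Longrightarrow> \<bar>f x\<bar> \<le> R" "0 \<le> R"
    and q: "0 < q" and one: "integrable (lebesgue_on K) (\<lambda>x. 1 :: real)"
    and vol: "vol = integral\<^sup>L (lebesgue_on K) (\<lambda>x. 1)" "0 < vol"
  shows "Lr_norm q K f \<le> vol powr (1 / q) * R"
proof -
  have le: "\<bar>f x\<bar> powr q \<le> R powr q" if "x \<in> K" for x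
    using R(1)[OF that] q by (intro powr_mono2) auto
  have i1: "integrable (lebesgue_on K) (\<lambda>x. R powr q * 1)" using one by (rule integrable_mult_right)
  have i2: "integrable (lebesgue_on K) (\<lambda>x. \<bar>f x\<bar> powr q)"
  proof (rule Bochner_Integration.integrable_bound[OF i1])
    show "(\<lambda>x. \<bar>f x\<bar> powr q) \<in> borel_measurable (lebesgue_on K)" using f by measurable
    show "AE x in lebesgue_on K. norm (\<bar>f x\<bar> powr q) \<le> norm (R powr q * 1)"
      using le by (intro AE_I2) simp
  qed
  have "integral\<^sup>L (lebesgue_on K) (\<lambda>x. \<bar>f x\<bar> powr q) \<le> integral\<^sup>L (lebesgue_on K) (\<lambda>x. R powr q * 1)"
    using le by (intro integral_mono i1 i2) simp
  also have "\<dots> = R powr q * vol" unfolding vol(1) by (rule integral_mult_right_zero)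
  finally have "Lr_norm q K f \<le> (R powr q * vol) powr (1 / q)"
    unfolding Lr_norm_def using q by (intro powr_mono2) auto
  also have "\<dots> = vol powr (1 / q) * R"
    using R(2) vol(2) q by (simp add: powr_mult powr_powr)
  finally show ?thesis .
qed

section \<open>Coercivity and inverse estimates on a fixed simplex\<close>

lemma Pol_perp_Pol: "r \<in> Pol_perp j K \<Longrightarrow> r \<in> Pol j"
  by (simp add: Pol_perp_def)

context barycentric
begin

lemma pairing_K: "pairing K f g = I (\<lambda>x. f x * g x)"
  by (simp add: pairing_def I_def)

lemma weighted_form_pos_def:
  assumes w: "rpoly w" and nn: "\<And>x. x \<in> K \<Longrightarrow> 0 \<le> w x" and pos: "\<And>x. x \<in> K_int \<Longrightarrow> 0 < w x"
  shows "pos_def_form (Pol j) (\<lambda>f g. I (\<lambda>x. w x * (f x * g x)))"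
proof
  show "(\<lambda>x. 0) \<in> Pol j" by (rule Pol_zero)
  show "\<exists>B. finite B \<and> Pol j \<subseteq> fun_vs.span B" by (rule Pol_finite_dim)
  fix f g h :: "real ^ 'n \<Rightarrow> real" and c :: real
  assume f: "f \<in> Pol j"
  note pf = Pol_rpoly[OF f]
  show "(\<lambda>x. c * f x) \<in> Pol j" by (rule Pol_scale[OF f])
  { assume "f \<noteq> (\<lambda>x. 0)"
    moreover have "0 \<le> I (\<lambda>x. w x * (f x * f x))"
      by (intro I_nonneg mult_nonneg_nonneg nn zero_le_square)
    moreover have "f = (\<lambda>x. 0)" if "I (\<lambda>x. w x * (f x * f x)) = 0"
      using weighted_square_zero[OF pf w nn pos that] by (rule ext)
    ultimately show "0 < I (\<lambda>x. w x * (f x * f x))" by force }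
  { assume h: "h \<in> Pol j"
    show "I (\<lambda>x. w x * (h x * (c * f x))) = c * I (\<lambda>x. w x * (h x * f x))"
      unfolding I_scale[symmetric] by (simp only: mult.left_commute) }
  assume g: "g \<in> Pol j"
  note pg = Pol_rpoly[OF g]
  show "(\<lambda>x. f x + g x) \<in> Pol j" by (rule Pol_add[OF f g])
  show "I (\<lambda>x. w x * (f x * g x)) = I (\<lambda>x. w x * (g x * f x))" by (simp only: mult.commute)
  assume h: "h \<in> Pol j"
  note ph = Pol_rpoly[OF h]
  have "rpoly (\<lambda>x. w x * (h x * f x))" "rpoly (\<lambda>x. w x * (h x * g x))"
    by (intro rpoly_intros w ph pf pg)+
  from I_add[OF this] show "I (\<lambda>x. w x * (h x * (f x + g x))) = I (\<lambda>x. w x * (h x * f x)) + I (\<lambda>x. w x * (h x * g x))"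
    by (simp only: distrib_left)
qed

lemma polynomial_bounded': "f \<in> Pol j \<Longrightarrow> \<exists>B. \<forall>x\<in>K. \<bar>f x\<bar> \<le> B"
  using polynomial_bounded[OF Pol_rpoly] by blast

lemma bub_form_bound:
  "\<exists>C>0. \<forall>f\<in>Pol j. \<forall>x\<in>K. (f x)\<^sup>2 \<le> C * I (\<lambda>x. bub x * (f x * f x))"
proof -
  interpret pos_def_form "Pol j" "\<lambda>f g. I (\<lambda>x. bub x * (f x * g x))"
    by (rule weighted_form_pos_def[OF bub_polynomial bub_nonneg bub_pos])
  show ?thesis by (rule operator_bound[of K "\<lambda>f. f"]) (simp_all add: polynomial_bounded')
qed

text \<open>Norm equivalence is applied to each partial derivative, with the unweighted square
  integral as form; that integral is at most the square of the supremum times the volume. The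
  constant depends on the simplex, so the estimate is invoked on the reference simplex only.\<close>

lemma derivative_bound:
  "\<exists>C>0. \<forall>f\<in>Pol j. \<forall>d R. (\<forall>x\<in>K. \<bar>f x\<bar> \<le> R) \<longrightarrow>
     (\<forall>x\<in>K. \<bar>frechet_derivative f (at x) d\<bar> \<le> C * norm d * R)"
proof -
  interpret pos_def_form "Pol j" "\<lambda>f g. I (\<lambda>x. 1 * (f x * g x))"
    by (rule weighted_form_pos_def) (simp_all add: rpoly_intros)
  have "\<exists>C>0. \<forall>f\<in>Pol j. \<forall>x\<in>K. (frechet_derivative f (at x) (axis i 1))\<^sup>2 \<le> C * I (\<lambda>x. 1 * (f x * f x))" for i
  proof (rule operator_bound[of K "\<lambda>f x. frechet_derivative f (at x) (axis i 1)"])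
    fix f :: "real ^ 'n \<Rightarrow> real" assume f: "f \<in> Pol j"
    note pf = Pol_rpoly[OF f]
    show "\<exists>B. \<forall>x\<in>K. \<bar>frechet_derivative f (at x) (axis i 1)\<bar> \<le> B"
      using polynomial_bounded[OF rpoly_frechet_derivative[OF pf]] by blast
    show "frechet_derivative (\<lambda>x. c * f x) (at x) (axis i 1) = c * frechet_derivative f (at x) (axis i 1)" for c x
      using frechet_derivative_mult[of "\<lambda>_. c" x f "axis i 1"] pf
      by (simp add: rpoly_differentiable frechet_derivative_const)
    fix g :: "real ^ 'n \<Rightarrow> real" and x assume g: "g \<in> Pol j"
    show "frechet_derivative (\<lambda>x. f x + g x) (at x) (axis i 1)
      = frechet_derivative f (at x) (axis i 1) + frechet_derivative g (at x) (axis i 1)"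
      using pf Pol_rpoly[OF g]
      by (simp add: frechet_derivative_add rpoly_differentiable)
  qed
  then obtain C where C: "\<And>i. 0 < C i"
    "\<And>i f x. f \<in> Pol j \<Longrightarrow> x \<in> K \<Longrightarrow> (frechet_derivative f (at x) (axis i 1))\<^sup>2 \<le> C i * I (\<lambda>x. 1 * (f x * f x))"
    by metis
  define D where "D = (\<Sum>i\<in>UNIV. sqrt (C i * I (\<lambda>x. 1)))"
  have "0 < D" unfolding D_def using C(1) I_one_pos by (intro sum_pos) auto
  moreover have "\<bar>frechet_derivative f (at x) d\<bar> \<le> D * norm d * R"
    if f: "f \<in> Pol j" and R: "\<forall>x\<in>K. \<bar>f x\<bar> \<le> R" and x: "x \<in> K" for f d R x
  proof -
    have R0: "0 \<le> R" using R vertex_in_K[of None] abs_ge_zero order_trans by blast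
    note pf = Pol_rpoly[OF f]
    have IR: "I (\<lambda>x. 1 * (f x * f x)) \<le> R\<^sup>2 * I (\<lambda>x. 1)"
      unfolding I_scale[symmetric]
    proof (rule I_mono)
      show "1 * (f x * f x) \<le> R\<^sup>2 * 1" if "x \<in> K" for x
        using R that abs_le_square_iff[of "f x" R] R0 by (simp add: power2_eq_square)
    qed (intro rpoly_intros pf)+
    have Di: "\<bar>frechet_derivative f (at x) (axis i 1)\<bar> \<le> sqrt (C i * I (\<lambda>x. 1)) * R" for i
    proof -
      have "(frechet_derivative f (at x) (axis i 1))\<^sup>2 \<le> C i * I (\<lambda>x. 1 * (f x * f x))" by (rule C(2)[OF f x])
      also have "\<dots> \<le> C i * (R\<^sup>2 * I (\<lambda>x. 1))" using IR C(1)[of i] by (intro mult_left_mono) auto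
      also have "\<dots> = C i * I (\<lambda>x. 1) * R\<^sup>2" by (simp only: mult_ac)
      finally have "sqrt ((frechet_derivative f (at x) (axis i 1))\<^sup>2) \<le> sqrt (C i * I (\<lambda>x. 1) * R\<^sup>2)"
        by (rule real_sqrt_le_mono)
      then show ?thesis using R0 by (simp add: real_sqrt_mult)
    qed
    have "\<bar>frechet_derivative f (at x) d\<bar> = \<bar>\<Sum>i\<in>UNIV. d $ i * frechet_derivative f (at x) (axis i 1)\<bar>"
      using frechet_derivative_eq_sum[OF rpoly_differentiable[OF pf], of x d] by simp
    also have "\<dots> \<le> (\<Sum>i\<in>UNIV. \<bar>d $ i * frechet_derivative f (at x) (axis i 1)\<bar>)" by (rule sum_abs)
    also have "\<dots> \<le> (\<Sum>i\<in>UNIV. norm d * (sqrt (C i * I (\<lambda>x. 1)) * R))"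
      unfolding abs_mult by (intro sum_mono mult_mono Di component_le_norm_cart) auto
    also have "\<dots> = D * norm d * R" by (simp add: D_def sum_distrib_left sum_distrib_right mult_ac)
    finally show ?thesis .
  qed
  ultimately show ?thesis by blast
qed

text \<open>The subspace \<open>S\<close> and the facets \<open>A\<close> are left open for two
  uses: the orthogonal complement with all facets, and affine functions with just two.\<close>

lemma facet_sum_form:
  assumes S: "S \<subseteq> Pol (int k)" "(\<lambda>x. 0) \<in> S" "\<And>f g. f \<in> S \<Longrightarrow> g \<in> S \<Longrightarrow> (\<lambda>x. f x + g x) \<in> S"
      "\<And>c f. f \<in> S \<Longrightarrow> (\<lambda>x. c * f x) \<in> S"
    and c: "\<And>i. i \<in> A \<Longrightarrow> 0 < c i"
    and definite: "\<And>r. r \<in> S \<Longrightarrow> (\<And>i x. i \<in> A \<Longrightarrow> x \<in> K \<Longrightarrow> lam i x = 0 \<Longrightarrow> r x = 0) \<Longrightarrow> r = (\<lambda>x. 0)"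
  shows "pos_def_form S (\<lambda>f g. \<Sum>i\<in>A. c i * facet_form i f g)"
proof
  have SP: "rpoly f" if "f \<in> S" for f
    using that S(1) Pol_rpoly by blast
  show "(\<lambda>x. 0) \<in> S" by (rule S(2))
  show "\<exists>B. finite B \<and> S \<subseteq> fun_vs.span B" using Pol_finite_dim[of "int k"] S(1) by blast
  fix f g h :: "real ^ 'n \<Rightarrow> real" and t :: real
  assume f: "f \<in> S"
  show "(\<lambda>x. t * f x) \<in> S" by (rule S(4)[OF f])
  { assume nz: "f \<noteq> (\<lambda>x. 0)"
    have nn: "0 \<le> facet_form i f f" for i using f S(1) by (intro facet_form_nonneg) blast
    have "\<exists>i\<in>A. facet_form i f f \<noteq> 0"
    proof (rule ccontr)
      assume "\<not> (\<exists>i\<in>A. facet_form i f f \<noteq> 0)"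
      then have "f = (\<lambda>x. 0)"
        using f S(1) by (intro definite) (auto intro: facet_form_eq_0)
      then show False using nz by blast
    qed
    then obtain i where i: "i \<in> A" "facet_form i f f \<noteq> 0" by blast
    have "0 < c i * facet_form i f f" using nn[of i] i c by (simp add: order_less_le)
    then show "0 < (\<Sum>i\<in>A. c i * facet_form i f f)"
      using i c nn by (intro sum_pos2[of A i]) (auto simp: less_imp_le) }
  { assume h: "h \<in> S"
    show "(\<Sum>i\<in>A. c i * facet_form i h (\<lambda>x. t * f x)) = t * (\<Sum>i\<in>A. c i * facet_form i h f)"
      by (simp add: facet_form_scale[OF SP[OF f] SP[OF h]] sum_distrib_left mult.left_commute) }
  assume g: "g \<in> S"
  show "(\<lambda>x. f x + g x) \<in> S" by (rule S(3)[OF f g])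
  show "(\<Sum>i\<in>A. c i * facet_form i f g) = (\<Sum>i\<in>A. c i * facet_form i g f)" by (simp only: facet_form_sym)
  assume h: "h \<in> S"
  show "(\<Sum>i\<in>A. c i * facet_form i h (\<lambda>x. f x + g x)) = (\<Sum>i\<in>A. c i * facet_form i h f) + (\<Sum>i\<in>A. c i * facet_form i h g)"
    by (simp add: facet_form_add[OF SP[OF f] SP[OF g] SP[OF h]] sum.distrib distrib_left)
qed

lemma Pol_perp_zero: "(\<lambda>x. 0) \<in> Pol_perp j K"
  by (simp add: Pol_perp_def Pol_zero pairing_def)

lemma Pol_perp_scale: "f \<in> Pol_perp j K \<Longrightarrow> (\<lambda>x. c * f x) \<in> Pol_perp j K"
  by (simp add: Pol_perp_def Pol_scale pairing_K mult.assoc I_scale)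

lemma Pol_perp_add: "f \<in> Pol_perp j K \<Longrightarrow> g \<in> Pol_perp j K \<Longrightarrow> (\<lambda>x. f x + g x) \<in> Pol_perp j K"
proof -
  assume f: "f \<in> Pol_perp j K" and g: "g \<in> Pol_perp j K"
  have "pairing K (\<lambda>x. f x + g x) z = 0" if z: "z \<in> Pol0 j K" for z
  proof -
    have pz: "rpoly z" using z Pol_rpoly by (auto simp: Pol0_def)
    have "I (\<lambda>x. f x * z x + g x * z x) = I (\<lambda>x. f x * z x) + I (\<lambda>x. g x * z x)"
      by (intro I_add rpoly_intros pz Pol_rpoly[OF Pol_perp_Pol[OF f]]
          Pol_rpoly[OF Pol_perp_Pol[OF g]])
    then show ?thesis using f g z by (simp add: pairing_K Pol_perp_def distrib_right)
  qed
  then show ?thesis using Pol_add[OF Pol_perp_Pol[OF f] Pol_perp_Pol[OF g]] by (simp add: Pol_perp_def)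
qed

text \<open>Zero boundary values put \<open>r\<close> into \<open>Pol0\<close>, to which it is
  orthogonal, so \<open>r\<close> is orthogonal to itself. This is the reason for the orthogonal
  complement in the test space.\<close>

lemma Pol_perp_definite:
  assumes r: "r \<in> Pol_perp j K" and z: "\<And>i x. x \<in> K \<Longrightarrow> lam i x = 0 \<Longrightarrow> r x = 0"
  shows "r = (\<lambda>x. 0)"
proof -
  have "r \<in> Pol0 j K" using r z frontier_K by (auto simp: Pol0_def Pol_perp_def)
  then have "I (\<lambda>x. 1 * (r x * r x)) = 0" using r by (simp add: Pol_perp_def pairing_K)
  from weighted_square_zero[OF Pol_rpoly[OF Pol_perp_Pol[OF r]] _ _ _ this]
  show ?thesis by (intro ext) (simp add: rpoly_intros)
qed

lemma Pol_1_affine: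
  assumes "f \<in> Pol 1" shows "f x = (\<Sum>l\<in>UNIV. lam l x * f (a l))"
  using assms
proof (induction rule: Pol_induct)
  case zero
  show ?case by simp
next
  case (add f g)
  then show ?case by (simp add: distrib_left sum.distrib)
next
  case (scale c f)
  then show ?case by (simp add: sum_distrib_left mult.left_commute)
next
  case (monomial \<alpha>)
  show ?case
  proof (cases "\<exists>i. \<alpha> i > 0")
    case False
    then have "monomial \<alpha> = (\<lambda>x. 1)" by (simp add: monomial_def fun_eq_iff)
    then show ?thesis by (simp add: lam_sum)
  next
    case True
    then obtain i where i: "\<alpha> i > 0" by blast
    have "(\<Sum>l\<in>UNIV. \<alpha> l) = \<alpha> i + (\<Sum>l\<in>UNIV - {i}. \<alpha> l)" by (intro sum.remove) simp_all
    moreover have "(\<Sum>l\<in>UNIV. \<alpha> l) \<le> 1" using monomial by (simp only: of_nat_le_1_iff)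
    ultimately have "\<alpha> i = 1" "(\<Sum>l\<in>UNIV - {i}. \<alpha> l) = 0" using i by linarith+
    then have \<alpha>: "\<alpha> l = (if l = i then 1 else 0)" for l by (cases "l = i") auto
    have "monomial \<alpha> x = x $ i" for x
      unfolding monomial_def \<alpha> by (simp add: if_distrib[of "\<lambda>e. _ ^ e"] prod.delta cong: if_cong)
    moreover have "x $ i = (\<Sum>l\<in>UNIV. lam l x * a l $ i)"
      using arg_cong[OF lam_comb[of x], of "\<lambda>v. v $ i"] by simp
    ultimately show ?thesis by simp
  qed
qed

text \<open>Every vertex lies on at least one of two distinct facets, and an affine function is
  determined by its values at the vertices.\<close>

lemma Pol_1_definite:
  assumes r: "r \<in> Pol 1" and ij: "i \<noteq> j"
    and z: "\<And>m x. m \<in> {i, j} \<Longrightarrow> x \<in> K \<Longrightarrow> lam m x = 0 \<Longrightarrow> r x = 0"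
  shows "r = (\<lambda>x. 0)"
proof -
  have v: "r (a l) = 0" for l
    using z[of i "a l"] z[of j "a l"] ij vertex_in_K[of l] by (cases "l = i") (simp_all add: lam_vertex)
  show ?thesis by (rule ext, subst Pol_1_affine[OF r]) (simp add: v)
qed

lemma facet_coercive:
  "\<exists>C>0. \<forall>r\<in>Pol_perp (int k) K. \<forall>x\<in>K. (r x)\<^sup>2 \<le> C * (\<Sum>i\<in>UNIV. facet_form i r r)"
proof -
  interpret pos_def_form "Pol_perp (int k) K" "\<lambda>f g. \<Sum>i\<in>UNIV. 1 * facet_form i f g"
  proof (rule facet_sum_form[where k = k])
    show "Pol_perp (int k) K \<subseteq> Pol (int k)" by (rule subsetI, rule Pol_perp_Pol)
    show "r = (\<lambda>x. 0)" if "r \<in> Pol_perp (int k) K" "\<And>i x. i \<in> UNIV \<Longrightarrow> x \<in> K \<Longrightarrow> lam i x = 0 \<Longrightarrow> r x = 0" for r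
      by (rule Pol_perp_definite[OF that(1)]) (rule that(2)[OF UNIV_I])
  qed (rule Pol_perp_zero Pol_perp_add Pol_perp_scale zero_less_one | assumption)+
  have "\<exists>C>0. \<forall>r\<in>Pol_perp (int k) K. \<forall>x\<in>K. (r x)\<^sup>2 \<le> C * (\<Sum>i\<in>UNIV. 1 * facet_form i r r)"
    by (rule operator_bound[of K "\<lambda>f. f"]) (simp_all add: polynomial_bounded'[OF Pol_perp_Pol])
  then show ?thesis by simp
qed

lemma facet_coercive_pair:
  assumes "i \<noteq> j"
  shows "\<exists>C>0. \<forall>r\<in>Pol 1. \<forall>x\<in>K. (r x)\<^sup>2 \<le> C * (facet_form i r r + facet_form j r r)"
proof -
  interpret pos_def_form "Pol 1" "\<lambda>f g. \<Sum>m\<in>{i, j}. 1 * facet_form m f g"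
  proof (rule facet_sum_form[where k = 1])
    show "Pol 1 \<subseteq> Pol (int 1)" by simp
    show "r = (\<lambda>x. 0)" if "r \<in> Pol 1" "\<And>m x. m \<in> {i, j} \<Longrightarrow> x \<in> K \<Longrightarrow> lam m x = 0 \<Longrightarrow> r x = 0" for r
      by (rule Pol_1_definite[OF that(1) assms that(2)])
  qed (rule Pol_zero Pol_add Pol_scale zero_less_one | assumption)+
  have "\<exists>C>0. \<forall>r\<in>Pol 1. \<forall>x\<in>K. (r x)\<^sup>2 \<le> C * (\<Sum>m\<in>{i, j}. 1 * facet_form m r r)"
    by (rule operator_bound[of K "\<lambda>f. f"]) (simp_all add: polynomial_bounded')
  then show ?thesis using assms by simp
qed

end

text \<open>Since the derivatives of the barycentric coordinates along \<open>\<beta>\<close> sum up to zero, two of them are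
  comparable to \<open>\<beta>\<close>; an affine function vanishing on two facets is zero.\<close>

lemma ref_facet_coercive_1:
  "\<exists>C>0. \<forall>r\<in>Pol 1. \<forall>\<beta> :: real ^ 'n. \<forall>x\<in>ref_simplex.
     (r x)\<^sup>2 * norm \<beta> \<le> C * (\<Sum>i\<in>UNIV. \<bar>ref_dl i \<beta>\<bar> * ref.facet_form i r r)"
proof -
  \<comment> \<open>On the diagonal the constant is just a positive default, so that all of them can
    be summed below.\<close>
  have "\<exists>C>0. i \<noteq> j \<longrightarrow> (\<forall>r\<in>Pol 1. \<forall>x\<in>ref.K. (r x)\<^sup>2 \<le> C * (ref.facet_form i r r + ref.facet_form j r r))"
    for i j :: "'n option"
    using ref.facet_coercive_pair[of i j] by (cases "i = j") (auto intro: exI[of _ 1])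
  then obtain C where C: "\<And>i j. 0 < C i j"
    "\<And>i j r x. i \<noteq> j \<Longrightarrow> r \<in> Pol 1 \<Longrightarrow> x \<in> ref.K \<Longrightarrow> (r x)\<^sup>2 \<le> C i j * (ref.facet_form i r r + ref.facet_form j r (r :: real ^ 'n \<Rightarrow> real))"
    by metis
  define N where "N = real CARD('n)"
  have N: "1 \<le> N" using zero_less_card_finite[where 'a = 'n] by (simp add: N_def)
  define D where "D = (\<Sum>i\<in>UNIV. \<Sum>j\<in>UNIV. C i j)"
  have CD: "C i j \<le> D" for i j
  proof -
    have "C i j \<le> (\<Sum>j\<in>UNIV. C i j)" using C(1) by (intro member_le_sum) (auto simp: less_imp_le)
    also have "\<dots> \<le> D" unfolding D_def
      using C(1) by (intro member_le_sum[of i UNIV "\<lambda>i. \<Sum>j\<in>UNIV. C i j"]) (auto intro!: sum_nonneg simp: less_imp_le)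
    finally show ?thesis .
  qed
  have D: "0 < D" using C(1) CD less_le_trans by blast
  have "(r x)\<^sup>2 * norm \<beta> \<le> (D * N\<^sup>2) * (\<Sum>i\<in>UNIV. \<bar>ref_dl i \<beta>\<bar> * ref.facet_form i r r)"
    if r: "r \<in> Pol 1" and x: "x \<in> ref.K" for r x and \<beta> :: "real ^ 'n"
  proof -
    have Q: "0 \<le> ref.facet_form i r r" for i using ref.facet_form_nonneg[of r 1] r by simp
    have fin: "finite (range (\<lambda>l. \<bar>ref_dl l \<beta>\<bar>))" by simp
    have "Max (range (\<lambda>l. \<bar>ref_dl l \<beta>\<bar>)) \<in> range (\<lambda>l. \<bar>ref_dl l \<beta>\<bar>)" by (intro Max_in fin) simp
    then obtain i where "Max (range (\<lambda>l. \<bar>ref_dl l \<beta>\<bar>)) = \<bar>ref_dl i \<beta>\<bar>" by blast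
    then have i: "\<bar>ref_dl l \<beta>\<bar> \<le> \<bar>ref_dl i \<beta>\<bar>" for l using Max_ge[OF fin, of "\<bar>ref_dl l \<beta>\<bar>"] by auto
    define m where "m = \<bar>ref_dl i \<beta>\<bar>"
    have m0: "0 \<le> m" by (simp add: m_def)
    have nb: "norm \<beta> \<le> N * m"
    proof -
      have "norm \<beta> \<le> (\<Sum>j\<in>UNIV. \<bar>\<beta> $ j\<bar>)" by (rule norm_le_l1_cart)
      also have "\<dots> \<le> (\<Sum>j\<in>(UNIV::'n set). m)"
        using i[of "Some _"] by (intro sum_mono) (simp add: m_def ref_dl_def)
      finally show ?thesis by (simp add: N_def)
    qed
    \<comment> \<open>If each of the other N differentials were smaller than \<open>m / N\<close> in
      modulus, they could not cancel the largest one, although all of them sum to zero.\<close>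
    have "\<exists>j. j \<noteq> i \<and> m \<le> N * \<bar>ref_dl j \<beta>\<bar>"
    proof (rule ccontr)
      assume neg: "\<not> (\<exists>j. j \<noteq> i \<and> m \<le> N * \<bar>ref_dl j \<beta>\<bar>)"
      have "ref_dl i \<beta> = - (\<Sum>l\<in>UNIV - {i}. ref_dl l \<beta>)"
        using ref.dl_sum[of \<beta>] sum.remove[of UNIV i "\<lambda>l. ref_dl l \<beta>"] by simp
      then have "N * m = N * \<bar>\<Sum>l\<in>UNIV - {i}. ref_dl l \<beta>\<bar>" unfolding m_def by simp
      also have "\<dots> \<le> N * (\<Sum>l\<in>UNIV - {i}. \<bar>ref_dl l \<beta>\<bar>)" using N by (intro mult_left_mono sum_abs) auto
      also have "\<dots> = (\<Sum>l\<in>UNIV - {i}. N * \<bar>ref_dl l \<beta>\<bar>)" by (rule sum_distrib_left)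
      also have "\<dots> < (\<Sum>l\<in>UNIV - {i}. m)"
        using neg ref.exists_other[of i] by (intro sum_strict_mono) (auto simp: not_le)
      also have "\<dots> = N * m" by (simp add: N_def card_Diff_subset)
      finally show False by simp
    qed
    then obtain j where j: "j \<noteq> i" "m \<le> N * \<bar>ref_dl j \<beta>\<bar>" by blast
    let ?E = "\<Sum>i\<in>UNIV. \<bar>ref_dl i \<beta>\<bar> * ref.facet_form i r r"
    have pair: "\<bar>ref_dl i \<beta>\<bar> * ref.facet_form i r r + \<bar>ref_dl j \<beta>\<bar> * ref.facet_form j r r \<le> ?E"
    proof -
      have "(\<Sum>l\<in>{i, j}. \<bar>ref_dl l \<beta>\<bar> * ref.facet_form l r r) \<le> ?E"
        using Q by (intro sum_mono2) auto
      then show ?thesis using j(1) by simp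
    qed
    have "m * (ref.facet_form i r r + ref.facet_form j r r) \<le> N * ?E"
    proof -
      have "m * ref.facet_form i r r \<le> N * (m * ref.facet_form i r r)"
        using mult_right_mono[OF N, of "m * ref.facet_form i r r"] m0 Q by simp
      moreover have "m * ref.facet_form j r r \<le> N * \<bar>ref_dl j \<beta>\<bar> * ref.facet_form j r r"
        by (intro mult_right_mono j Q)
      moreover have "N * (\<bar>ref_dl i \<beta>\<bar> * ref.facet_form i r r + \<bar>ref_dl j \<beta>\<bar> * ref.facet_form j r r) \<le> N * ?E"
        using N pair by (intro mult_left_mono) auto
      ultimately show ?thesis by (simp add: m_def algebra_simps)
    qed
    then have mE: "m * (ref.facet_form i r r + ref.facet_form j r r) * N \<le> N * ?E * N"
      using N by (intro mult_right_mono) auto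
    have "(r x)\<^sup>2 * norm \<beta> \<le> (D * (ref.facet_form i r r + ref.facet_form j r r)) * (N * m)"
    proof (intro mult_mono nb)
      have "(r x)\<^sup>2 \<le> C i j * (ref.facet_form i r r + ref.facet_form j r r)" using j(1) by (intro C(2) r x) auto
      also have "\<dots> \<le> D * (ref.facet_form i r r + ref.facet_form j r r)" using Q by (intro mult_right_mono CD) simp
      finally show "(r x)\<^sup>2 \<le> D * (ref.facet_form i r r + ref.facet_form j r r)" .
    qed (use D Q in auto)
    also have "\<dots> = D * (m * (ref.facet_form i r r + ref.facet_form j r r) * N)" by (simp add: mult_ac)
    also have "\<dots> \<le> D * (N * ?E * N)" using D by (intro mult_left_mono mE) auto
    also have "\<dots> = (D * N\<^sup>2) * ?E" by (simp add: power2_eq_square mult_ac)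
    finally show ?thesis .
  qed
  moreover have "0 < D * N\<^sup>2" using D N by simp
  ultimately show ?thesis unfolding ref_K by blast
qed

section \<open>A single element\<close>

lemma norm_ref_simplex:
  assumes "x \<in> ref_simplex" shows "norm x \<le> 1"
proof -
  have x: "\<And>i. 0 \<le> ref_lam i x" using assms unfolding ref_K[symmetric] ref.K_def by simp
  have "norm x \<le> (\<Sum>j\<in>UNIV. \<bar>x $ j\<bar>)" by (rule norm_le_l1_cart)
  also have "\<dots> = (\<Sum>j\<in>UNIV. x $ j)" using x[of "Some _"] by (simp add: ref_lam_def)
  also have "\<dots> \<le> 1" using x[of None] by (simp add: ref_lam_def)
  finally show ?thesis .
qed

lemma mat_norm_bound: "norm (A *v x) \<le> mat_norm A * norm x"
  unfolding mat_norm_def by (rule onorm) (rule matrix_vector_mul_bounded_linear)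

text \<open>The constants are parameters, so every bound below is visibly uniform over elements.
  \<open>coercive\<close> is the common form of the two alternatives on degree and fluxes: the
  polynomial lives on the reference simplex, the fluxes are those of the element. The degree in
  \<open>deriv_bound\<close> covers both \<open>r\<close> and the projected function.\<close>

locale element =
  fixes M :: "real ^ 'n ^ 'n" and g \<beta> :: "real ^ 'n" and k :: nat and \<kappa> Cc Cb Cd :: real and El :: "(real ^ 'n) set"
  assumes invertible_M: "invertible M" and \<beta>_nonzero: "\<beta> \<noteq> 0"
    and El_def: "El = affine_map M g ` ref_simplex"
    and shape: "mat_norm M * mat_norm (matrix_inv M) \<le> \<kappa>"
    and constants: "0 < Cc" "0 < Cb" "0 < Cd" "0 < \<kappa>"
    and coercive: "\<And>r x. r \<in> Pol_perp (int k) ref_simplex \<Longrightarrow> x \<in> ref_simplex \<Longrightarrow>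
        (r x)\<^sup>2 * (norm \<beta> / diameter El) \<le> Cc * (\<Sum>i\<in>UNIV. \<bar>aff_dl M i \<beta>\<bar> * ref.facet_form i r r)"
    and bubble_bound: "\<And>(f :: real ^ 'n \<Rightarrow> real) x. f \<in> Pol (int k - 2) \<Longrightarrow> x \<in> ref_simplex \<Longrightarrow>
        (f x)\<^sup>2 \<le> Cb * ref.I (\<lambda>x. ref.bub x * (f x * f x))"
    and deriv_bound: "\<And>(f :: real ^ 'n \<Rightarrow> real) d R x. f \<in> Pol (int k + int CARD('n) + 1) \<Longrightarrow> (\<And>x. x \<in> ref_simplex \<Longrightarrow> \<bar>f x\<bar> \<le> R) \<Longrightarrow>
        x \<in> ref_simplex \<Longrightarrow> \<bar>frechet_derivative f (at x) d\<bar> \<le> Cd * norm d * R"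
begin

sublocale A: barycentric "vertices M g" "aff_lam M g" "aff_dl M"
  by (rule barycentric_affine[OF invertible_M])

lemma El_K: "El = A.K"
  unfolding El_def by (rule affine_K[OF invertible_M, symmetric])

abbreviation vol where "vol \<equiv> A.I (\<lambda>x. 1)"

lemma vol_pos: "0 < vol"
  by (rule A.I_one_pos)

lemma ref_vol_pos: "0 < ref.I (\<lambda>x::real^'n. 1)"
  by (rule ref.I_one_pos)

section \<open>Transport to the reference simplex and scaled estimates\<close>

definition hat :: "(real ^ 'n \<Rightarrow> real) \<Rightarrow> real ^ 'n \<Rightarrow> real" where
  "hat f x = f (affine_map M g x)"

lemmas pull_affine = pull_affine_map[OF invertible_M, of g]
  and affine_pull = affine_map_pull[OF invertible_M, of g]

lemma hat_pull: "hat f (pull M g x) = f x"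
  by (simp add: hat_def affine_pull)

lemma hat_comp_pull: "hat (\<lambda>x. f (pull M g x)) = f"
  by (simp add: hat_def pull_affine fun_eq_iff)

lemma Pol_hat: "f \<in> Pol j \<Longrightarrow> hat f \<in> Pol j"
  unfolding hat_def[abs_def]
proof (rule Pol_compose)
  fix i
  have "(\<lambda>x. (M *v x) $ i + g $ i) \<in> Pol 1"
  proof (intro Pol_add Pol_const Pol_linear)
    show "linear (\<lambda>x. (M *v x) $ i)"
      using linear_compose[OF matrix_vector_mul_linear[of M] bounded_linear.linear[OF bounded_linear_vec_nth[of i]]]
      by (simp add: o_def)
  qed simp
  then show "(\<lambda>x. affine_map M g x $ i) \<in> Pol 1" by (simp add: affine_map_def)
qed

lemma Pol_pull: "f \<in> Pol j \<Longrightarrow> (\<lambda>x. f (pull M g x)) \<in> Pol j"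
proof (rule Pol_compose)
  fix i
  have "(\<lambda>x. pull M g x $ i) = aff_lam M g (Some i)" by (simp add: aff_lam_def ref_lam_def fun_eq_iff)
  then show "(\<lambda>x. pull M g x $ i) \<in> Pol 1" using A.lam_Pol by simp
qed

lemma polynomial_hat: "rpoly f \<Longrightarrow> rpoly (hat f)"
  using rpoly_Pol Pol_hat Pol_rpoly by blast

lemma integral_hat:
  assumes "rpoly f"
  shows "A.I f = vol / ref.I (\<lambda>x::real^'n. 1) * ref.I (hat f)"
  using integral_pull[OF invertible_M polynomial_hat[OF assms], of g] by (simp add: hat_pull)

lemma pull_in_ref: "pull M g x \<in> ref_simplex \<longleftrightarrow> x \<in> El"
  unfolding El_K ref_K[symmetric] by (simp add: A.K_def ref.K_def aff_lam_def)

lemma affine_in_El: "affine_map M g x \<in> El \<longleftrightarrow> x \<in> ref_simplex"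
  using pull_in_ref[of "affine_map M g x"] by (simp add: pull_affine)

lemma derivative_hat:
  assumes "rpoly f"
  shows "frechet_derivative f (at x) d = frechet_derivative (hat f) (at (pull M g x)) (matrix_inv M *v d)"
proof -
  have "((\<lambda>x. pull M g x) has_derivative (\<lambda>d. matrix_inv M *v (d - 0))) (at x)"
    unfolding pull_def
    by (intro bounded_linear.has_derivative[OF matrix_vector_mul_bounded_linear] has_derivative_diff has_derivative_ident has_derivative_const)
  from has_derivative_compose[OF this rpoly_has_derivative[OF polynomial_hat[OF assms]]]
  have "(f has_derivative (\<lambda>d. frechet_derivative (hat f) (at (pull M g x)) (matrix_inv M *v d))) (at x)"
    by (simp add: hat_pull)
  then show ?thesis by (metis frechet_derivative_at)
qed

lemma hat_mult: "hat (\<lambda>x. f x * h x) = (\<lambda>x. hat f x * hat h x)"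
  by (simp add: hat_def fun_eq_iff)

lemma hat_bub: "hat A.bub = ref.bub" and hat_fbub: "hat (A.fbub i) = ref.fbub i"
  by (simp_all add: fun_eq_iff hat_def A.bub_def ref.bub_def A.fbub_def ref.fbub_def aff_lam_def pull_affine)

text \<open>Composition with the affine map preserves degree and zero boundary values and multiplies
  all integrals by the same factor, so orthogonality carries over.\<close>

lemma Pol_perp_hat:
  assumes w: "w \<in> Pol_perp j El" shows "hat w \<in> Pol_perp j ref_simplex"
proof -
  have wP: "w \<in> Pol j" by (rule Pol_perp_Pol[OF w])
  have "pairing ref_simplex (hat w) z = 0" if z: "z \<in> Pol0 j ref_simplex" for z
  proof -
    let ?z = "\<lambda>x. z (pull M g x)"
    have zP: "z \<in> Pol j" using z by (simp add: Pol0_def)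
    have "?z \<in> Pol0 j El" unfolding Pol0_def
    proof (intro CollectI conjI ballI)
      show "?z \<in> Pol j" by (rule Pol_pull[OF zP])
      fix x assume "x \<in> frontier El"
      then have "pull M g x \<in> frontier ref_simplex"
        unfolding El_K A.frontier_K unfolding ref_K[symmetric] ref.frontier_K by (simp add: A.K_def ref.K_def aff_lam_def)
      then show "?z x = 0" using z by (simp add: Pol0_def)
    qed
    then have "pairing El w ?z = 0" using w by (simp add: Pol_perp_def)
    then have "A.I (\<lambda>x. w x * ?z x) = 0" by (simp add: El_K A.pairing_K)
    moreover have "rpoly (\<lambda>x. w x * ?z x)"
      by (intro rpoly_intros Pol_rpoly[OF wP] Pol_rpoly[OF Pol_pull[OF zP]])
    ultimately have "vol / ref.I (\<lambda>x::real^'n. 1) * ref.I (\<lambda>x. hat w x * z x) = 0"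
      using integral_hat by (simp add: hat_mult hat_comp_pull)
    then have "ref.I (\<lambda>x. hat w x * z x) = 0" using vol_pos ref_vol_pos by simp
    then show ?thesis unfolding ref_K[symmetric] ref.pairing_K .
  qed
  then show ?thesis using Pol_hat[OF wP] by (simp add: Pol_perp_def)
qed

text \<open>The inverse affine map sends the radial field about a vertex to the radial field about
  the corresponding reference vertex, so the facet functional scales like a plain integral.\<close>

lemma facet_form_hat:
  assumes w: "rpoly w" and r: "rpoly r"
  shows "A.facet_form i w r = vol / ref.I (\<lambda>x::real^'n. 1) * ref.facet_form i (hat w) (hat r)"
proof -
  define f where "f x = A.fbub i x * (w x * r x)" for x
  have pf: "rpoly f" unfolding f_def[abs_def]
    by (intro rpoly_intros A.fbub_polynomial w r)
  have hf: "hat f = (\<lambda>x. ref.fbub i x * (hat w x * hat r x))"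
    unfolding f_def[abs_def] hat_mult hat_fbub ..
  let ?h = "\<lambda>x. real CARD('n) * hat f x + frechet_derivative (hat f) (at x) (x - ref_vertex i)"
  have "matrix_inv M *v (x - vertices M g i) = pull M g x - ref_vertex i" for x
  proof -
    have "matrix_inv M *v (x - vertices M g i) = pull M g x - pull M g (vertices M g i)"
      by (simp add: pull_def matrix_vector_mult_diff_distrib[symmetric])
    then show ?thesis by (simp add: vertices_def pull_affine)
  qed
  then have "A.facet_form i w r = A.I (\<lambda>x. ?h (pull M g x))"
    unfolding A.facet_form_def A.facet_functional_def f_def[symmetric] derivative_hat[OF pf] by (simp add: hat_pull)
  also have "\<dots> = vol / ref.I (\<lambda>x::real^'n. 1) * ref.I ?h"
    by (intro integral_pull invertible_M rpoly_intros polynomial_hat pf ref.radial_polynomial)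
  also have "ref.I ?h = ref.facet_form i (hat w) (hat r)"
    unfolding ref.facet_form_def ref.facet_functional_def hf ..
  finally show ?thesis .
qed

text \<open>The factor left open in the facet functional is the height
  \<open>1 / norm (grad i)\<close>; it cancels against the norm of the gradient contained in
  \<open>aff_dl M i \<beta>\<close>. So this is the sum of the facet integrals of
  \<open>|\<beta> . n_i| b_i w r\<close>.\<close>

definition E :: "(real ^ 'n \<Rightarrow> real) \<Rightarrow> (real ^ 'n \<Rightarrow> real) \<Rightarrow> real" where
  "E w r = (\<Sum>i\<in>UNIV. \<bar>aff_dl M i \<beta>\<bar> * A.facet_form i w r)"

lemma E_coercive:
  assumes r: "r \<in> Pol_perp (int k) El" and x: "x \<in> El"
  shows "(r x)\<^sup>2 * vol * (norm \<beta> / diameter El) \<le> Cc * ref.I (\<lambda>x::real^'n. 1) * E r r"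
proof -
  note pr = Pol_rpoly[OF Pol_perp_Pol[OF r]]
  have "E r r = vol / ref.I (\<lambda>x::real^'n. 1) * (\<Sum>i\<in>UNIV. \<bar>aff_dl M i \<beta>\<bar> * ref.facet_form i (hat r) (hat r))"
    unfolding E_def facet_form_hat[OF pr pr] by (simp add: sum_distrib_left mult_ac)
  then have eq: "vol * (\<Sum>i\<in>UNIV. \<bar>aff_dl M i \<beta>\<bar> * ref.facet_form i (hat r) (hat r)) = ref.I (\<lambda>x::real^'n. 1) * E r r"
    using ref_vol_pos by (simp add: field_simps)
  have "(hat r (pull M g x))\<^sup>2 * (norm \<beta> / diameter El)
      \<le> Cc * (\<Sum>i\<in>UNIV. \<bar>aff_dl M i \<beta>\<bar> * ref.facet_form i (hat r) (hat r))"
    by (rule coercive[OF Pol_perp_hat[OF r]]) (simp add: pull_in_ref x)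
  then have "vol * ((r x)\<^sup>2 * (norm \<beta> / diameter El))
      \<le> vol * (Cc * (\<Sum>i\<in>UNIV. \<bar>aff_dl M i \<beta>\<bar> * ref.facet_form i (hat r) (hat r)))"
    unfolding hat_pull using vol_pos by (intro mult_left_mono) auto
  also have "\<dots> = Cc * (ref.I (\<lambda>x::real^'n. 1) * E r r)" unfolding eq[symmetric] by (simp only: mult.left_commute)
  finally show ?thesis by (simp only: mult_ac)
qed

lemma bub_coercive:
  assumes f: "f \<in> Pol (int k - 2)" and x: "x \<in> El"
  shows "(f x)\<^sup>2 * vol \<le> Cb * ref.I (\<lambda>x::real^'n. 1) * A.I (\<lambda>x. A.bub x * (f x * f x))"
proof -
  note pf = Pol_rpoly[OF f]
  have "A.I (\<lambda>x. A.bub x * (f x * f x)) = vol / ref.I (\<lambda>x::real^'n. 1) * ref.I (hat (\<lambda>x. A.bub x * (f x * f x)))"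
    by (intro integral_hat rpoly_intros A.bub_polynomial pf)
  then have eq: "vol * ref.I (\<lambda>x. ref.bub x * (hat f x * hat f x)) = ref.I (\<lambda>x::real^'n. 1) * A.I (\<lambda>x. A.bub x * (f x * f x))"
    using ref_vol_pos by (simp add: field_simps hat_mult hat_bub)
  have "(hat f (pull M g x))\<^sup>2 \<le> Cb * ref.I (\<lambda>x. ref.bub x * (hat f x * hat f x))"
    by (rule bubble_bound[OF Pol_hat[OF f]]) (simp add: pull_in_ref x)
  then have "vol * (f x)\<^sup>2 \<le> vol * (Cb * ref.I (\<lambda>x. ref.bub x * (hat f x * hat f x)))"
    unfolding hat_pull using vol_pos by (intro mult_left_mono) auto
  also have "\<dots> = Cb * (ref.I (\<lambda>x::real^'n. 1) * A.I (\<lambda>x. A.bub x * (f x * f x)))" unfolding eq[symmetric] by (simp only: mult.left_commute)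
  finally show ?thesis by (simp only: mult_ac)
qed

lemma diameter_pos: "0 < diameter El"
  unfolding El_K by (rule A.diameter_pos)

lemma diameter_le: "diameter El \<le> 2 * mat_norm M"
proof (rule diameter_le)
  show "El \<noteq> {} \<or> 0 \<le> 2 * mat_norm M" using A.vertex_in_K El_K by blast
  fix x y assume xy: "x \<in> El" "y \<in> El"
  let ?d = "pull M g x - pull M g y"
  have "x - y = affine_map M g (pull M g x) - affine_map M g (pull M g y)" by (simp add: affine_pull)
  also have "\<dots> = M *v ?d" by (simp add: affine_map_def matrix_vector_mult_diff_distrib)
  finally have "norm (x - y) \<le> mat_norm M * norm ?d" using mat_norm_bound by simp
  also have "norm ?d \<le> norm (pull M g x) + norm (pull M g y)" by (rule norm_triangle_ineq4)
  also have "\<dots> \<le> 1 + 1" using xy by (intro add_mono norm_ref_simplex) (simp_all add: pull_in_ref)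
  finally show "norm (x - y) \<le> 2 * mat_norm M"
    using onorm_pos_le[OF matrix_vector_mul_bounded_linear[of M]] by (simp add: mat_norm_def mult_left_mono)
qed

text \<open>Origin of the factor \<open>2 * \<kappa>\<close>: the reference simplex lies in the unit
  ball, so the diameter is at most twice the norm of \<open>M\<close>, and the product of the two
  matrix norms is at most \<open>\<kappa>\<close>.\<close>

lemma norm_pulled_direction: "norm (matrix_inv M *v \<beta>) \<le> 2 * \<kappa> * (norm \<beta> / diameter El)"
proof -
  have "diameter El * norm (matrix_inv M *v \<beta>) \<le> (2 * mat_norm M) * (mat_norm (matrix_inv M) * norm \<beta>)"
    using diameter_le mat_norm_bound diameter_pos by (intro mult_mono) auto
  also have "\<dots> = 2 * (mat_norm M * mat_norm (matrix_inv M)) * norm \<beta>" by simp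
  also have "\<dots> \<le> 2 * \<kappa> * norm \<beta>" using shape by (intro mult_right_mono mult_left_mono) auto
  finally show ?thesis using diameter_pos by (simp add: field_simps)
qed

lemma inverse_estimate:
  assumes f: "f \<in> Pol (int k + int CARD('n) + 1)" and R: "\<And>x. x \<in> El \<Longrightarrow> \<bar>f x\<bar> \<le> R" and x: "x \<in> El"
  shows "\<bar>frechet_derivative f (at x) \<beta>\<bar> \<le> 2 * \<kappa> * Cd * (norm \<beta> / diameter El) * R"
proof -
  have R0: "0 \<le> R" using R[OF x] by linarith
  have "\<bar>frechet_derivative (hat f) (at (pull M g x)) (matrix_inv M *v \<beta>)\<bar> \<le> Cd * norm (matrix_inv M *v \<beta>) * R"
  proof (rule deriv_bound[OF Pol_hat[OF f]])
    show "\<bar>hat f y\<bar> \<le> R" if "y \<in> ref_simplex" for y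
      unfolding hat_def by (rule R) (simp add: affine_in_El that)
  qed (simp add: pull_in_ref x)
  also have "\<dots> \<le> Cd * (2 * \<kappa> * (norm \<beta> / diameter El)) * R"
    using constants R0 norm_pulled_direction by (intro mult_right_mono mult_left_mono) auto
  also have "\<dots> = 2 * \<kappa> * Cd * (norm \<beta> / diameter El) * R" by (simp only: mult_ac)
  finally show ?thesis unfolding derivative_hat[OF Pol_rpoly[OF f]] .
qed

text \<open>Positivity is read off from \<open>E_coercive\<close> instead of being argued facet by
  facet, because for \<open>k = 1\<close> some of the fluxes may vanish.\<close>

lemma E_form: "pos_def_form (Pol_perp (int k) El) E"
proof
  have SP: "rpoly f" if "f \<in> Pol_perp (int k) El" for f
    using that Pol_perp_Pol Pol_rpoly by blast
  show "(\<lambda>x. 0) \<in> Pol_perp (int k) El" unfolding El_K by (rule A.Pol_perp_zero)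
  show "\<exists>B. finite B \<and> Pol_perp (int k) El \<subseteq> fun_vs.span B"
    using Pol_finite_dim[of "int k"] Pol_perp_Pol by blast
  fix f h r :: "real ^ 'n \<Rightarrow> real" and c :: real
  assume f: "f \<in> Pol_perp (int k) El"
  show "(\<lambda>x. c * f x) \<in> Pol_perp (int k) El" using f unfolding El_K by (rule A.Pol_perp_scale)
  { assume nz: "f \<noteq> (\<lambda>x. 0)"
    have "\<exists>x\<in>El. f x \<noteq> 0"
    proof (rule ccontr)
      assume "\<not> (\<exists>x\<in>El. f x \<noteq> 0)"
      then have z: "f x = 0" if "x \<in> A.K_int" for x using that A.K_int_subset El_K by blast
      obtain x0 where "x0 \<in> A.K_int" using A.K_int_nonempty by blast
      then have "f = (\<lambda>x. 0)" using polynomial_zero_if_zero_on_open[OF SP[OF f] A.K_int_open _ z] by blast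
      then show False using nz by blast
    qed
    then obtain x where x: "x \<in> El" "f x \<noteq> 0" by blast
    have "0 < (f x)\<^sup>2 * vol * (norm \<beta> / diameter El)"
      using x(2) vol_pos \<beta>_nonzero diameter_pos by simp
    also have "\<dots> \<le> Cc * ref.I (\<lambda>x::real^'n. 1) * E f f" by (rule E_coercive[OF f x(1)])
    finally show "0 < E f f"
      by (rule zero_less_mult_pos) (rule mult_pos_pos[OF constants(1) ref_vol_pos]) }
  { assume r: "r \<in> Pol_perp (int k) El"
    show "E r (\<lambda>x. c * f x) = c * E r f"
      by (simp add: E_def A.facet_form_scale[OF SP[OF f] SP[OF r]] sum_distrib_left mult.left_commute) }
  assume h: "h \<in> Pol_perp (int k) El"
  show "(\<lambda>x. f x + h x) \<in> Pol_perp (int k) El" using f h unfolding El_K by (rule A.Pol_perp_add)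
  show "E f h = E h f" unfolding E_def by (simp only: A.facet_form_sym)
  assume r: "r \<in> Pol_perp (int k) El"
  show "E r (\<lambda>x. f x + h x) = E r f + E r h"
    by (simp add: E_def A.facet_form_add[OF SP[OF f] SP[OF h] SP[OF r]] sum.distrib distrib_left)
qed

section \<open>The local test space\<close>

definition sb :: "real ^ 'n \<Rightarrow> real" where
  "sb x = (\<Sum>i\<in>UNIV. (- sgn (aff_dl M i \<beta>)) * A.fbub i x)"

lemma sb_eq: "signed_bubble \<beta> El (vertices M g) = sb"
  unfolding El_K by (simp add: fun_eq_iff signed_bubble_def sb_def A.facet_sign_eq A.facet_bubble_eq)

lemma fbub_Pol: "A.fbub i \<in> Pol (int CARD('n))"
proof -
  have "A.fbub i \<in> Pol (\<Sum>j\<in>UNIV - {i}. 1)"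
    unfolding A.fbub_def[abs_def] by (intro Pol_prod A.lam_Pol) simp
  then show ?thesis by (simp add: card_Diff_subset)
qed

lemma bub_Pol: "A.bub \<in> Pol (int CARD('n) + 1)"
proof -
  have "(\<lambda>x. aff_lam M g None x * A.fbub None x) \<in> Pol (1 + int CARD('n))"
    by (intro Pol_mult A.lam_Pol fbub_Pol)
  then show ?thesis unfolding A.bub_eq[symmetric] by (simp add: add.commute)
qed

lemma sb_Pol: "sb \<in> Pol (int CARD('n))"
  unfolding sb_def[abs_def] by (intro Pol_sum Pol_scale fbub_Pol) simp

lemma V_Pol:
  assumes "r \<in> Pol (int k)" "z \<in> Pol (int k - 2)"
  shows "(\<lambda>x. sb x * r x + A.bub x * z x) \<in> Pol (int k + int CARD('n) + 1)"
proof (rule Pol_add)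
  have "(\<lambda>x. sb x * r x) \<in> Pol (int CARD('n) + int k)" by (intro Pol_mult sb_Pol assms)
  then show "(\<lambda>x. sb x * r x) \<in> Pol (int k + int CARD('n) + 1)" by (rule Pol_mono) simp
  have "(\<lambda>x. A.bub x * z x) \<in> Pol (int CARD('n) + 1 + (int k - 2))" by (intro Pol_mult bub_Pol assms)
  then show "(\<lambda>x. A.bub x * z x) \<in> Pol (int k + int CARD('n) + 1)" by (rule Pol_mono) simp
qed

lemma lam_le_1: "x \<in> El \<Longrightarrow> aff_lam M g i x \<le> 1"
proof -
  assume "x \<in> El"
  then have "aff_lam M g i x \<le> (\<Sum>i\<in>UNIV. aff_lam M g i x)"
    by (intro member_le_sum) (auto simp: El_K A.K_def)
  then show ?thesis by (simp add: A.lam_sum)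
qed

lemma fbub_le_1: "x \<in> El \<Longrightarrow> \<bar>A.fbub i x\<bar> \<le> 1"
  using A.fbub_nonneg[of x i] unfolding El_K[symmetric] A.fbub_def
  by (auto intro!: prod_le_1 simp: lam_le_1 El_K A.K_def)

lemma bub_le_1: "x \<in> El \<Longrightarrow> \<bar>A.bub x\<bar> \<le> 1"
proof -
  assume x: "x \<in> El"
  have "\<bar>A.bub x\<bar> = \<bar>aff_lam M g None x\<bar> * \<bar>A.fbub None x\<bar>" by (simp add: A.bub_eq[of _ None] abs_mult)
  also have "\<dots> \<le> 1 * 1"
    using x lam_le_1[OF x, of None] fbub_le_1[OF x] by (intro mult_mono) (auto simp: El_K A.K_def)
  finally show ?thesis by simp
qed

lemma sb_bound: "x \<in> El \<Longrightarrow> \<bar>sb x\<bar> \<le> real CARD('n) + 1"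
proof -
  assume x: "x \<in> El"
  have "\<bar>sb x\<bar> \<le> (\<Sum>i\<in>UNIV. \<bar>(- sgn (aff_dl M i \<beta>)) * A.fbub i x\<bar>)" unfolding sb_def by (rule sum_abs)
  also have "\<dots> \<le> (\<Sum>i\<in>(UNIV :: 'n option set). 1)"
  proof (rule sum_mono)
    fix i
    have "\<bar>(- sgn (aff_dl M i \<beta>)) * A.fbub i x\<bar> \<le> 1 * 1"
      unfolding abs_mult using fbub_le_1[OF x] by (intro mult_mono) (auto simp: sgn_if)
    then show "\<bar>(- sgn (aff_dl M i \<beta>)) * A.fbub i x\<bar> \<le> 1" by simp
  qed
  also have "\<dots> = real CARD('n) + 1" by simp
  finally show ?thesis .
qed

text \<open>The signs turn the flux of \<open>\<beta>\<close> through each facet into its absolute value.\<close>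

lemma integral_derivative_V:
  assumes w: "rpoly w" and r: "rpoly r" and z: "rpoly z"
  shows "A.I (\<lambda>x. frechet_derivative (\<lambda>x. w x * (sb x * r x + A.bub x * z x)) (at x) \<beta>) = E w r"
proof -
  define F where "F i x = A.fbub i x * (w x * r x)" for i x
  have pF: "rpoly (F i)" for i unfolding F_def[abs_def]
    by (intro rpoly_intros A.fbub_polynomial w r)
  let ?c = "\<lambda>i. - sgn (aff_dl M i \<beta>)"
  let ?S = "\<lambda>x. \<Sum>i\<in>UNIV. ?c i * F i x" and ?B = "\<lambda>x. A.bub x * (w x * z x)"
  have pS: "rpoly ?S"
    by (intro real_polynomial_function_sum rpoly_intros pF) simp
  have pB: "rpoly ?B" by (intro rpoly_intros A.bub_polynomial w z)
  have eq: "(\<lambda>x. w x * (sb x * r x + A.bub x * z x)) = (\<lambda>x. ?S x + ?B x)"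
    by (simp add: fun_eq_iff sb_def F_def sum_distrib_left sum_distrib_right algebra_simps)
  have "A.I (\<lambda>x. frechet_derivative (\<lambda>x. w x * (sb x * r x + A.bub x * z x)) (at x) \<beta>)
     = A.I (\<lambda>x. frechet_derivative ?S (at x) \<beta> + frechet_derivative ?B (at x) \<beta>)"
    unfolding eq by (simp only: frechet_derivative_add[OF pS[THEN rpoly_differentiable] pB[THEN rpoly_differentiable]])
  also have "\<dots> = A.I (\<lambda>x. frechet_derivative ?S (at x) \<beta>) + A.I (\<lambda>x. frechet_derivative ?B (at x) \<beta>)"
    by (intro A.I_add rpoly_frechet_derivative pS pB)
  \<comment> \<open>Here \<open>z\<close> disappears from the first equation: the bubble part
    vanishes on the whole boundary.\<close>
  also have "A.I (\<lambda>x. frechet_derivative ?B (at x) \<beta>) = 0"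
    by (intro A.integral_derivative_bub rpoly_intros w z)
  also have "A.I (\<lambda>x. frechet_derivative ?S (at x) \<beta>) = (\<Sum>i\<in>UNIV. ?c i * A.I (\<lambda>x. frechet_derivative (F i) (at x) \<beta>))"
  proof -
    have S: "frechet_derivative ?S (at x) = (\<lambda>d. \<Sum>i\<in>UNIV. ?c i * frechet_derivative (F i) (at x) d)" for x
    proof -
      have "(?S has_derivative (\<lambda>d. \<Sum>i\<in>UNIV. ?c i * frechet_derivative (F i) (at x) d)) (at x)"
        by (intro has_derivative_sum has_derivative_mult_right rpoly_has_derivative pF)
      then show ?thesis by (rule frechet_derivative_at[symmetric])
    qed
    have "A.I (\<lambda>x. frechet_derivative ?S (at x) \<beta>) = A.I (\<lambda>x. \<Sum>i\<in>UNIV. ?c i * frechet_derivative (F i) (at x) \<beta>)"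
      unfolding S ..
    also have "\<dots> = (\<Sum>i\<in>UNIV. A.I (\<lambda>x. ?c i * frechet_derivative (F i) (at x) \<beta>))"
      by (intro A.I_sum rpoly_intros rpoly_frechet_derivative pF)
    finally show ?thesis by (simp only: A.I_scale)
  qed
  also have "\<dots> = E w r" unfolding E_def
  proof (intro sum.cong refl)
    fix i
    have "A.I (\<lambda>x. frechet_derivative (F i) (at x) \<beta>) = - aff_dl M i \<beta> * A.facet_form i w r"
      unfolding F_def[abs_def] A.facet_form_def
      by (intro A.integral_derivative_facet_functional A.div_except_fbub rpoly_intros w r)
    then show "?c i * A.I (\<lambda>x. frechet_derivative (F i) (at x) \<beta>) = \<bar>aff_dl M i \<beta>\<bar> * A.facet_form i w r"
      by (simp add: sgn_if)
  qed
  finally show ?thesis by simp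
qed

end

section \<open>The local projector\<close>

text \<open>Needed to split integrals against the derivative of a test function: such a split
  requires both parts to be integrable.\<close>

lemma test_function_derivative:
  assumes phi: "\<phi> \<in> test_functions U"
  shows "(\<lambda>x. frechet_derivative \<phi> (at x) d) \<in> test_functions U"
proof -
  let ?D = "\<lambda>x. frechet_derivative \<phi> (at x) d"
  have "{x. ?D x \<noteq> 0} \<subseteq> closure {x. \<phi> x \<noteq> 0}" using test_function_outside(2)[of _ \<phi> d] by blast
  then have sub: "closure {x. ?D x \<noteq> 0} \<subseteq> closure {x. \<phi> x \<noteq> 0}" by (rule closure_minimal) simp
  have "compact (closure {x. ?D x \<noteq> 0})"
    using phi compact_Int_closed[of "closure {x. \<phi> x \<noteq> 0}", OF _ closed_closure, of "{x. ?D x \<noteq> 0}"]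
    unfolding Int_absorb1[OF sub] by (simp add: test_functions_def)
  moreover have "Ck m ?D" for m using phi by (intro Ck_frechet_derivative) (simp only: test_functions_def mem_Collect_eq)
  ultimately show ?thesis using phi sub by (auto simp: test_functions_def)
qed

lemma loc_integrable_diff:
  "loc_integrable U f \<Longrightarrow> loc_integrable U g \<Longrightarrow> loc_integrable U (\<lambda>x. f x - g x)"
  unfolding loc_integrable_def by (auto intro!: Bochner_Integration.integrable_diff)

lemma is_weak_deriv_diff:
  assumes U: "open U" and f: "is_weak_deriv \<beta> U f f'" and g: "is_weak_deriv \<beta> U g g'"
  shows "is_weak_deriv \<beta> U (\<lambda>x. f x - g x) (\<lambda>x. f' x - g' x)"
proof -
  have l: "loc_integrable U f" "loc_integrable U f'" "loc_integrable U g" "loc_integrable U g'"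
    using f g by (auto simp: is_weak_deriv_def)
  have "integral\<^sup>L (lebesgue_on U) (\<lambda>x. (f x - g x) * frechet_derivative \<phi> (at x) \<beta>)
      = - integral\<^sup>L (lebesgue_on U) (\<lambda>x. (f' x - g' x) * \<phi> x)" if phi: "\<phi> \<in> test_functions U" for \<phi>
  proof -
    note int = integrable_mult_test_function[OF U]
    note dphi = test_function_derivative[OF phi, of \<beta>]
    have "integral\<^sup>L (lebesgue_on U) (\<lambda>x. f x * frechet_derivative \<phi> (at x) \<beta>) = - integral\<^sup>L (lebesgue_on U) (\<lambda>x. f' x * \<phi> x)"
      "integral\<^sup>L (lebesgue_on U) (\<lambda>x. g x * frechet_derivative \<phi> (at x) \<beta>) = - integral\<^sup>L (lebesgue_on U) (\<lambda>x. g' x * \<phi> x)"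
      using f g phi by (auto simp: is_weak_deriv_def)
    then show ?thesis
      using int[OF l(1) dphi] int[OF l(3) dphi] int[OF l(2) phi] int[OF l(4) phi]
      by (simp add: left_diff_distrib)
  qed
  then show ?thesis using l by (auto simp: is_weak_deriv_def intro: loc_integrable_diff)
qed

lemma weak_deriv_works:
  "is_weak_deriv \<beta> (interior K) v h \<Longrightarrow> is_weak_deriv \<beta> (interior K) v (weak_deriv \<beta> K v)"
  unfolding weak_deriv_def by (rule someI[of "is_weak_deriv \<beta> (interior K) v"])

context element
begin

text \<open>Uniqueness is available on the open interior; the frontier adds only a null set. The
  chosen derivative may therefore be replaced by any known representative in integrals over
  \<open>El\<close>.\<close>

lemma negligible_weak_deriv:
  assumes "is_weak_deriv \<beta> (interior El) v h"
  shows "negligible {x \<in> El. weak_deriv \<beta> El v x \<noteq> h x}"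
proof -
  have "negligible {x \<in> interior El. weak_deriv \<beta> El v x \<noteq> h x}"
    by (rule is_weak_deriv_unique[OF open_interior weak_deriv_works[OF assms] assms])
  moreover have "negligible (frontier El)" unfolding El_K by (rule A.negligible_frontier_K)
  moreover have "{x \<in> El. weak_deriv \<beta> El v x \<noteq> h x} \<subseteq> {x \<in> interior El. weak_deriv \<beta> El v x \<noteq> h x} \<union> frontier El"
    using closure_subset[of El] by (auto simp: frontier_def)
  ultimately show ?thesis by (meson negligible_Un negligible_subset)
qed

lemma El_lebesgue: "El \<in> sets lebesgue"
  unfolding El_K by (rule A.K_lebesgue)

lemma polynomial_measurable: "rpoly f \<Longrightarrow> f \<in> borel_measurable (lebesgue_on El)"
  using A.polynomial_integrable unfolding El_K by blast

lemma integrable_one: "integrable (lebesgue_on El) (\<lambda>x. 1 :: real)"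
  unfolding El_K by (intro A.polynomial_integrable rpoly_intros)

lemma vol_eq: "vol = integral\<^sup>L (lebesgue_on El) (\<lambda>x. 1)"
  by (simp add: A.I_def El_K)

lemma weak_deriv_polynomial:
  "rpoly w \<Longrightarrow> is_weak_deriv \<beta> (interior El) w (\<lambda>x. frechet_derivative w (at x) \<beta>)"
  by (rule is_weak_deriv_polynomial) auto

lemma pairing_weak_deriv:
  assumes "is_weak_deriv \<beta> (interior El) v h" "h \<in> borel_measurable (lebesgue_on El)" "w \<in> borel_measurable (lebesgue_on El)"
  shows "pairing El w (weak_deriv \<beta> El v) = pairing El w h" "pairing El (weak_deriv \<beta> El v) w = pairing El h w"
  using integral_mult_cong_negligible[OF El_lebesgue negligible_weak_deriv[OF assms(1)] assms(2,3)]
  by (simp_all add: pairing_def mult.commute)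

lemma polynomial_mult_integrable:
  assumes w: "rpoly w" and v: "integrable (lebesgue_on El) v"
  shows "integrable (lebesgue_on El) (\<lambda>x. w x * v x)"
proof -
  obtain B where "\<forall>x\<in>El. \<bar>w x\<bar> \<le> B" using A.polynomial_bounded[OF w] El_K by blast
  then have "integrable (lebesgue_on El) (\<lambda>x. v x * w x)"
    using v polynomial_measurable[OF w] by (intro integrable_mult_bounded[of _ _ _ B]) auto
  then show ?thesis by (simp only: mult.commute)
qed

lemma pairing_bound:
  assumes w: "rpoly w" and v: "integrable (lebesgue_on El) v" and B: "\<And>x. x \<in> El \<Longrightarrow> \<bar>w x\<bar> \<le> B"
  shows "\<bar>pairing El w v\<bar> \<le> B * integral\<^sup>L (lebesgue_on El) (\<lambda>x. \<bar>v x\<bar>)"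
proof -
  have "\<bar>pairing El w v\<bar> \<le> integral\<^sup>L (lebesgue_on El) (\<lambda>x. \<bar>w x * v x\<bar>)"
    unfolding pairing_def by (rule integral_abs_bound)
  also have "\<dots> \<le> integral\<^sup>L (lebesgue_on El) (\<lambda>x. B * \<bar>v x\<bar>)"
  proof (rule integral_mono)
    show "integrable (lebesgue_on El) (\<lambda>x. \<bar>w x * v x\<bar>)" using polynomial_mult_integrable[OF w v] by simp
    show "integrable (lebesgue_on El) (\<lambda>x. B * \<bar>v x\<bar>)" using v by simp
    show "\<bar>w x * v x\<bar> \<le> B * \<bar>v x\<bar>" if "x \<in> space (lebesgue_on El)" for x
      using B[of x] that by (simp add: abs_mult mult_right_mono)
  qed
  finally show ?thesis by simp
qed

lemma pairing_add_left:
  assumes "rpoly w" "rpoly w'" "integrable (lebesgue_on El) v"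
  shows "pairing El (\<lambda>x. w x + w' x) v = pairing El w v + pairing El w' v"
  using polynomial_mult_integrable[OF assms(1,3)] polynomial_mult_integrable[OF assms(2,3)]
  by (simp add: pairing_def distrib_right)

lemma pairing_scale_left: "pairing El (\<lambda>x. c * w x) v = c * pairing El w v"
  by (simp add: pairing_def mult.assoc)

lemma pairing_diff_right:
  assumes "rpoly w" "integrable (lebesgue_on El) u" "integrable (lebesgue_on El) v"
  shows "pairing El w (\<lambda>x. u x - v x) = pairing El w u - pairing El w v"
  using polynomial_mult_integrable[OF assms(1,2)] polynomial_mult_integrable[OF assms(1,3)]
  by (simp add: pairing_def right_diff_distrib)

lemma pairing_polynomial: "pairing El f h = A.I (\<lambda>x. f x * h x)"
  unfolding El_K by (rule A.pairing_K)

text \<open>Eliminates both arbitrary choices: the classical derivative stands in for that of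
  \<open>w\<close>, and any integrable representative \<open>h\<close> for that of \<open>v\<close>.
  All computations with \<open>D\<close> go through this form.\<close>

lemma D_eq:
  assumes w: "rpoly w" and v: "integrable (lebesgue_on El) v"
    and h: "is_weak_deriv \<beta> (interior El) v h" "integrable (lebesgue_on El) h"
  shows "D \<beta> El w v = pairing El (\<lambda>x. frechet_derivative w (at x) \<beta>) v + pairing El w h"
  unfolding D_def
  using pairing_weak_deriv(1)[OF h(1) borel_measurable_integrable[OF h(2)] polynomial_measurable[OF w]]
    pairing_weak_deriv(2)[OF weak_deriv_polynomial[OF w]
      polynomial_measurable[OF rpoly_frechet_derivative[OF w]] borel_measurable_integrable[OF v]]
  by simp

lemma D_polynomial:
  assumes w: "rpoly w" and u: "rpoly u"
  shows "D \<beta> El w u = A.I (\<lambda>x. frechet_derivative (\<lambda>x. w x * u x) (at x) \<beta>)"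
proof -
  have du: "rpoly (\<lambda>x. frechet_derivative u (at x) \<beta>)"
    and dw: "rpoly (\<lambda>x. frechet_derivative w (at x) \<beta>)"
    by (rule rpoly_frechet_derivative[OF u], rule rpoly_frechet_derivative[OF w])
  have "D \<beta> El w u = A.I (\<lambda>x. frechet_derivative w (at x) \<beta> * u x) + A.I (\<lambda>x. w x * frechet_derivative u (at x) \<beta>)"
    using D_eq[OF w _ weak_deriv_polynomial[OF u]] A.polynomial_integrable[OF u] A.polynomial_integrable[OF du]
    by (simp add: El_K A.pairing_K)
  also have "\<dots> = A.I (\<lambda>x. frechet_derivative w (at x) \<beta> * u x + w x * frechet_derivative u (at x) \<beta>)"
    by (intro A.I_add[symmetric] rpoly_intros dw w u du)
  finally show ?thesis
    by (simp add: frechet_derivative_mult w u rpoly_differentiable add.commute)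
qed

lemma D_V:
  assumes "w \<in> Pol_perp (int k) El" "r \<in> Pol_perp (int k) El" "z \<in> Pol (int k - 2)"
  shows "D \<beta> El w (\<lambda>x. sb x * r x + A.bub x * z x) = E w r"
proof -
  note p = Pol_rpoly[OF Pol_perp_Pol[OF assms(1)]] Pol_rpoly[OF Pol_perp_Pol[OF assms(2)]]
    Pol_rpoly[OF assms(3)] and u = Pol_rpoly[OF V_Pol[OF Pol_perp_Pol[OF assms(2)] assms(3)]]
  show ?thesis unfolding D_polynomial[OF p(1) u] by (rule integral_derivative_V[OF p])
qed

lemma V_eq: "V k \<beta> El (vertices M g) = {(\<lambda>x. sb x * r x + A.bub x * z x) | r z. r \<in> Pol_perp (int k) El \<and> z \<in> Pol (int k - 2)}"
  unfolding V_def sb_eq A.bubble_eq ..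

lemma D_diff:
  assumes w: "rpoly w" and u: "rpoly u"
    and v: "integrable (lebesgue_on El) v" and h: "is_weak_deriv \<beta> (interior El) v h" "integrable (lebesgue_on El) h"
  shows "D \<beta> El w (\<lambda>x. u x - v x) = D \<beta> El w u - D \<beta> El w v"
proof -
  note du = rpoly_frechet_derivative[OF u, of \<beta>]
    and dw = rpoly_frechet_derivative[OF w, of \<beta>]
  have iu: "integrable (lebesgue_on El) u" "integrable (lebesgue_on El) (\<lambda>x. frechet_derivative u (at x) \<beta>)"
    unfolding El_K by (intro A.polynomial_integrable u du)+
  note wd = is_weak_deriv_diff[OF open_interior weak_deriv_polynomial[OF u] h(1)]
  show ?thesis
    unfolding D_eq[OF w Bochner_Integration.integrable_diff[OF iu(1) v] wd Bochner_Integration.integrable_diff[OF iu(2) h(2)]]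
      D_eq[OF w v h] D_eq[OF w iu(1) weak_deriv_polynomial[OF u] iu(2)]
      pairing_diff_right[OF dw iu(1) v] pairing_diff_right[OF w iu(2) h(2)]
    by simp
qed

text \<open>The system is triangular: the first equation determines \<open>r\<close> alone, and the
  second determines \<open>z\<close> with \<open>r\<close> as data. Riesz representation gives
  existence and definiteness gives uniqueness, which together justify the definite description in
  \<open>Proj\<close>.\<close>

lemma Proj_characterization:
  assumes v: "integrable (lebesgue_on El) v" and h: "is_weak_deriv \<beta> (interior El) v h" "integrable (lebesgue_on El) h"
  shows "\<exists>r\<in>Pol_perp (int k) El. \<exists>z\<in>Pol (int k - 2).
    Proj k \<beta> El (vertices M g) v = (\<lambda>x. sb x * r x + A.bub x * z x) \<and>
    (\<forall>w\<in>Pol_perp (int k) El. E w r = D \<beta> El w v) \<and>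
    (\<forall>\<zeta>\<in>Pol (int k - 2). A.I (\<lambda>x. A.bub x * (\<zeta> x * z x)) = pairing El \<zeta> v - A.I (\<lambda>x. \<zeta> x * (sb x * r x)))"
proof -
  interpret E: pos_def_form "Pol_perp (int k) El" E by (rule E_form)
  interpret B: pos_def_form "Pol (int k - 2)" "\<lambda>f h. A.I (\<lambda>x. A.bub x * (f x * h x))"
    by (rule A.weighted_form_pos_def[OF A.bub_polynomial A.bub_nonneg A.bub_pos])
  note pp = Pol_rpoly and pperp = Pol_rpoly[OF Pol_perp_Pol]
  have sbp: "rpoly sb" by (rule pp[OF sb_Pol])
  \<comment> \<open>The equivalence is stated for arbitrary candidates, so that it serves the
    existence part and the uniqueness part alike.\<close>
  have cond: "((\<forall>w\<in>Pol_perp (int k) El. D \<beta> El w (\<lambda>x. (sb x * r x + A.bub x * z x) - v x) = 0) \<and>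
      (\<forall>\<zeta>\<in>Pol (int k - 2). pairing El \<zeta> (\<lambda>x. (sb x * r x + A.bub x * z x) - v x) = 0)) \<longleftrightarrow>
      (\<forall>w\<in>Pol_perp (int k) El. E w r = D \<beta> El w v) \<and>
      (\<forall>\<zeta>\<in>Pol (int k - 2). A.I (\<lambda>x. A.bub x * (\<zeta> x * z x)) = pairing El \<zeta> v - A.I (\<lambda>x. \<zeta> x * (sb x * r x)))"
    if r: "r \<in> Pol_perp (int k) El" and z: "z \<in> Pol (int k - 2)" for r z
  proof -
    let ?u = "\<lambda>x. sb x * r x + A.bub x * z x"
    have u: "rpoly ?u" by (rule pp[OF V_Pol[OF Pol_perp_Pol[OF r] z]])
    have iu: "integrable (lebesgue_on El) ?u" unfolding El_K by (rule A.polynomial_integrable[OF u])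
    have 1: "D \<beta> El w (\<lambda>x. ?u x - v x) = E w r - D \<beta> El w v" if w: "w \<in> Pol_perp (int k) El" for w
      unfolding D_diff[OF pperp[OF w] u v h] D_V[OF w r z] ..
    have 2: "pairing El \<zeta> (\<lambda>x. ?u x - v x)
        = A.I (\<lambda>x. \<zeta> x * (sb x * r x)) + A.I (\<lambda>x. A.bub x * (\<zeta> x * z x)) - pairing El \<zeta> v"
      if \<zeta>: "\<zeta> \<in> Pol (int k - 2)" for \<zeta>
    proof -
      have "A.I (\<lambda>x. \<zeta> x * (sb x * r x) + A.bub x * (\<zeta> x * z x)) = A.I (\<lambda>x. \<zeta> x * (sb x * r x)) + A.I (\<lambda>x. A.bub x * (\<zeta> x * z x))"
        by (intro A.I_add rpoly_intros pp[OF \<zeta>] sbp pperp[OF r] pp[OF z] A.bub_polynomial)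
      then show ?thesis
        unfolding pairing_diff_right[OF pp[OF \<zeta>] iu v] pairing_polynomial[of \<zeta> ?u] by (simp add: distrib_left mult.left_commute)
    qed
    show ?thesis using 1 2 by (auto simp: algebra_simps)
  qed
  have "\<exists>r\<in>Pol_perp (int k) El. \<forall>w\<in>Pol_perp (int k) El. E w r = D \<beta> El w v"
  proof (rule E.riesz)
    fix f :: "real ^ 'n \<Rightarrow> real" and c assume f: "f \<in> Pol_perp (int k) El"
    note pf = pperp[OF f]
    have cf: "rpoly (\<lambda>x. c * f x)" by (intro rpoly_intros pf)
    have dc: "frechet_derivative (\<lambda>x. c * f x) (at x) \<beta> = c * frechet_derivative f (at x) \<beta>" for x
      using frechet_derivative_mult[of "\<lambda>_. c" x f \<beta>] pf
      by (simp add: rpoly_differentiable frechet_derivative_const)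
    show "D \<beta> El (\<lambda>x. c * f x) v = c * D \<beta> El f v"
      unfolding D_eq[OF cf v h] D_eq[OF pf v h] dc pairing_scale_left by (simp add: distrib_left)
    fix f' :: "real ^ 'n \<Rightarrow> real" assume f': "f' \<in> Pol_perp (int k) El"
    note pf' = pperp[OF f']
    have s: "rpoly (\<lambda>x. f x + f' x)" by (intro rpoly_intros pf pf')
    have da: "frechet_derivative (\<lambda>x. f x + f' x) (at x) \<beta> = frechet_derivative f (at x) \<beta> + frechet_derivative f' (at x) \<beta>" for x
      by (rule frechet_derivative_add) (rule rpoly_differentiable, rule pf pf')+
    show "D \<beta> El (\<lambda>x. f x + f' x) v = D \<beta> El f v + D \<beta> El f' v"
      unfolding D_eq[OF s v h] D_eq[OF pf v h] D_eq[OF pf' v h] da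
        pairing_add_left[OF pf pf' h(2)]
        pairing_add_left[OF rpoly_frechet_derivative[OF pf] rpoly_frechet_derivative[OF pf'] v]
      by simp
  qed
  then obtain r where r: "r \<in> Pol_perp (int k) El" "\<And>w. w \<in> Pol_perp (int k) El \<Longrightarrow> E w r = D \<beta> El w v" by blast
  have prod_p: "rpoly (\<lambda>x. f x * (sb x * r x))" if "f \<in> Pol (int k - 2)" for f
    by (intro rpoly_intros pp[OF that] sbp pperp[OF r(1)])
  have "\<exists>z\<in>Pol (int k - 2). \<forall>\<zeta>\<in>Pol (int k - 2).
      A.I (\<lambda>x. A.bub x * (\<zeta> x * z x)) = pairing El \<zeta> v - A.I (\<lambda>x. \<zeta> x * (sb x * r x))"
  proof (rule B.riesz)
    fix f :: "real ^ 'n \<Rightarrow> real" and c assume f: "f \<in> Pol (int k - 2)"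
    show "pairing El (\<lambda>x. c * f x) v - A.I (\<lambda>x. c * f x * (sb x * r x)) = c * (pairing El f v - A.I (\<lambda>x. f x * (sb x * r x)))"
      unfolding pairing_scale_left mult.assoc A.I_scale by (simp add: right_diff_distrib)
    fix f' :: "real ^ 'n \<Rightarrow> real" assume f': "f' \<in> Pol (int k - 2)"
    show "pairing El (\<lambda>x. f x + f' x) v - A.I (\<lambda>x. (f x + f' x) * (sb x * r x))
       = (pairing El f v - A.I (\<lambda>x. f x * (sb x * r x))) + (pairing El f' v - A.I (\<lambda>x. f' x * (sb x * r x)))"
      unfolding pairing_add_left[OF pp[OF f] pp[OF f'] v] distrib_right A.I_add[OF prod_p[OF f] prod_p[OF f']] by simp
  qed
  then obtain z where z: "z \<in> Pol (int k - 2)"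
    "\<And>\<zeta>. \<zeta> \<in> Pol (int k - 2) \<Longrightarrow> A.I (\<lambda>x. A.bub x * (\<zeta> x * z x)) = pairing El \<zeta> v - A.I (\<lambda>x. \<zeta> x * (sb x * r x))" by blast
  let ?u = "\<lambda>x. sb x * r x + A.bub x * z x"
  have "Proj k \<beta> El (vertices M g) v = ?u" unfolding Proj_def
  proof (rule the_equality)
    show "?u \<in> V k \<beta> El (vertices M g) \<and> (\<forall>w\<in>Pol_perp (int k) El. D \<beta> El w (\<lambda>x. ?u x - v x) = 0) \<and>
      (\<forall>\<zeta>\<in>Pol (int k - 2). pairing El \<zeta> (\<lambda>x. ?u x - v x) = 0)"
      using cond[OF r(1) z(1)] r z unfolding V_eq by blast
    fix u' assume u': "u' \<in> V k \<beta> El (vertices M g) \<and> (\<forall>w\<in>Pol_perp (int k) El. D \<beta> El w (\<lambda>x. u' x - v x) = 0) \<and>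
      (\<forall>\<zeta>\<in>Pol (int k - 2). pairing El \<zeta> (\<lambda>x. u' x - v x) = 0)"
    then obtain r' z' where r': "r' \<in> Pol_perp (int k) El" and z': "z' \<in> Pol (int k - 2)"
      and eq: "u' = (\<lambda>x. sb x * r' x + A.bub x * z' x)" unfolding V_eq by blast
    have c': "(\<forall>w\<in>Pol_perp (int k) El. E w r' = D \<beta> El w v) \<and>
      (\<forall>\<zeta>\<in>Pol (int k - 2). A.I (\<lambda>x. A.bub x * (\<zeta> x * z' x)) = pairing El \<zeta> v - A.I (\<lambda>x. \<zeta> x * (sb x * r' x)))"
      using u' cond[OF r' z'] unfolding eq by blast
    have "r' = r" by (rule E.form_eqD[OF r' r(1)]) (simp add: c' r(2))
    moreover have "z' = z" by (rule B.form_eqD[OF z' z(1)]) (simp add: c' z(2) \<open>r' = r\<close>)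
    ultimately show "u' = ?u" using eq by simp
  qed
  then show ?thesis using r z by blast
qed

lemma exists_max:
  assumes "rpoly f" shows "\<exists>x\<in>El. \<forall>y\<in>El. \<bar>f y\<bar> \<le> \<bar>f x\<bar>"
proof (rule continuous_attains_sup)
  show "compact El" unfolding El_K by (rule A.K_compact)
  show "El \<noteq> {}" using A.vertex_in_K El_K by blast
  show "continuous_on El (\<lambda>x. \<bar>f x\<bar>)"
    by (intro continuous_on_rabs continuous_on_rpoly assms)
qed

text \<open>\<open>C_r\<close> controls the supremum of \<open>r\<close> times the volume:
  \<open>2 * \<kappa> * Cd\<close> comes from the derivative of the test function, 1 from the
  derivative of \<open>v\<close>. In \<open>C_u\<close> the number of facets bounds
  \<open>sb\<close>, the first summand belongs to \<open>sb * r\<close> and the second to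
  \<open>bub * z\<close>.\<close>

definition "C_r = Cc * ref.I (\<lambda>x::real^'n. 1) * (2 * \<kappa> * Cd + 1)"
definition "C_u = (real CARD('n) + 1) * C_r + Cb * ref.I (\<lambda>x::real^'n. 1) * (1 + (real CARD('n) + 1) * C_r)"

lemma C_r_pos: "0 < C_r"
  unfolding C_r_def using constants ref_vol_pos by (intro mult_pos_pos add_pos_pos) auto

text \<open>\<open>Y\<close> is a bound for the part of the data that does not involve the derivative of \<open>v\<close>.\<close>

lemma Proj_sup_bound:
  assumes v: "integrable (lebesgue_on El) v" and h: "is_weak_deriv \<beta> (interior El) v h" "integrable (lebesgue_on El) h"
    and Y: "0 \<le> Y"
    and Y1: "\<And>w B. w \<in> Pol_perp (int k) El \<Longrightarrow> (\<And>x. x \<in> El \<Longrightarrow> \<bar>frechet_derivative w (at x) \<beta>\<bar> \<le> B) \<Longrightarrow>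
        \<bar>pairing El (\<lambda>x. frechet_derivative w (at x) \<beta>) v\<bar> \<le> B * Y"
    and Y2: "\<And>z B. z \<in> Pol (int k - 2) \<Longrightarrow> (\<And>x. x \<in> El \<Longrightarrow> \<bar>z x\<bar> \<le> B) \<Longrightarrow> \<bar>pairing El z v\<bar> \<le> B * Y"
  shows "Proj k \<beta> El (vertices M g) v \<in> Pol (int k + int CARD('n) + 1) \<and>
    (\<forall>x\<in>El. \<bar>Proj k \<beta> El (vertices M g) v x\<bar> * vol
        \<le> C_u * (Y + diameter El / norm \<beta> * integral\<^sup>L (lebesgue_on El) (\<lambda>x. \<bar>h x\<bar>)))"
proof -
  define n where "n = real CARD('n) + 1"
  define G where "G = integral\<^sup>L (lebesgue_on El) (\<lambda>x. \<bar>h x\<bar>)"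
  define a where "a = diameter El / norm \<beta>"
  define X where "X = Y + a * G"
  have a: "0 < a" using diameter_pos \<beta>_nonzero by (simp add: a_def)
  have G: "0 \<le> G" by (simp add: G_def)
  have X: "Y \<le> X" "a * G \<le> X" "0 \<le> X" using a G Y by (simp_all add: X_def)
  have na: "norm \<beta> / diameter El = 1 / a" by (simp add: a_def)
  obtain r z where r: "r \<in> Pol_perp (int k) El" and z: "z \<in> Pol (int k - 2)"
    and P: "Proj k \<beta> El (vertices M g) v = (\<lambda>x. sb x * r x + A.bub x * z x)"
    and Er: "\<And>w. w \<in> Pol_perp (int k) El \<Longrightarrow> E w r = D \<beta> El w v"
    and Bz: "\<And>\<zeta>. \<zeta> \<in> Pol (int k - 2) \<Longrightarrow> A.I (\<lambda>x. A.bub x * (\<zeta> x * z x)) = pairing El \<zeta> v - A.I (\<lambda>x. \<zeta> x * (sb x * r x))"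
    using Proj_characterization[OF v h] by blast
  note pr = Pol_rpoly[OF Pol_perp_Pol[OF r]] and pz = Pol_rpoly[OF z]
  obtain xr where xr: "xr \<in> El" "\<And>y. y \<in> El \<Longrightarrow> \<bar>r y\<bar> \<le> \<bar>r xr\<bar>" using exists_max[OF pr] by blast
  obtain xz where xz: "xz \<in> El" "\<And>y. y \<in> El \<Longrightarrow> \<bar>z y\<bar> \<le> \<bar>z xz\<bar>" using exists_max[OF pz] by blast
  \<comment> \<open>\<open>R\<close> and \<open>Z\<close> are maxima over \<open>El\<close>; the
    pointwise coercivity estimates are used at the points where they are attained.\<close>
  define R where "R = \<bar>r xr\<bar>"
  define Z where "Z = \<bar>z xz\<bar>"
  have R0: "0 \<le> R" and Z0: "0 \<le> Z" by (simp_all add: R_def Z_def)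
  have R: "\<bar>r y\<bar> \<le> R" and Z: "\<bar>z y\<bar> \<le> Z" if "y \<in> El" for y
    using xr(2)[OF that] xz(2)[OF that] by (simp_all add: R_def Z_def)
  let ?Rv = "ref.I (\<lambda>x::real^'n. 1)"
  have rP: "r \<in> Pol (int k + int CARD('n) + 1)" by (rule Pol_mono[OF Pol_perp_Pol[OF r]]) simp
  have dr: "\<bar>frechet_derivative r (at x) \<beta>\<bar> \<le> 2 * \<kappa> * Cd * (1 / a) * R" if "x \<in> El" for x
    using inverse_estimate[OF rP R that] unfolding na .
  \<comment> \<open>The first equation is tested with \<open>w = r\<close>. The inverse estimate
    costs \<open>1 / a\<close>, which the factor \<open>a\<close> on the left absorbs.\<close>
  have "a * D \<beta> El r v \<le> (2 * \<kappa> * Cd + 1) * R * X"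
  proof -
    have "D \<beta> El r v \<le> 2 * \<kappa> * Cd * (1 / a) * R * Y + R * G"
      unfolding D_eq[OF pr v h] G_def
      using Y1[OF r dr] pairing_bound[OF pr h(2) R] by linarith
    then have "a * D \<beta> El r v \<le> a * (2 * \<kappa> * Cd * (1 / a) * R * Y + R * G)" using a by (intro mult_left_mono) auto
    also have "\<dots> = 2 * \<kappa> * Cd * R * Y + R * (a * G)" using a by (simp add: field_simps)
    also have "\<dots> \<le> 2 * \<kappa> * Cd * R * X + R * X"
      using X R0 constants by (intro add_mono mult_left_mono) auto
    also have "\<dots> = (2 * \<kappa> * Cd + 1) * R * X" by (simp add: algebra_simps)
    finally show ?thesis .
  qed
  then have aD: "Cc * ?Rv * (a * D \<beta> El r v) \<le> Cc * ?Rv * ((2 * \<kappa> * Cd + 1) * R * X)"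
    using constants ref_vol_pos by (intro mult_left_mono) auto
  have "R\<^sup>2 * vol * (1 / a) \<le> Cc * ?Rv * D \<beta> El r v"
    using E_coercive[OF r xr(1)] unfolding na Er[OF r] by (simp add: R_def)
  then have "a * (R\<^sup>2 * vol * (1 / a)) \<le> a * (Cc * ?Rv * D \<beta> El r v)" using a by (intro mult_left_mono) auto
  then have "R\<^sup>2 * vol \<le> Cc * ?Rv * (a * D \<beta> El r v)" using a by (simp add: mult.left_commute)
  \<comment> \<open>Coercivity is quadratic in \<open>R\<close> and the data term linear, so one
    factor \<open>R\<close> cancels unless it is zero.\<close>
  then have "R * (R * vol) \<le> R * (C_r * X)"
    using aD by (simp add: C_r_def power2_eq_square mult_ac)
  then have Rv: "R * vol \<le> C_r * X"
  proof (cases "R = 0")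
    case True
    then show ?thesis using C_r_pos X by simp
  next
    case False
    then have "0 < R" using R0 by simp
    then show ?thesis using \<open>R * (R * vol) \<le> R * (C_r * X)\<close> by (simp only: mult_le_cancel_left_pos)
  qed
  have sbr: "\<bar>sb x * r x\<bar> \<le> n * R" if "x \<in> El" for x
    unfolding abs_mult n_def using sb_bound[OF that] R[OF that] by (intro mult_mono) auto
  \<comment> \<open>The second equation is tested with \<open>\<zeta> = z\<close>; the term with
    \<open>r\<close> on its right-hand side is controlled by the bound on \<open>R * vol\<close>
    just obtained.\<close>
  have "A.I (\<lambda>x. A.bub x * (z x * z x)) \<le> Z * (X + n * (C_r * X))"
  proof -
    have psr: "rpoly (\<lambda>x. z x * (sb x * r x))"
      by (intro rpoly_intros pz pr Pol_rpoly[OF sb_Pol])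
    have "- A.I (\<lambda>x. z x * (sb x * r x)) = A.I (\<lambda>x. (-1) * (z x * (sb x * r x)))" unfolding A.I_scale by simp
    also have "\<dots> \<le> A.I (\<lambda>x. (Z * (n * R)) * 1)"
    proof (rule A.I_mono)
      show "(-1) * (z x * (sb x * r x)) \<le> (Z * (n * R)) * 1" if "x \<in> A.K" for x
      proof -
        have "x \<in> El" using that El_K by simp
        then have "\<bar>z x * (sb x * r x)\<bar> \<le> Z * (n * R)"
          unfolding abs_mult[of "z x"] using Z sbr Z0 by (intro mult_mono) auto
        then show ?thesis by linarith
      qed
    qed (intro rpoly_intros psr)+
    also have "\<dots> = Z * (n * (R * vol))" unfolding A.I_scale by simp
    also have "\<dots> \<le> Z * (n * (C_r * X))" using Z0 Rv by (intro mult_left_mono) (auto simp: n_def)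
    finally have "- A.I (\<lambda>x. z x * (sb x * r x)) \<le> Z * (n * (C_r * X))" .
    moreover have "pairing El z v \<le> Z * X"
    proof -
      have "pairing El z v \<le> Z * Y" using Y2[OF z Z] by linarith
      also have "\<dots> \<le> Z * X" using X Z0 by (intro mult_left_mono) auto
      finally show ?thesis .
    qed
    ultimately show ?thesis unfolding Bz[OF z] by (simp add: distrib_left)
  qed
  then have "Cb * ?Rv * A.I (\<lambda>x. A.bub x * (z x * z x)) \<le> Cb * ?Rv * (Z * (X + n * (C_r * X)))"
    using constants ref_vol_pos by (intro mult_left_mono) auto
  moreover have "Z\<^sup>2 * vol \<le> Cb * ?Rv * A.I (\<lambda>x. A.bub x * (z x * z x))"
    using bub_coercive[OF z xz(1)] by (simp add: Z_def)
  ultimately have "Z * (Z * vol) \<le> Z * (Cb * ?Rv * (1 + n * C_r) * X)"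
    by (simp add: power2_eq_square algebra_simps)
  then have Zv: "Z * vol \<le> Cb * ?Rv * (1 + n * C_r) * X"
  proof (cases "Z = 0")
    case True
    have "0 \<le> Cb * ?Rv * (1 + n * C_r) * X"
      using constants ref_vol_pos C_r_pos X by (intro mult_nonneg_nonneg add_nonneg_nonneg) (auto simp: n_def)
    then show ?thesis using True by simp
  next
    case False
    then have "0 < Z" using Z0 by simp
    then show ?thesis using \<open>Z * (Z * vol) \<le> Z * (Cb * ?Rv * (1 + n * C_r) * X)\<close> by (simp only: mult_le_cancel_left_pos)
  qed
  have "\<bar>sb x * r x + A.bub x * z x\<bar> * vol \<le> C_u * X" if x: "x \<in> El" for x
  proof -
    have "\<bar>A.bub x * z x\<bar> \<le> 1 * Z"
      unfolding abs_mult using bub_le_1[OF x] Z[OF x] by (intro mult_mono) auto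
    then have "\<bar>sb x * r x + A.bub x * z x\<bar> \<le> n * R + Z" using sbr[OF x] by linarith
    then have "\<bar>sb x * r x + A.bub x * z x\<bar> * vol \<le> (n * R + Z) * vol" using vol_pos by (intro mult_right_mono) auto
    also have "\<dots> = n * (R * vol) + Z * vol" by (simp add: algebra_simps)
    also have "\<dots> \<le> n * (C_r * X) + Cb * ?Rv * (1 + n * C_r) * X"
      using Rv Zv by (intro add_mono mult_left_mono) (auto simp: n_def)
    also have "\<dots> = C_u * X" by (simp add: C_u_def n_def algebra_simps)
    finally show ?thesis .
  qed
  then show ?thesis unfolding P using V_Pol[OF Pol_perp_Pol[OF r] z] by (simp add: X_def a_def G_def)
qed

end

section \<open>Stability\<close>

lemma Lr_norm_nonneg: "0 \<le> Lr_norm q K f"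
  by (simp add: Lr_norm_def)

lemma tnorm_nonneg:
  assumes "bounded K" shows "0 \<le> tnorm q \<beta> K v"
  unfolding tnorm_def using diameter_ge_0[OF assms] by (simp add: Lr_norm_nonneg)

text \<open>A closed formula in the reference constants, so that the dependence on
  \<open>\<theta>\<close> is seen to enter through \<open>Cc\<close> alone. The last factor adds the
  bound for the derivative to the one for the function.\<close>

definition stab_const :: "real \<Rightarrow> real \<Rightarrow> real \<Rightarrow> real \<Rightarrow> real \<Rightarrow> real \<Rightarrow> real" where
  "stab_const n \<nu> \<kappa> Cc Cb Cd =
     (let Cr = Cc * \<nu> * (2 * \<kappa> * Cd + 1) in (n * Cr + Cb * \<nu> * (1 + n * Cr)) * (1 + 2 * \<kappa> * Cd))"

context element
begin

definition "C_stab = C_u * (1 + 2 * \<kappa> * Cd)"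

lemma C_stab_eq: "C_stab = stab_const (real CARD('n) + 1) (ref.I (\<lambda>x::real^'n. 1)) \<kappa> Cc Cb Cd"
  unfolding C_stab_def C_u_def C_r_def stab_const_def Let_def ..

lemma C_u_pos: "0 < C_u"
  unfolding C_u_def using constants ref_vol_pos C_r_pos
  by (intro add_pos_pos mult_pos_pos) auto

text \<open>The number \<open>y\<close> stands for the contribution of \<open>v\<close> itself: its
  norm in the general case, zero under the orthogonality conditions. Both final estimates are
  instances.\<close>

lemma Proj_norm_bounds:
  assumes q: "1 < q" and v: "v \<in> W q \<beta> El" and y: "0 \<le> y"
    and Y1: "\<And>w B. w \<in> Pol_perp (int k) El \<Longrightarrow> (\<And>x. x \<in> El \<Longrightarrow> \<bar>frechet_derivative w (at x) \<beta>\<bar> \<le> B) \<Longrightarrow>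
        \<bar>pairing El (\<lambda>x. frechet_derivative w (at x) \<beta>) v\<bar> \<le> B * (vol powr (1 - 1 / q) * y)"
    and Y2: "\<And>z B. z \<in> Pol (int k - 2) \<Longrightarrow> (\<And>x. x \<in> El \<Longrightarrow> \<bar>z x\<bar> \<le> B) \<Longrightarrow>
        \<bar>pairing El z v\<bar> \<le> B * (vol powr (1 - 1 / q) * y)"
  defines "a \<equiv> diameter El / norm \<beta>" and "u \<equiv> Proj k \<beta> El (vertices M g) v"
  shows "Lr_norm q El u \<le> C_u * (y + a * Lr_norm q El (weak_deriv \<beta> El v))"
    and "Lr_norm q El (weak_deriv \<beta> El u) \<le> 2 * \<kappa> * Cd * (1 / a) * (C_u * (y + a * Lr_norm q El (weak_deriv \<beta> El v)))"
proof -
  obtain h where h: "h \<in> Lr q El" "is_weak_deriv \<beta> (interior El) v h" using v by (auto simp: W_def)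
  have vq: "v \<in> Lr q El" using v by (simp add: W_def)
  note iv = Lr_integrable[OF vq q integrable_one] and ih = Lr_integrable[OF h(1) q integrable_one]
  define s where "s = Lr_norm q El (weak_deriv \<beta> El v)"
  have s: "s = Lr_norm q El h"
    unfolding s_def by (rule Lr_norm_cong_negligible[OF El_lebesgue negligible_weak_deriv[OF h(2)] borel_measurable_integrable[OF ih]])
  have a: "0 < a" using diameter_pos \<beta>_nonzero by (simp add: a_def)
  have s0: "0 \<le> s" by (simp add: s_def Lr_norm_nonneg)
  have Y: "0 \<le> vol powr (1 - 1 / q) * y" using y by simp
  have hh: "integral\<^sup>L (lebesgue_on El) (\<lambda>x. \<bar>h x\<bar>) \<le> vol powr (1 - 1 / q) * s"
    unfolding s by (rule Lr_hoelder[OF h(1) q integrable_one vol_eq vol_pos])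
  \<comment> \<open>Hoelder's inequality contributes exponent \<open>1 - 1 / q\<close> and division
    by the volume leaves \<open>- 1 / q\<close>; the L_q norm of a function bounded by
    \<open>S\<close> restores \<open>1 / q\<close>, so no power of the volume remains.\<close>
  define S where "S = vol powr (- (1 / q)) * (C_u * (y + a * s))"
  have S0: "0 \<le> S" unfolding S_def using C_u_pos y a s0 by simp
  have uP: "u \<in> Pol (int k + int CARD('n) + 1)"
    and ub: "\<And>x. x \<in> El \<Longrightarrow> \<bar>u x\<bar> * vol \<le> C_u * (vol powr (1 - 1 / q) * y + a * integral\<^sup>L (lebesgue_on El) (\<lambda>x. \<bar>h x\<bar>))"
    using Proj_sup_bound[OF iv h(2) ih Y Y1 Y2] unfolding u_def a_def by blast+
  note pu = Pol_rpoly[OF uP]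
  have uS: "\<bar>u x\<bar> \<le> S" if x: "x \<in> El" for x
  proof -
    have "\<bar>u x\<bar> * vol \<le> C_u * (vol powr (1 - 1 / q) * y + a * integral\<^sup>L (lebesgue_on El) (\<lambda>x. \<bar>h x\<bar>))" by (rule ub[OF x])
    also have "\<dots> \<le> C_u * (vol powr (1 - 1 / q) * y + a * (vol powr (1 - 1 / q) * s))"
      using C_u_pos a hh by (intro mult_left_mono add_left_mono) auto
    also have "\<dots> = vol powr (1 - 1 / q) * (C_u * (y + a * s))" by (simp add: algebra_simps)
    also have "vol powr (1 - 1 / q) = vol powr (- (1 / q)) * vol" using vol_pos by (simp add: powr_diff powr_minus field_simps)
    finally have "\<bar>u x\<bar> * vol \<le> S * vol" by (simp add: S_def mult_ac)
    then show ?thesis using vol_pos by (simp only: mult_le_cancel_right_pos)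
  qed
  have vS: "vol powr (1 / q) * S = C_u * (y + a * s)"
    using vol_pos by (simp add: S_def powr_minus field_simps)
  have "Lr_norm q El u \<le> vol powr (1 / q) * S"
    using q by (intro Lr_norm_le_sup[OF polynomial_measurable[OF pu] uS S0 _ integrable_one vol_eq vol_pos]) auto
  then show "Lr_norm q El u \<le> C_u * (y + a * Lr_norm q El (weak_deriv \<beta> El v))" unfolding vS s_def .
  note du = rpoly_frechet_derivative[OF pu, of \<beta>]
  have "Lr_norm q El (weak_deriv \<beta> El u) = Lr_norm q El (\<lambda>x. frechet_derivative u (at x) \<beta>)"
    by (rule Lr_norm_cong_negligible[OF El_lebesgue negligible_weak_deriv[OF weak_deriv_polynomial[OF pu]] polynomial_measurable[OF du]])
  also have "\<dots> \<le> vol powr (1 / q) * (2 * \<kappa> * Cd * (1 / a) * S)"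
  proof (rule Lr_norm_le_sup[OF polynomial_measurable[OF du] _ _ _ integrable_one vol_eq vol_pos])
    show "\<bar>frechet_derivative u (at x) \<beta>\<bar> \<le> 2 * \<kappa> * Cd * (1 / a) * S" if "x \<in> El" for x
      using inverse_estimate[OF uP uS that] by (simp add: a_def)
    show "0 \<le> 2 * \<kappa> * Cd * (1 / a) * S" using constants a S0 by simp
  qed (use q in simp)
  also have "\<dots> = 2 * \<kappa> * Cd * (1 / a) * (vol powr (1 / q) * S)" by (simp only: mult_ac)
  finally show "Lr_norm q El (weak_deriv \<beta> El u) \<le> 2 * \<kappa> * Cd * (1 / a) * (C_u * (y + a * Lr_norm q El (weak_deriv \<beta> El v)))"
    unfolding vS s_def .
qed

lemma Proj_stable:
  assumes q: "1 < q" and v: "v \<in> W q \<beta> El"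
  shows "tnorm q \<beta> El (Proj k \<beta> El (vertices M g) v) \<le> C_stab * tnorm q \<beta> El v"
proof -
  define a where "a = diameter El / norm \<beta>"
  have a: "0 < a" using diameter_pos \<beta>_nonzero by (simp add: a_def)
  let ?u = "Proj k \<beta> El (vertices M g) v" and ?y = "Lr_norm q El v"
  have vq: "v \<in> Lr q El" using v by (simp add: W_def)
  note iv = Lr_integrable[OF vq q integrable_one]
  have le: "integral\<^sup>L (lebesgue_on El) (\<lambda>x. \<bar>v x\<bar>) \<le> vol powr (1 - 1 / q) * ?y"
    by (rule Lr_hoelder[OF vq q integrable_one vol_eq vol_pos])
  have bd: "\<bar>pairing El w v\<bar> \<le> B * (vol powr (1 - 1 / q) * ?y)"
    if w: "rpoly w" and B: "\<And>x. x \<in> El \<Longrightarrow> \<bar>w x\<bar> \<le> B" for w B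
  proof -
    obtain x0 where "x0 \<in> El" using A.vertex_in_K El_K by blast
    then have "0 \<le> B" using B[of x0] by linarith
    then have "B * integral\<^sup>L (lebesgue_on El) (\<lambda>x. \<bar>v x\<bar>) \<le> B * (vol powr (1 - 1 / q) * ?y)"
      using le by (intro mult_left_mono)
    then show ?thesis using pairing_bound[OF w iv B] by linarith
  qed
  have bounds: "Lr_norm q El ?u \<le> C_u * (?y + a * Lr_norm q El (weak_deriv \<beta> El v))"
    "Lr_norm q El (weak_deriv \<beta> El ?u) \<le> 2 * \<kappa> * Cd * (1 / a) * (C_u * (?y + a * Lr_norm q El (weak_deriv \<beta> El v)))"
    unfolding a_def
    by (rule Proj_norm_bounds[OF q v Lr_norm_nonneg];
        rule bd, auto intro: rpoly_frechet_derivative Pol_rpoly Pol_perp_Pol)+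
  have "a * Lr_norm q El (weak_deriv \<beta> El ?u) \<le> a * (2 * \<kappa> * Cd * (1 / a) * (C_u * (?y + a * Lr_norm q El (weak_deriv \<beta> El v))))"
    using a by (intro mult_left_mono bounds) auto
  also have "\<dots> = 2 * \<kappa> * Cd * (C_u * (?y + a * Lr_norm q El (weak_deriv \<beta> El v)))" using a by simp
  finally show ?thesis
    using bounds(1) unfolding tnorm_def a_def[symmetric] C_stab_def by (simp add: algebra_simps)
qed

text \<open>The two conditions annihilate exactly the data terms that contain no derivative of
  \<open>v\<close>, so the previous bounds apply with \<open>y = 0\<close>.\<close>

lemma Proj_bound_orthogonal:
  assumes q: "1 < q" and v: "v \<in> W q \<beta> El"
    and z: "\<And>z. z \<in> Pol (int k - 2) \<Longrightarrow> pairing El z v = 0"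
    and w: "\<And>w. w \<in> Pol_perp (int k) El \<Longrightarrow> pairing El (weak_deriv \<beta> El w) v = 0"
  shows "Lr_norm q El (Proj k \<beta> El (vertices M g) v)
      \<le> C_stab * (diameter El / norm \<beta>) * Lr_norm q El (weak_deriv \<beta> El v)"
    and "Lr_norm q El (weak_deriv \<beta> El (Proj k \<beta> El (vertices M g) v))
      \<le> C_stab * Lr_norm q El (weak_deriv \<beta> El v)"
proof -
  define a where "a = diameter El / norm \<beta>"
  have a: "0 < a" using diameter_pos \<beta>_nonzero by (simp add: a_def)
  let ?u = "Proj k \<beta> El (vertices M g) v" and ?s = "Lr_norm q El (weak_deriv \<beta> El v)"
  have s0: "0 \<le> ?s" by (rule Lr_norm_nonneg)
  have vq: "v \<in> Lr q El" using v by (simp add: W_def)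
  note iv = Lr_integrable[OF vq q integrable_one]
  have Y1: "pairing El (\<lambda>x. frechet_derivative w' (at x) \<beta>) v = 0" if w': "w' \<in> Pol_perp (int k) El" for w'
  proof -
    note pw = Pol_rpoly[OF Pol_perp_Pol[OF w']]
    show ?thesis
      using pairing_weak_deriv(2)[OF weak_deriv_polynomial[OF pw]
          polynomial_measurable[OF rpoly_frechet_derivative[OF pw]] borel_measurable_integrable[OF iv]] w[OF w']
      by simp
  qed
  have bounds: "Lr_norm q El ?u \<le> C_u * (0 + a * ?s)"
    "Lr_norm q El (weak_deriv \<beta> El ?u) \<le> 2 * \<kappa> * Cd * (1 / a) * (C_u * (0 + a * ?s))"
    unfolding a_def by (rule Proj_norm_bounds[OF q v order_refl]; simp add: Y1 z)+
  have c: "C_u \<le> C_stab" "2 * \<kappa> * Cd * C_u \<le> C_stab"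
    using C_u_pos constants by (simp_all add: C_stab_def algebra_simps)
  have "Lr_norm q El ?u \<le> C_u * (a * ?s)" using bounds(1) by simp
  also have "\<dots> \<le> C_stab * (a * ?s)" using a s0 by (intro mult_right_mono c) auto
  finally show "Lr_norm q El ?u \<le> C_stab * (diameter El / norm \<beta>) * ?s" by (simp only: a_def mult.assoc)
  have "Lr_norm q El (weak_deriv \<beta> El ?u) \<le> 2 * \<kappa> * Cd * C_u * ?s" using bounds(2) a by simp
  also have "\<dots> \<le> C_stab * ?s" by (intro mult_right_mono c s0)
  finally show "Lr_norm q El (weak_deriv \<beta> El ?u) \<le> C_stab * ?s" .
qed

end

text \<open>The columns of \<open>M\<close> are edge vectors of \<open>K\<close>, hence of length at
  most the diameter. For \<open>k = 1\<close> this bounds the pulled-back direction from below by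
  \<open>norm \<beta> / diameter K\<close>.\<close>

lemma norm_le_pulled_direction:
  fixes M :: "real ^ 'n ^ 'n"
  assumes M: "invertible M" and K: "K = affine_map M g ` ref_simplex"
  shows "norm \<beta> \<le> real CARD('n) * diameter K * norm (matrix_inv M *v \<beta>)"
proof -
  interpret A: barycentric "vertices M g" "aff_lam M g" "aff_dl M" by (rule barycentric_affine[OF M])
  have KA: "K = A.K" unfolding K by (rule affine_K[OF M, symmetric])
  let ?b = "matrix_inv M *v \<beta>"
  have "\<beta> = M *v ?b" by (simp add: matrix_vector_mul_assoc matrix_inv_works[OF M])
  also have "\<dots> = M *v (\<Sum>j\<in>UNIV. ?b $ j *\<^sub>R axis j 1)"
    using basis_expansion[of ?b] by (simp add: scalar_mult_eq_scaleR)
  also have "\<dots> = (\<Sum>j\<in>UNIV. ?b $ j *\<^sub>R (M *v axis j 1))"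
    by (simp add: linear_sum[OF matrix_vector_mul_linear] matrix_vector_mult_scaleR)
  finally have "norm \<beta> = norm (\<Sum>j\<in>UNIV. ?b $ j *\<^sub>R (M *v axis j 1))" by simp
  also have "\<dots> \<le> (\<Sum>j\<in>UNIV. norm (?b $ j *\<^sub>R (M *v axis j 1)))" by (rule norm_sum)
  also have "\<dots> \<le> (\<Sum>j\<in>(UNIV :: 'n set). norm ?b * diameter K)"
  proof (rule sum_mono)
    fix j :: 'n
    have "M *v axis j 1 = vertices M g (Some j) - vertices M g None"
      by (simp add: vertices_def affine_map_def matrix_vector_mult_0_right)
    then have "norm (M *v axis j 1) \<le> diameter K" unfolding KA using A.diameter_edge by simp
    then show "norm (?b $ j *\<^sub>R (M *v axis j 1)) \<le> norm ?b * diameter K"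
      unfolding norm_scaleR by (intro mult_mono) (auto simp: component_le_norm_cart)
  qed
  also have "\<dots> = real CARD('n) * diameter K * norm ?b" by simp
  finally show ?thesis .
qed

theorem theorem6p1:
  fixes k :: nat and p q \<kappa>\<^sub>0 :: real
  assumes "1 \<le> k" and "1 < p" and "q = p / (p - 1)" and "0 < \<kappa>\<^sub>0"
  shows "\<exists>C :: real \<Rightarrow> real.
    (k = 1 \<longrightarrow> (\<forall>\<theta>\<in>{0<..1}. \<forall>\<theta>'\<in>{0<..1}. C \<theta> = C \<theta>')) \<and>
    (\<forall>\<theta>\<^sub>0\<in>{0<..1}.
     \<forall>(\<Omega> :: (real ^ 'n) set) \<T> M g \<beta> \<beta>\<^sub>K a.
       lipschitz_polyhedral_domain \<Omega> \<and>
       conforming_simplicial_mesh \<Omega> \<T> M g \<and>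
       shape_regular \<kappa>\<^sub>0 \<T> M \<and>
       advection_field \<T> \<beta> \<beta>\<^sub>K \<and>
       (\<forall>K. a K = vertices (M K) (g K)) \<and>
       (k = 1 \<or>
        (\<forall>K\<in>\<T>. \<forall>i. \<theta>\<^sub>0 * norm (\<beta>\<^sub>K K) \<le> \<bar>\<beta>\<^sub>K K \<bullet> outward_normal K (facet (a K) i)\<bar>))
       \<longrightarrow>
       (\<forall>K\<in>\<T>. \<forall>v\<in>W q (\<beta>\<^sub>K K) K.
          tnorm q (\<beta>\<^sub>K K) K (Proj k (\<beta>\<^sub>K K) K (a K) v) \<le> C \<theta>\<^sub>0 * tnorm q (\<beta>\<^sub>K K) K v) \<and>
       (\<forall>v\<in>W_mesh q \<beta>\<^sub>K \<T>.
          tnorm_mesh q \<beta>\<^sub>K \<T> (Proj_mesh k \<beta>\<^sub>K a v) \<le> C \<theta>\<^sub>0 * tnorm_mesh q \<beta>\<^sub>K \<T> v) \<and>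
       (\<forall>K\<in>\<T>. \<forall>v\<in>W q (\<beta>\<^sub>K K) K.
          (\<forall>z\<in>Pol (int k - 2). pairing K z v = 0) \<and>
          (\<forall>w\<in>Pol_perp (int k) K. pairing K (weak_deriv (\<beta>\<^sub>K K) K w) v = 0)
          \<longrightarrow>
          Lr_norm q K (Proj k (\<beta>\<^sub>K K) K (a K) v)
            \<le> C \<theta>\<^sub>0 * (diameter K / norm (\<beta>\<^sub>K K)) * Lr_norm q K (weak_deriv (\<beta>\<^sub>K K) K v) \<and>
          Lr_norm q K (weak_deriv (\<beta>\<^sub>K K) K (Proj k (\<beta>\<^sub>K K) K (a K) v))
            \<le> C \<theta>\<^sub>0 * Lr_norm q K (weak_deriv (\<beta>\<^sub>K K) K v)))"
proof -
  have q: "1 < q" unfolding assms(3) using assms(2) by (simp add: less_divide_eq)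
  obtain Cb where Cb: "0 < Cb" "\<And>(f :: real ^ 'n \<Rightarrow> real) x. f \<in> Pol (int k - 2) \<Longrightarrow> x \<in> ref_simplex \<Longrightarrow>
      (f x)\<^sup>2 \<le> Cb * ref.I (\<lambda>x. ref.bub x * (f x * f x))"
    using ref.bub_form_bound[of "int k - 2", where 'a = 'n] unfolding ref_K by blast
  obtain Cd where Cd: "0 < Cd" "\<And>(f :: real ^ 'n \<Rightarrow> real) d R x. f \<in> Pol (int k + int CARD('n) + 1) \<Longrightarrow>
      (\<And>x. x \<in> ref_simplex \<Longrightarrow> \<bar>f x\<bar> \<le> R) \<Longrightarrow> x \<in> ref_simplex \<Longrightarrow>
      \<bar>frechet_derivative f (at x) d\<bar> \<le> Cd * norm d * R"
    using ref.derivative_bound[of "int k + int CARD('n) + 1", where 'a = 'n] unfolding ref_K by blast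
  obtain C1 where C1: "0 < C1" "\<And>r (\<beta> :: real ^ 'n) x. r \<in> Pol 1 \<Longrightarrow> x \<in> ref_simplex \<Longrightarrow>
      (r x)\<^sup>2 * norm \<beta> \<le> C1 * (\<Sum>i\<in>UNIV. \<bar>ref_dl i \<beta>\<bar> * ref.facet_form i r r)"
    using ref_facet_coercive_1[where 'n = 'n] by blast
  obtain C2 where C2: "0 < C2" "\<And>(r :: real ^ 'n \<Rightarrow> real) x. r \<in> Pol_perp (int k) ref_simplex \<Longrightarrow> x \<in> ref_simplex \<Longrightarrow>
      (r x)\<^sup>2 \<le> C2 * (\<Sum>i\<in>UNIV. ref.facet_form i r r)"
    using ref.facet_coercive[of k, where 'a = 'n] unfolding ref_K by blast
  \<comment> \<open>For \<open>k = 1\<close> two facets suffice, and the factor N comes from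
    \<open>norm_le_pulled_direction\<close>; no flux bound enters, so the constant is the same for
    all \<open>\<theta>\<close>. Otherwise every flux is bounded below in terms of
    \<open>\<theta>\<close>, which costs one division by it.\<close>
  define Cc where "Cc \<theta> = (if k = 1 then C1 * real CARD('n) else C2 / \<theta>)" for \<theta>
  define C where "C \<theta> = stab_const (real CARD('n) + 1) (ref.I (\<lambda>x::real^'n. 1)) \<kappa>\<^sub>0 (Cc \<theta>) Cb Cd" for \<theta>
  have element: "element (M K) (g K) (\<beta>\<^sub>K K) k \<kappa>\<^sub>0 (Cc \<theta>) Cb Cd K"
    if \<theta>: "\<theta> \<in> {0<..1}" and mesh: "conforming_simplicial_mesh \<Omega> \<T> M g" and sr: "shape_regular \<kappa>\<^sub>0 \<T> M"
      and adv: "advection_field \<T> \<beta> \<beta>\<^sub>K" and av: "\<forall>K. a K = vertices (M K) (g K)"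
      and flux: "k = 1 \<or> (\<forall>K\<in>\<T>. \<forall>i. \<theta> * norm (\<beta>\<^sub>K K) \<le> \<bar>\<beta>\<^sub>K K \<bullet> outward_normal K (facet (a K) i)\<bar>)"
      and KT: "K \<in> \<T>"
    for \<theta> and \<Omega> :: "(real ^ 'n) set" and \<T> M g \<beta> \<beta>\<^sub>K a K
  proof (rule element.intro)
    have inv: "invertible (M K)" and K: "K = affine_map (M K) (g K) ` ref_simplex"
      using mesh KT by (auto simp: conforming_simplicial_mesh_def)
    interpret A: barycentric "vertices (M K) (g K)" "aff_lam (M K) (g K)" "aff_dl (M K)"
      by (rule barycentric_affine[OF inv])
    have KA: "K = A.K" by (rule trans[OF K affine_K[OF inv, symmetric]])
    have \<beta>0: "\<beta>\<^sub>K K \<noteq> 0" using adv KT by (simp add: advection_field_def)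
    have h: "0 < diameter K" using A.diameter_pos unfolding KA[symmetric] .
    show "invertible (M K)" by (rule inv)
    show "\<beta>\<^sub>K K \<noteq> 0" by (rule \<beta>0)
    show "K = affine_map (M K) (g K) ` ref_simplex" by (rule K)
    show "mat_norm (M K) * mat_norm (matrix_inv (M K)) \<le> \<kappa>\<^sub>0" using sr KT by (simp add: shape_regular_def)
    have "0 < real CARD('n)" by simp
    then show "0 < Cc \<theta>" using C1(1) C2(1) \<theta> by (simp add: Cc_def)
    show "0 < Cb" "0 < Cd" "0 < \<kappa>\<^sub>0" using Cb Cd assms by auto
    show "(f x)\<^sup>2 \<le> Cb * ref.I (\<lambda>x. ref.bub x * (f x * f x))" if "f \<in> Pol (int k - 2)" "x \<in> ref_simplex"
      for f :: "real ^ 'n \<Rightarrow> real" and x by (rule Cb(2)[OF that])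
    show "\<bar>frechet_derivative f (at x) d\<bar> \<le> Cd * norm d * R"
      if "f \<in> Pol (int k + int CARD('n) + 1)" "\<And>x. x \<in> ref_simplex \<Longrightarrow> \<bar>f x\<bar> \<le> R" "x \<in> ref_simplex"
      for f :: "real ^ 'n \<Rightarrow> real" and d R x by (rule Cd(2)[OF that])
    show "(r x)\<^sup>2 * (norm (\<beta>\<^sub>K K) / diameter K) \<le> Cc \<theta> * (\<Sum>i\<in>UNIV. \<bar>aff_dl (M K) i (\<beta>\<^sub>K K)\<bar> * ref.facet_form i r r)"
      if r: "r \<in> Pol_perp (int k) ref_simplex" and x: "x \<in> ref_simplex" for r x
    proof (cases "k = 1")
      case True
      let ?b = "matrix_inv (M K) *v \<beta>\<^sub>K K"
      let ?E = "\<Sum>i\<in>UNIV. \<bar>ref_dl i ?b\<bar> * ref.facet_form i r r"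
      have "norm (\<beta>\<^sub>K K) / diameter K \<le> real CARD('n) * norm ?b"
        using norm_le_pulled_direction[OF inv K, of "\<beta>\<^sub>K K"] h by (simp add: pos_divide_le_eq mult_ac)
      then have "(r x)\<^sup>2 * (norm (\<beta>\<^sub>K K) / diameter K) \<le> (r x)\<^sup>2 * (real CARD('n) * norm ?b)"
        by (intro mult_left_mono) auto
      also have "\<dots> = real CARD('n) * ((r x)\<^sup>2 * norm ?b)" by simp
      also have "\<dots> \<le> real CARD('n) * (C1 * ?E)"
        using Pol_perp_Pol[OF r] True by (intro mult_left_mono C1(2) x) auto
      also have "\<dots> = Cc \<theta> * ?E" using True by (simp add: Cc_def)
      finally show ?thesis by (simp only: aff_dl_def)
    next
      case False
      then have flux: "\<theta> * norm (\<beta>\<^sub>K K) \<le> \<bar>\<beta>\<^sub>K K \<bullet> outward_normal A.K (facet (vertices (M K) (g K)) i)\<bar>" for i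
        using flux KT av unfolding KA[symmetric] by simp
      let ?t = "norm (\<beta>\<^sub>K K) / diameter K"
      have rk: "r \<in> Pol (int k)" by (rule Pol_perp_Pol[OF r])
      have le: "\<theta> * ?t \<le> \<bar>aff_dl (M K) i (\<beta>\<^sub>K K)\<bar>" for i
        using A.dl_lower_bound[OF flux] \<theta> unfolding KA[symmetric] by simp
      have "\<theta> * ?t * (\<Sum>i\<in>UNIV. ref.facet_form i r r) = (\<Sum>i\<in>UNIV. \<theta> * ?t * ref.facet_form i r r)"
        by (rule sum_distrib_left)
      also have "\<dots> \<le> (\<Sum>i\<in>UNIV. \<bar>aff_dl (M K) i (\<beta>\<^sub>K K)\<bar> * ref.facet_form i r r)"
        using le by (intro sum_mono mult_right_mono ref.facet_form_nonneg[OF rk])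
      finally have E: "\<theta> * ?t * (\<Sum>i\<in>UNIV. ref.facet_form i r r) \<le> (\<Sum>i\<in>UNIV. \<bar>aff_dl (M K) i (\<beta>\<^sub>K K)\<bar> * ref.facet_form i r r)" .
      have "(r x)\<^sup>2 * ?t \<le> (C2 * (\<Sum>i\<in>UNIV. ref.facet_form i r r)) * ?t"
        using C2(2)[OF r x] h by (intro mult_right_mono) auto
      also have "\<dots> = C2 / \<theta> * (\<theta> * ?t * (\<Sum>i\<in>UNIV. ref.facet_form i r r))" using \<theta> by simp
      also have "\<dots> \<le> C2 / \<theta> * (\<Sum>i\<in>UNIV. \<bar>aff_dl (M K) i (\<beta>\<^sub>K K)\<bar> * ref.facet_form i r r)"
        using C2(1) \<theta> by (intro mult_left_mono E) auto
      finally show ?thesis using False by (simp only: Cc_def if_False)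
    qed
  qed
  show ?thesis
  proof (intro exI[of _ C] conjI impI ballI allI)
    show "C \<theta> = C \<theta>'" if "k = 1" for \<theta> \<theta>' using that by (simp add: C_def Cc_def)
  next
    fix \<theta> :: real and \<Omega> :: "(real ^ 'n) set" and \<T> M g \<beta> \<beta>\<^sub>K a
    assume \<theta>: "\<theta> \<in> {0<..1}"
      and H: "lipschitz_polyhedral_domain \<Omega> \<and> conforming_simplicial_mesh \<Omega> \<T> M g \<and> shape_regular \<kappa>\<^sub>0 \<T> M \<and>
       advection_field \<T> \<beta> \<beta>\<^sub>K \<and> (\<forall>K. a K = vertices (M K) (g K)) \<and>
       (k = 1 \<or> (\<forall>K\<in>\<T>. \<forall>i. \<theta> * norm (\<beta>\<^sub>K K) \<le> \<bar>\<beta>\<^sub>K K \<bullet> outward_normal K (facet (a K) i)\<bar>))"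
    have el: "element (M K) (g K) (\<beta>\<^sub>K K) k \<kappa>\<^sub>0 (Cc \<theta>) Cb Cd K" if "K \<in> \<T>" for K
    proof (rule element[OF \<theta>, where \<T> = \<T> and a = a and \<Omega> = \<Omega> and \<beta> = \<beta>])
      show "conforming_simplicial_mesh \<Omega> \<T> M g" "shape_regular \<kappa>\<^sub>0 \<T> M" "advection_field \<T> \<beta> \<beta>\<^sub>K"
        "\<forall>K. a K = vertices (M K) (g K)"
        "k = 1 \<or> (\<forall>K\<in>\<T>. \<forall>i. \<theta> * norm (\<beta>\<^sub>K K) \<le> \<bar>\<beta>\<^sub>K K \<bullet> outward_normal K (facet (a K) i)\<bar>)"
        using H by blast+
    qed (rule that)
    have av: "a K = vertices (M K) (g K)" for K using H by simp
    show stable: "tnorm q (\<beta>\<^sub>K K) K (Proj k (\<beta>\<^sub>K K) K (a K) v) \<le> C \<theta> * tnorm q (\<beta>\<^sub>K K) K v"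
      if "K \<in> \<T>" "v \<in> W q (\<beta>\<^sub>K K) K" for K v
      using element.Proj_stable[OF el[OF that(1)] q that(2)]
      unfolding element.C_stab_eq[OF el[OF that(1)]] C_def av .
    { fix K v assume K: "K \<in> \<T>" and v: "v \<in> W q (\<beta>\<^sub>K K) K"
        and orth: "(\<forall>z\<in>Pol (int k - 2). pairing K z v = 0) \<and> (\<forall>w\<in>Pol_perp (int k) K. pairing K (weak_deriv (\<beta>\<^sub>K K) K w) v = 0)"
      note b = element.Proj_bound_orthogonal[OF el[OF K] q v]
      show "Lr_norm q K (Proj k (\<beta>\<^sub>K K) K (a K) v) \<le> C \<theta> * (diameter K / norm (\<beta>\<^sub>K K)) * Lr_norm q K (weak_deriv (\<beta>\<^sub>K K) K v)"
        using b(1) orth unfolding element.C_stab_eq[OF el[OF K]] C_def av by blast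
      show "Lr_norm q K (weak_deriv (\<beta>\<^sub>K K) K (Proj k (\<beta>\<^sub>K K) K (a K) v)) \<le> C \<theta> * Lr_norm q K (weak_deriv (\<beta>\<^sub>K K) K v)"
        using b(2) orth unfolding element.C_stab_eq[OF el[OF K]] C_def av by blast }
    fix v assume v: "v \<in> W_mesh q \<beta>\<^sub>K \<T>"
    have C0: "0 \<le> C \<theta>"
      unfolding C_def stab_const_def Let_def
      using Cb(1) Cd(1) assms(4) ref.I_one_pos[where 'a = 'n] C1(1) C2(1) \<theta>
      by (intro mult_nonneg_nonneg add_nonneg_nonneg) (auto simp: Cc_def)
    have bd: "bounded K" if "K \<in> \<T>" for K
      using compact_imp_bounded[OF barycentric.K_compact[OF barycentric_affine]] affine_K
        element.invertible_M[OF el[OF that]] element.El_def[OF el[OF that]] by metis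
    \<comment> \<open>The elementwise bound is raised to the power \<open>q\<close> and summed;
      \<open>C0\<close> and the nonnegativity of the norms allow the constant to be taken out of the
      power.\<close>
    have "(\<Sum>K\<in>\<T>. tnorm q (\<beta>\<^sub>K K) K (Proj_mesh k \<beta>\<^sub>K a v K) powr q)
        \<le> (\<Sum>K\<in>\<T>. (C \<theta> * tnorm q (\<beta>\<^sub>K K) K (v K)) powr q)"
    proof (rule sum_mono)
      fix K assume K: "K \<in> \<T>"
      then have "v K \<in> W q (\<beta>\<^sub>K K) K" using v by (auto simp: W_mesh_def)
      from stable[OF K this] show "tnorm q (\<beta>\<^sub>K K) K (Proj_mesh k \<beta>\<^sub>K a v K) powr q \<le> (C \<theta> * tnorm q (\<beta>\<^sub>K K) K (v K)) powr q"
        unfolding Proj_mesh_def using q tnorm_nonneg[OF bd[OF K]] by (intro powr_mono2) auto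
    qed
    also have "\<dots> = C \<theta> powr q * (\<Sum>K\<in>\<T>. tnorm q (\<beta>\<^sub>K K) K (v K) powr q)"
      unfolding sum_distrib_left using C0 tnorm_nonneg[OF bd] by (intro sum.cong refl powr_mult)
    finally have "tnorm_mesh q \<beta>\<^sub>K \<T> (Proj_mesh k \<beta>\<^sub>K a v)
        \<le> (C \<theta> powr q * (\<Sum>K\<in>\<T>. tnorm q (\<beta>\<^sub>K K) K (v K) powr q)) powr (1 / q)"
      unfolding tnorm_mesh_def using q by (intro powr_mono2) (auto intro!: sum_nonneg)
    also have "\<dots> = C \<theta> * tnorm_mesh q \<beta>\<^sub>K \<T> v"
      unfolding tnorm_mesh_def using C0 q by (simp add: powr_mult powr_powr sum_nonneg)
    finally show "tnorm_mesh q \<beta>\<^sub>K \<T> (Proj_mesh k \<beta>\<^sub>K a v) \<le> C \<theta> * tnorm_mesh q \<beta>\<^sub>K \<T> v" .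
  qed
qed

end
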